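(* Let $\psi:\mathbb{R}^+\to\mathbb{R}^+$ be a decreasing function with $\tau_\psi\ge2$. Let $I\subset\mathbb{R}$ be an interval and let $f_1,f_2,\lambda\in C^{(2)}(I)$ be such that the curve $\{(f_1(x),f_2(x)):x\in I\}$ is non-degenerate at every point of $I$ except possibly on a set of Hausdorff dimension less than $\frac{3}{\tau_\psi+1}$. Then $$\dim A_2(\psi,\lambda)=\frac{3}{\tau_\psi+1}.$$
   Context: $\tau_\psi:=\liminf_{q\to\infty}\frac{-\log\psi(q)}{\log q}$. The curve is non-degenerate at $x$ if the Wronskian $f_1'(x)f_2''(x)-f_2'(x)f_1''(x)$ is nonzero. For $\mathbf{a}=(a_1,a_2)\in\mathbb{Z}^2$, $|\mathbf{a}|=\max(|a_1|,|a_2|)$; $\|\cdot\|$ is the distance to the nearest integer. $A_2(\psi,\lambda)$ is the set of $x\in I$ such that $\|a_1f_1(x)+a_2f_2(x)+\lambda(x)\|<\psi(|\mathbf{a}|)$ for infinitely many $\mathbf{a}\in\mathbb{Z}^2\setminus\{0\}$. $\dim$ denotes Hausdorff dimension. *)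

theory Defs
  imports "HOL-Analysis.Analysis"
begin

(* The guard gives the empty set weight 0 and, because 0 powr 0 = 0 in Isabelle, makes every
   nonempty set (singletons included) count 1 when s = 0, so that s = 0 is counting measure. *)
definition diam_powr :: "real \<Rightarrow> 'a::metric_space set \<Rightarrow> ennreal" where
  "diam_powr s U = (if U = {} then 0 else if s = 0 then 1 else ennreal (diameter U powr s))"

(* diameter is only meaningful on bounded sets, hence the boundedness condition.
   Finite covers are included, since the U i may be empty. *)
definition hausdorff_premeasure :: "real \<Rightarrow> real \<Rightarrow> 'a::metric_space set \<Rightarrow> ennreal" where
  "hausdorff_premeasure s \<delta> E =
     (INF U \<in> {U :: nat \<Rightarrow> 'a set. E \<subseteq> (\<Union>i. U i) \<and> (\<forall>i. bounded (U i) \<and> diameter (U i) \<le> \<delta>)}.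
        (\<Sum>i. diam_powr s (U i)))"

definition hausdorff_measure :: "real \<Rightarrow> 'a::metric_space set \<Rightarrow> ennreal" where
  "hausdorff_measure s E = (SUP \<delta>\<in>{0<..}. hausdorff_premeasure s \<delta> E)"

(* The empty set has dimension 0 under this definition. *)
definition hausdorff_dim :: "'a::metric_space set \<Rightarrow> ereal" where
  "hausdorff_dim E = Inf {ereal s | s. 0 \<le> s \<and> hausdorff_measure s E = 0}"

(* Derivative relative to I: one-sided at an endpoint of I that belongs to I. *)
definition deriv_in :: "real set \<Rightarrow> (real \<Rightarrow> real) \<Rightarrow> real \<Rightarrow> real" where
  "deriv_in I f x = vector_derivative f (at x within I)"

definition C2_on :: "real set \<Rightarrow> (real \<Rightarrow> real) \<Rightarrow> bool" where
  "C2_on I f \<longleftrightarrow> f differentiable_on I \<and> deriv_in I f differentiable_on I \<and>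
     continuous_on I (deriv_in I (deriv_in I f))"

definition nondegenerate_at ::
    "real set \<Rightarrow> (real \<Rightarrow> real) \<Rightarrow> (real \<Rightarrow> real) \<Rightarrow> real \<Rightarrow> bool" where
  "nondegenerate_at I f1 f2 x \<longleftrightarrow>
     deriv_in I f1 x * deriv_in I (deriv_in I f2) x
       - deriv_in I f2 x * deriv_in I (deriv_in I f1) x \<noteq> 0"

(* May be infinite. *)
definition lower_order :: "(real \<Rightarrow> real) \<Rightarrow> ereal" where
  "lower_order \<psi> = Liminf at_top (\<lambda>q. ereal (- ln (\<psi> q) / ln q))"

definition A2 :: "real set \<Rightarrow> (real \<Rightarrow> real) \<Rightarrow> (real \<Rightarrow> real) \<Rightarrow>
    (real \<Rightarrow> real) \<Rightarrow> (real \<Rightarrow> real) \<Rightarrow> real set" where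
  "A2 I f1 f2 \<psi> \<Lambda> = {x \<in> I. infinite {a :: int \<times> int. a \<noteq> (0, 0) \<and>
     infdist (of_int (fst a) * f1 x + of_int (snd a) * f2 x + \<Lambda> x) \<int>
       < \<psi> (of_int (max \<bar>fst a\<bar> \<bar>snd a\<bar>))}}"

end

theory Submission
  imports Defs
begin

text \<open>
  Away from a set of small dimension \<open>I\<close> is covered by compact arcs on which one of \<open>f1', f2'\<close> is
  bounded away from 0 and, for every vector \<open>a\<close>, the form \<open>F = a1 f1 + a2 f2 + p + \<Lambda>\<close> has first or
  second derivative of the order of \<open>|a|\<close>.

  Upper bound. Fix a dyadic height \<open>q\<close>, let \<open>\<tau>\<close> be slightly below the lower order of \<open>\<psi>\<close>, and put
  \<open>\<delta> = q powr -\<tau>\<close>. The set where \<open>|F| < \<delta>\<close> and \<open>|F'| \<ge> 1\<close>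
  for some \<open>a\<close> of height about \<open>q\<close> is covered by intervals of length about \<open>\<delta> / |F'|\<close>, whose total cost is
  computed by summing over \<open>a1\<close> at a fixed point of the arc. Where \<open>|F'| \<le> 1\<close>, each solution is compared
  with the much larger set where \<open>|F| < 1 / q^2\<close>; the measures of these sets have a sum of order
  \<open>log q\<close>, because two solutions at the same point differ by a solution of the homogeneous problem, and
  homogeneous solutions \<open>v\<close> of comparable height at one point are controlled by their cross products with one
  of them, that is, by rational points very near the curve.

  Lower bound. The same estimates show that outside a set of small measure there is no small value
  of the homogeneous form. At such a point a packing argument gives three independent short vectors,
  hence by rounding an inhomogeneous solution with derivative of order \<open>q\<close> and so a zero of some \<open>F\<close> within
  \<open>4 / q^3\<close>. Since a nested sequence of balls around such zeros avoids any cheap cover, the content is positive.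
\<close>

section \<open>Hausdorff content\<close>

text \<open>Counting explains the exponent: about q^2 pairs (a1, a2) of height q and about q values
  of p give q^3 zeros, each surrounded by an interval of length about q powr -(\<tau> + 1), so the
  cost q^3 * q powr -(s * (\<tau> + 1)) turns from large to small at s = 3 / (\<tau> + 1). The
  obstacle is tangency: where F' nearly vanishes the interval has length about (\<delta> / q)^(1/2),
  and freezing the derivative no longer counts such forms. The threshold 1 / q^2 is the scale of
  Dirichlet's theorem, at which the solution sets have bounded mean multiplicity up to a logarithm;
  a tangential set grows there to length about q^(-3/2), and the ratio (\<delta> / q)^(s/2) *
  q^(3/2) has the same critical exponent. The assumption \<tau> >= 2 keeps \<delta> at or below this
  scale and the critical exponent at most 1. Logarithms are harmless because every s other than the
  critical one leaves a power of q to spare. Content replaces Hausdorff measure because for s > 0 it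
  has the same null sets and needs no bound on the diameters.\<close>

definition hcontent :: "real \<Rightarrow> 'a::metric_space set \<Rightarrow> ennreal" where
  "hcontent s E = (INF U\<in>{U :: nat \<Rightarrow> 'a set. E \<subseteq> (\<Union>i. U i) \<and> (\<forall>i. bounded (U i))}.
     \<Sum>i. ennreal (diameter (U i) powr s))"

lemma hcontent_le:
  assumes "E \<subseteq> (\<Union>i. U i)" "\<And>i. bounded (U i)"
  shows "hcontent s E \<le> (\<Sum>i. ennreal (diameter (U i) powr s))"
  unfolding hcontent_def by (rule INF_lower) (use assms in auto)

lemma hcontent_less_cover:
  assumes "hcontent s E < w"
  obtains U where "E \<subseteq> (\<Union>i::nat. U i)" "\<And>i. bounded (U i)"
    "(\<Sum>i. ennreal (diameter (U i) powr s)) < w"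
  using assms unfolding hcontent_def INF_less_iff by auto

lemma hcontent_mono: "E \<subseteq> F \<Longrightarrow> hcontent s E \<le> hcontent s F"
  unfolding hcontent_def by (rule INF_superset_mono) auto

lemma hcontent_le_diameter:
  assumes "bounded U"
  shows "hcontent s U \<le> ennreal (diameter U powr s)"
proof -
  define V where "V = (\<lambda>i::nat. if i = 0 then U else {})"
  have "hcontent s U \<le> (\<Sum>i. ennreal (diameter (V i) powr s))"
    by (rule hcontent_le) (use assms in \<open>auto simp: V_def\<close>)
  also have "(\<Sum>i. ennreal (diameter (V i) powr s)) = (\<Sum>i\<in>{0}. ennreal (diameter (V i) powr s))"
    by (rule suminf_finite) (auto simp: V_def)
  finally show ?thesis by (simp add: V_def)
qed

lemma hcontent_empty [simp]: "hcontent s {} = 0"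
  using hcontent_le_diameter[of "{}" s] by simp

lemma hcontent_UN:
  fixes E :: "nat \<Rightarrow> 'a::metric_space set"
  shows "hcontent s (\<Union>n. E n) \<le> (\<Sum>n. hcontent s (E n))"
proof (cases "(\<Sum>n. hcontent s (E n)) = \<infinity>")
  case False
  hence fin: "hcontent s (E n) < \<infinity>" for n
    by (metis ennreal_suminf_lessD infinity_ennreal_def less_top)
  show ?thesis
  proof (rule ennreal_le_epsilon)
    fix e :: real assume e: "0 < e"
    have "\<exists>U. E n \<subseteq> (\<Union>i::nat. U i) \<and> (\<forall>i. bounded (U i)) \<and>
       (\<Sum>i. ennreal (diameter (U i) powr s)) < hcontent s (E n) + ennreal (e * (1/2)^Suc n)" for n
    proof -
      have "hcontent s (E n) < hcontent s (E n) + ennreal (e * (1/2)^Suc n)"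
        using fin[of n] e by (simp add: ennreal_add_left_cancel_less[of _ 0, simplified] )
      then show ?thesis by (elim hcontent_less_cover) auto
    qed
    then obtain U where U: "\<And>n. E n \<subseteq> (\<Union>i::nat. U n i)" "\<And>n i. bounded (U n i)"
      "\<And>n. (\<Sum>i. ennreal (diameter (U n i) powr s)) < hcontent s (E n) + ennreal (e * (1/2)^Suc n)"
      by metis
    define V where "V k = (case prod_decode k of (n, i) \<Rightarrow> U n i)" for k
    have "hcontent s (\<Union>n. E n) \<le> (\<Sum>k. ennreal (diameter (V k) powr s))"
    proof (rule hcontent_le)
      show "(\<Union>n. E n) \<subseteq> (\<Union>k. V k)"
      proof
        fix x assume "x \<in> (\<Union>n. E n)"
        then obtain n i where "x \<in> U n i" using U(1) by blast
        hence "x \<in> V (prod_encode (n, i))" by (simp add: V_def)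
        thus "x \<in> (\<Union>k. V k)" by blast
      qed
    qed (auto simp: V_def U(2) split: prod.splits)
    also have "\<dots> = (\<Sum>k. (\<lambda>(n, i). ennreal (diameter (U n i) powr s)) (prod_decode k))"
      by (auto simp: V_def split: prod.splits intro!: suminf_cong)
    also have "\<dots> = (\<Sum>n. \<Sum>i. ennreal (diameter (U n i) powr s))"
      by (rule suminf_ennreal_2dimen) simp
    also have "\<dots> \<le> (\<Sum>n. hcontent s (E n) + ennreal (e * (1/2)^Suc n))"
      by (intro suminf_le) (use U(3) in \<open>auto intro: less_imp_le\<close>)
    also have "\<dots> = (\<Sum>n. hcontent s (E n)) + (\<Sum>n. ennreal (e * (1/2)^Suc n))"
      by (intro suminf_add[symmetric]) auto
    also have "(\<Sum>n. ennreal (e * (1/2)^Suc n)) = ennreal e"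
    proof -
      have "(\<lambda>n. e * (1/2)^Suc n) sums (e * 1)"
        by (intro sums_mult power_half_series)
      thus ?thesis using e by (intro suminf_ennreal_eq) auto
    qed
    finally show "hcontent s (\<Union>n. E n) \<le> (\<Sum>n. hcontent s (E n)) + ennreal e" .
  qed
qed auto

lemma hcontent_Un: "hcontent s (A \<union> B) \<le> hcontent s A + hcontent s B"
proof -
  define E where "E = (\<lambda>i::nat. if i = 0 then A else if i = 1 then B else {})"
  have "A \<union> B \<subseteq> (\<Union>n. E n)"
    unfolding E_def by (auto split: if_splits)
  hence "hcontent s (A \<union> B) \<le> (\<Sum>n. hcontent s (E n))"
    by (rule order_trans[OF hcontent_mono hcontent_UN])
  also have "\<dots> = (\<Sum>n\<in>{0,1}. hcontent s (E n))"
    by (rule suminf_finite) (auto simp: E_def)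
  finally show ?thesis by (simp add: E_def)
qed

lemma hcontent_UN_finite:
  assumes "finite K"
  shows "hcontent s (\<Union>k\<in>K. E k) \<le> (\<Sum>k\<in>K. hcontent s (E k))"
  using assms
proof induction
  case (insert k K)
  have "hcontent s (\<Union>k\<in>insert k K. E k) \<le> hcontent s (E k) + hcontent s (\<Union>k\<in>K. E k)"
    using hcontent_Un[of s "E k"] by simp
  also have "\<dots> \<le> hcontent s (E k) + (\<Sum>k\<in>K. hcontent s (E k))"
    using insert by (intro add_left_mono) auto
  finally show ?case using insert by simp
qed auto

lemma hcontent_UN_null:
  fixes E :: "nat \<Rightarrow> 'a::metric_space set"
  assumes "\<And>n. hcontent s (E n) = 0"
  shows "hcontent s (\<Union>n. E n) = 0"
  using hcontent_UN[of s E] assms by simp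

lemma hcontent_countable_null:
  assumes "countable A" "s > 0"
  shows "hcontent s A = 0"
proof (cases "A = {}")
  case False
  then obtain f :: "nat \<Rightarrow> 'a" where f: "A = range f"
    using assms(1) uncountable_def by metis
  have "hcontent s {f n} = 0" for n
    using hcontent_le_diameter[of "{f n}" s] by simp
  hence "hcontent s (\<Union>n. {f n}) = 0" by (rule hcontent_UN_null)
  thus ?thesis using f by (simp add: UNION_singleton_eq_range)
qed auto

text \<open>The first Borel-Cantelli lemma with content in place of measure: only monotonicity and
  countable subadditivity enter.\<close>

lemma hcontent_limsup_null:
  fixes E :: "nat \<Rightarrow> 'a::metric_space set"
  assumes "\<And>n. hcontent s (E n) \<le> ennreal (w n)" "summable w" "\<And>n. 0 \<le> w n"
  shows "hcontent s {x. infinite {n. x \<in> E n}} = 0"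
proof -
  have "hcontent s {x. infinite {n. x \<in> E n}} \<le> ennreal (\<Sum>n. w (n + N))" for N
  proof -
    have "{x. infinite {n. x \<in> E n}} \<subseteq> (\<Union>n. E (n + N))"
    proof
      fix x assume "x \<in> {x. infinite {n. x \<in> E n}}"
      hence "\<exists>n\<ge>N. x \<in> E n" by (auto simp: infinite_nat_iff_unbounded_le)
      then obtain n where "n \<ge> N" "x \<in> E n" by auto
      hence "x \<in> E ((n - N) + N)" by simp
      thus "x \<in> (\<Union>n. E (n + N))" by blast
    qed
    hence "hcontent s {x. infinite {n. x \<in> E n}} \<le> (\<Sum>n. hcontent s (E (n + N)))"
      using hcontent_UN[of s "\<lambda>n. E (n + N)"] hcontent_mono order_trans by blast
    also have "\<dots> \<le> (\<Sum>n. ennreal (w (n + N)))"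
      by (intro suminf_le assms) auto
    also have "\<dots> = ennreal (\<Sum>n. w (n + N))"
      using assms by (intro suminf_ennreal2) (auto simp: summable_iff_shift)
    finally show ?thesis .
  qed
  moreover have "(\<lambda>N. ennreal (\<Sum>n. w (n + N))) \<longlonglongrightarrow> ennreal 0"
    by (intro tendsto_ennrealI suminf_exist_split2 assms)
  ultimately have "hcontent s {x. infinite {n. x \<in> E n}} \<le> ennreal 0"
    by (intro LIMSEQ_le_const) auto
  thus ?thesis by simp
qed

text \<open>A cover of total cost below \<open>\<delta> powr s\<close> automatically has all
  diameters at most \<delta>, so for null sets the restriction on the diameters costs
  nothing.\<close>

lemma hausdorff_measure_eq_0_iff:
  assumes s: "s > 0"
  shows "hausdorff_measure s E = 0 \<longleftrightarrow> hcontent s E = 0"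
proof -
  have dp: "diam_powr s U = ennreal (diameter U powr s)" for U :: "'a set"
    using s by (simp add: diam_powr_def)
  have "hcontent s E = 0" if "hausdorff_measure s E = 0"
  proof -
    have 0: "hausdorff_premeasure s 1 E = 0"
      using that unfolding hausdorff_measure_def by (simp add: SUP_eq_iff bot_ennreal flip: bot_ennreal)
    have "hcontent s E \<le> hausdorff_premeasure s 1 E"
      unfolding hcontent_def hausdorff_premeasure_def dp by (rule INF_superset_mono) auto
    thus ?thesis using 0 by simp
  qed
  moreover have "hausdorff_measure s E = 0" if 0: "hcontent s E = 0"
  proof -
    have "hausdorff_premeasure s \<delta> E = 0" if d: "\<delta> > 0" for \<delta>
    proof -
      have "hausdorff_premeasure s \<delta> E \<le> 0 + ennreal e" if e: "e > 0" for e
      proof -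
        have "hcontent s E < ennreal (min e (\<delta> powr s))" using 0 e d by simp
        then obtain U where U: "E \<subseteq> (\<Union>i::nat. U i)" "\<And>i. bounded (U i)"
          "(\<Sum>i. ennreal (diameter (U i) powr s)) < ennreal (min e (\<delta> powr s))"
          by (rule hcontent_less_cover) blast
        have "diameter (U i) \<le> \<delta>" for i
        proof -
          have "ennreal (diameter (U i) powr s) < ennreal (min e (\<delta> powr s))"
            using U(3) by (rule ennreal_suminf_lessD)
          hence "diameter (U i) powr s < \<delta> powr s" by (simp add: ennreal_less_iff)
          thus ?thesis using s d powr_mono2[of s \<delta> "diameter (U i)"] by linarith
        qed
        hence "hausdorff_premeasure s \<delta> E \<le> (\<Sum>i. ennreal (diameter (U i) powr s))"
          unfolding hausdorff_premeasure_def dp by (intro INF_lower) (use U in auto)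
        also have "\<dots> \<le> ennreal e" using U(3) e d
          by (meson dual_order.strict_trans1 ennreal_leI less_imp_le min.cobounded1)
        finally show ?thesis by simp
      qed
      hence "hausdorff_premeasure s \<delta> E \<le> 0" by (rule ennreal_le_epsilon)
      thus ?thesis by simp
    qed
    thus ?thesis
      unfolding hausdorff_measure_def by simp
  qed
  ultimately show ?thesis by blast
qed

lemma hcontent_null_mono_exponent:
  assumes "hcontent s E = 0" "0 < s" "s \<le> s'"
  shows "hcontent s' E = 0"
proof -
  have "hcontent s' E \<le> 0 + ennreal e" if e: "e > 0" for e
  proof -
    have "hcontent s E < ennreal (min e 1)" using assms e by simp
    then obtain U where U: "E \<subseteq> (\<Union>i::nat. U i)" "\<And>i. bounded (U i)"
      "(\<Sum>i. ennreal (diameter (U i) powr s)) < ennreal (min e 1)"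
      by (rule hcontent_less_cover) blast
    have le: "diameter (U i) powr s' \<le> diameter (U i) powr s" for i
    proof -
      have "ennreal (diameter (U i) powr s) < ennreal (min e 1)"
        using U(3) by (rule ennreal_suminf_lessD)
      hence "diameter (U i) powr s < 1 powr s" by (simp add: ennreal_less_iff)
      hence "diameter (U i) \<le> 1" using assms powr_mono2[of s 1 "diameter (U i)"] by linarith
      thus ?thesis using assms by (intro powr_mono') (auto simp: diameter_ge_0 U)
    qed
    have "hcontent s' E \<le> (\<Sum>i. ennreal (diameter (U i) powr s'))"
      by (rule hcontent_le) (use U in auto)
    also have "\<dots> \<le> (\<Sum>i. ennreal (diameter (U i) powr s))"
      by (intro suminf_le) (auto intro!: ennreal_leI le)
    also have "\<dots> \<le> ennreal e" using U(3) 
      by (meson dual_order.strict_trans1 ennreal_leI less_imp_le min.cobounded1)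
    finally show ?thesis by simp
  qed
  hence "hcontent s' E \<le> 0" by (rule ennreal_le_epsilon)
  thus ?thesis by simp
qed

text \<open>Exponent 0 has to be treated apart from content: \<open>diam_powr\<close> counts
  singletons there, while \<open>hcontent\<close> gives them the cost
  \<open>0 powr 0 = 0\<close>.\<close>

lemma hausdorff_measure_0_eq_0:
  assumes "hausdorff_measure 0 E = 0"
  shows "E = {}"
proof (rule ccontr)
  assume "E \<noteq> {}"
  have "hausdorff_premeasure 0 1 E \<ge> 1"
    unfolding hausdorff_premeasure_def
  proof (rule INF_greatest)
    fix U assume U: "U \<in> {U :: nat \<Rightarrow> 'a set. E \<subseteq> (\<Union>i. U i) \<and> (\<forall>i. bounded (U i) \<and> diameter (U i) \<le> 1)}"
    then obtain i where "U i \<noteq> {}" using \<open>E \<noteq> {}\<close> by blast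
    hence "1 = diam_powr 0 (U i)" by (simp add: diam_powr_def)
    also have "\<dots> \<le> (\<Sum>i. diam_powr 0 (U i))"
      using ennreal_suminf_lessD[of "\<lambda>i. diam_powr 0 (U i)" "diam_powr 0 (U i)" i] by (meson less_irrefl not_le)
    finally show "1 \<le> (\<Sum>i. diam_powr 0 (U i))" .
  qed
  moreover have "hausdorff_premeasure 0 1 E = 0"
    using assms unfolding hausdorff_measure_def by (simp add: SUP_eq_iff bot_ennreal flip: bot_ennreal)
  ultimately show False by simp
qed

lemma hausdorff_dim_less_imp_null:
  fixes E :: "'a::metric_space set"
  assumes "hausdorff_dim E < ereal s"
  shows "hcontent s E = 0"
proof -
  obtain r where r: "0 \<le> r" "hausdorff_measure r E = 0" "ereal r < ereal s"
    using assms unfolding hausdorff_dim_def Inf_less_iff by auto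
  show ?thesis
  proof (cases "r = 0")
    case True
    hence "E = {}" using r by (intro hausdorff_measure_0_eq_0) auto
    thus ?thesis by simp
  next
    case False
    thus ?thesis using r hausdorff_measure_eq_0_iff[of r E] hcontent_null_mono_exponent[of r E s] by auto
  qed
qed

lemma hausdorff_dim_le:
  assumes "hcontent s E = 0" "s > 0"
  shows "hausdorff_dim E \<le> ereal s"
  unfolding hausdorff_dim_def
  by (rule Inf_lower) (use assms in \<open>auto simp: hausdorff_measure_eq_0_iff\<close>)

lemma hausdorff_dim_nonneg: "0 \<le> hausdorff_dim E"
  unfolding hausdorff_dim_def by (rule Inf_greatest) auto

lemma hausdorff_dim_ge:
  assumes "\<And>s. 0 < s \<Longrightarrow> s < u \<Longrightarrow> hcontent s E \<noteq> 0"
  shows "ereal u \<le> hausdorff_dim E"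
proof (rule ccontr)
  assume "\<not> ?thesis"
  hence "hausdorff_dim E < ereal u" by simp
  then obtain s where s: "hausdorff_dim E < ereal s" "ereal s < ereal u"
    by (metis ereal_dense2 ereal_less_PInfty less_ereal.simps(1) ereal_dense3 dual_order.strict_trans)
  have "0 < s" using s hausdorff_dim_nonneg[of E] by (metis ereal_less(2) le_less_trans)
  thus False using assms[of s] s hausdorff_dim_less_imp_null[of E s] by auto
qed

section \<open>Content and Lebesgue measure on the real line\<close>

lemma subset_interval_diameter:
  fixes U :: "real set"
  assumes "bounded U" "U \<noteq> {}"
  shows "U \<subseteq> {Inf U .. Inf U + diameter U}"
proof
  fix x assume x: "x \<in> U"
  have bb: "bdd_below U" using assms by (simp add: bounded_imp_bdd_below)
  have "x - diameter U \<le> y" if "y \<in> U" for y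
    using diameter_bounded_bound[OF assms(1) x that] by (auto simp: dist_real_def)
  hence "x - diameter U \<le> Inf U" using assms(2) by (intro cInf_greatest) auto
  thus "x \<in> {Inf U .. Inf U + diameter U}" using x bb by (auto intro: cInf_lower)
qed

text \<open>Each cover element lies in a closed interval as long as its diameter. Content bounds
  with exponent 1 thereby become bounds for Lebesgue measure.\<close>

lemma emeasure_le_hcontent:
  fixes A :: "real set"
  assumes "A \<in> sets lborel"
  shows "emeasure lborel A \<le> hcontent 1 A"
  unfolding hcontent_def
proof (rule INF_greatest)
  fix U assume U: "U \<in> {U :: nat \<Rightarrow> real set. A \<subseteq> (\<Union>i. U i) \<and> (\<forall>i. bounded (U i))}"
  define V where "V i = (if U i = {} then {} else {Inf (U i) .. Inf (U i) + diameter (U i)})" for i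
  have V: "U i \<subseteq> V i" for i using subset_interval_diameter[of "U i"] U by (auto simp: V_def)
  have "emeasure lborel A \<le> emeasure lborel (\<Union>i. V i)"
    using U V by (intro emeasure_mono) (force, auto simp: V_def)
  also have "\<dots> \<le> (\<Sum>i. emeasure lborel (V i))"
    by (intro emeasure_subadditive_countably) (auto simp: V_def)
  also have "\<dots> \<le> (\<Sum>i. ennreal (diameter (U i) powr 1))"
    using U by (intro suminf_le) (auto simp: V_def diameter_ge_0)
  finally show "emeasure lborel A \<le> (\<Sum>i. ennreal (diameter (U i) powr 1))" .
qed

text \<open>Cutting a unit interval into n + 1 equal pieces costs (n + 1) powr (1 - s), which tends
  to 0. This disposes of exponents above 1, since the estimates along arcs are restricted to s <=
  1.\<close>

lemma hcontent_bounded_null: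
  fixes E :: "real set"
  assumes "s > 1"
  shows "hcontent s E = 0"
proof -
  have unit: "hcontent s {x..x+1} = 0" for x :: real
  proof -
    have "hcontent s {x..x+1} \<le> ennreal (real (Suc n) powr (1 - s))" for n
    proof -
      define P where "P i = {x + real i / Suc n .. x + real (Suc i) / Suc n}" for i
      have dP: "diameter (P i) = 1 / Suc n" for i
      proof -
        have "real i / Suc n \<le> real (Suc i) / Suc n" by (intro divide_right_mono) auto
        moreover have "real (Suc i) / Suc n - real i / Suc n = 1 / Suc n"
          by (simp add: diff_divide_distrib[symmetric])
        ultimately show ?thesis unfolding P_def by (subst diameter_closed_interval) auto
      qed
      have "{x..x+1} \<subseteq> (\<Union>i\<in>{..n}. P i)"
      proof
        fix y assume y: "y \<in> {x..x+1}"
        show "y \<in> (\<Union>i\<in>{..n}. P i)"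
        proof (cases "y = x + 1")
          case True
          moreover have "real n / real (Suc n) \<le> 1" "real (Suc n) / real (Suc n) = 1" by auto
          ultimately have "y \<in> P n" unfolding P_def by (simp only: atLeastAtMost_iff) linarith
          thus ?thesis by auto
        next
          case False
          define i where "i = nat \<lfloor>(y - x) * Suc n\<rfloor>"
          have 0: "0 \<le> (y - x) * Suc n" using y by auto
          have "(y - x) * Suc n < 1 * real (Suc n)" using y False by (intro mult_strict_right_mono) auto
          hence 1: "(y - x) * Suc n < Suc n" by simp
          have i: "real i \<le> (y - x) * Suc n" "(y - x) * Suc n < real i + 1"
            using 0 unfolding i_def by linarith+
          hence "i \<le> n" using 1 by linarith
          moreover have "real i / Suc n \<le> y - x" "y - x \<le> real (Suc i) / Suc n"
            using i by (auto simp: pos_divide_le_eq pos_le_divide_eq simp del: of_nat_Suc) 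
          hence "y \<in> P i" by (auto simp: P_def)
          ultimately show ?thesis by auto
        qed
      qed
      hence "hcontent s {x..x+1} \<le> (\<Sum>i\<in>{..n}. hcontent s (P i))"
        using hcontent_UN_finite[of "{..n}" s P] hcontent_mono order_trans by blast
      also have "\<dots> \<le> (\<Sum>i\<in>{..n}. ennreal ((1 / Suc n) powr s))"
        by (intro sum_mono order_trans[OF hcontent_le_diameter]) (auto simp: dP, simp add: P_def)
      also have "\<dots> = ennreal (real (Suc n) * (1 / Suc n) powr s)"
        by (simp add: ennreal_mult ennreal_of_nat_eq_real_of_nat)
      also have "real (Suc n) * (1 / Suc n) powr s = real (Suc n) powr (1 - s)"
        by (simp add: powr_divide powr_diff del: of_nat_Suc)
      finally show ?thesis .
    qed
    moreover have "(\<lambda>n. ennreal (real (Suc n) powr (1 - s))) \<longlonglongrightarrow> ennreal 0"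
      by (intro tendsto_ennrealI tendsto_neg_powr filterlim_compose[OF filterlim_real_sequentially filterlim_Suc])
         (use assms in auto)
    ultimately have "hcontent s {x..x+1} \<le> ennreal 0" by (intro LIMSEQ_le_const) auto
    thus ?thesis by simp
  qed
  \<comment> \<open>Every integer is a difference of two naturals, so these unit intervals,
    enumerated by pairs, cover the line.\<close>
  have null: "hcontent s (\<Union>n. case prod_decode n of (i, j) \<Rightarrow> {real i - real j..real i - real j + 1}) = 0"
    by (intro hcontent_UN_null) (auto split: prod.splits simp: unit)
  have "E \<subseteq> (\<Union>n. case prod_decode n of (i, j) \<Rightarrow> {real i - real j..real i - real j + 1})"
  proof
    fix x assume "x \<in> E"
    define k where "k = prod_encode (nat \<lfloor>x\<rfloor>, nat (- \<lfloor>x\<rfloor>))"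
    have "x \<in> (case prod_decode k of (i, j) \<Rightarrow> {real i - real j..real i - real j + 1})"
    proof -
      have "real (nat \<lfloor>x\<rfloor>) - real (nat (- \<lfloor>x\<rfloor>)) = of_int \<lfloor>x\<rfloor>"
        by (cases "0 \<le> \<lfloor>x\<rfloor>") auto
      moreover have "of_int \<lfloor>x\<rfloor> \<le> x" "x \<le> of_int \<lfloor>x\<rfloor> + 1" by linarith+
      ultimately show ?thesis unfolding k_def prod_encode_inverse by auto
    qed
    thus "x \<in> (\<Union>n. case prod_decode n of (i, j) \<Rightarrow> {real i - real j..real i - real j + 1})"
      by (rule UN_I[OF UNIV_I])
  qed
  from hcontent_mono[OF this, of s] show ?thesis unfolding null by simp
qed

section \<open>A lower bound for the content of limsup sets\<close>

lemma card_separated_le: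
  fixes X :: "real set"
  assumes "\<And>x y. x \<in> X \<Longrightarrow> y \<in> X \<Longrightarrow> x \<noteq> y \<Longrightarrow> \<rho> \<le> \<bar>x - y\<bar>"
    and "X \<subseteq> {u..v}" "0 < \<rho>" "u \<le> v"
  shows "real (card X) \<le> (v - u) / \<rho> + 1"
proof -
  define f where "f x = nat \<lfloor>(x - u) / \<rho>\<rfloor>" for x
  have inj: "inj_on f X"
  proof (rule inj_onI, rule ccontr)
    fix x y assume xy: "x \<in> X" "y \<in> X" "f x = f y" "x \<noteq> y"
    have "0 \<le> (x - u) / \<rho>" "0 \<le> (y - u) / \<rho>" using assms xy by auto
    hence "\<lfloor>(x - u) / \<rho>\<rfloor> = \<lfloor>(y - u) / \<rho>\<rfloor>" using xy(3) unfolding f_def by linarith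
    hence "\<bar>(x - u) / \<rho> - (y - u) / \<rho>\<bar> < 1" by linarith
    hence "\<bar>(x - y) / \<rho>\<bar> < 1" by (simp add: diff_divide_distrib)
    hence "\<bar>x - y\<bar> < \<rho>" using assms(3) by (simp add: abs_divide)
    thus False using assms(1)[OF xy(1,2,4)] by simp
  qed
  have sub: "f ` X \<subseteq> {..nat \<lfloor>(v - u) / \<rho>\<rfloor>}"
    unfolding f_def using assms by (auto intro!: nat_mono floor_mono divide_right_mono)
  have "card X = card (f ` X)" using inj by (simp add: card_image)
  also have "\<dots> \<le> card {..nat \<lfloor>(v - u) / \<rho>\<rfloor>}" by (intro card_mono sub) auto
  also have "\<dots> = nat \<lfloor>(v - u) / \<rho>\<rfloor> + 1" by simp
  finally have "real (card X) \<le> real (nat \<lfloor>(v - u) / \<rho>\<rfloor>) + 1" by linarith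
  also have "real (nat \<lfloor>(v - u) / \<rho>\<rfloor>) \<le> (v - u) / \<rho>"
    using assms by (simp add: of_nat_nat)
  finally show ?thesis by simp
qed

text \<open>The intervals of a hypothetical cheap cover are avoided by a nested sequence of balls: among
  well-separated centres, few are hit by a cover element larger than the next balls, and on
  average the smaller elements hitting a ball are cheap relative to the ball.\<close>

lemma limsup_hcontent_pos:
  fixes E :: "nat \<Rightarrow> real set"
  assumes ab: "\<alpha> < \<beta>" and s: "0 < s" "s \<le> 1" and c: "0 < c" "c \<le> 1"
    and step: "\<And>a b L N \<eta>. \<alpha> \<le> a \<Longrightarrow> a < b \<Longrightarrow> b \<le> \<beta> \<Longrightarrow> 0 < \<eta> \<Longrightarrow> 0 < L \<Longrightarrow>
      \<exists>n\<ge>N. \<exists>\<rho> r X. 0 < r \<and> r \<le> \<rho> \<and> r \<le> \<eta> \<and> finite X \<and>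
        (\<forall>x\<in>X. {x - r..x + r} \<subseteq> {a..b} \<inter> E n) \<and>
        (\<forall>x\<in>X. \<forall>y\<in>X. x \<noteq> y \<longrightarrow> \<rho> \<le> \<bar>x - y\<bar>) \<and>
        c * (b - a) \<le> real (card X) * \<rho> \<and> L * \<rho> \<le> r powr s"
  shows "hcontent s {x\<in>{\<alpha>..\<beta>}. infinite {n. x \<in> E n}} \<noteq> 0"
proof
  assume null: "hcontent s {x\<in>{\<alpha>..\<beta>}. infinite {n. x \<in> E n}} = 0"
  \<comment> \<open>The share of cover cost that an interval may carry: below,
    \<open>4 * d * \<theta> = c * d / 4\<close> loses at most a quarter of the centres.\<close>
  define \<theta> where "\<theta> = c / 16"
  have \<theta>: "0 < \<theta>" "\<theta> \<le> 1/16" using c by (auto simp: \<theta>_def)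
  define w where "w = \<theta> * (\<beta> - \<alpha>) powr s / 2"
  have w: "w > 0" using \<theta> ab by (auto simp: w_def)
  have "hcontent s {x\<in>{\<alpha>..\<beta>}. infinite {n. x \<in> E n}} < ennreal w" using null w by simp
  then obtain U where U: "{x\<in>{\<alpha>..\<beta>}. infinite {n. x \<in> E n}} \<subseteq> (\<Union>i::nat. U i)" "\<And>i. bounded (U i)"
     "(\<Sum>i. ennreal (diameter (U i) powr s)) < ennreal w"
    by (rule hcontent_less_cover) blast
  \<comment> \<open>The geometric padding makes every enlarged length \<open>e i\<close> positive,
    even when \<open>U i\<close> is a point or empty; the final contradiction rests on this.\<close>
  define t where "t i = diameter (U i) powr s + w * (1/2)^Suc i" for i
  have fin: "(\<Sum>i. ennreal (diameter (U i) powr s)) < top"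
    using U(3) by (metis ennreal_less_top order_less_trans)
  have sm1: "summable (\<lambda>i. diameter (U i) powr s)"
    using fin by (intro summable_suminf_not_top) auto
  have su1: "(\<Sum>i. diameter (U i) powr s) < w"
  proof -
    have "ennreal (\<Sum>i. diameter (U i) powr s) < ennreal w"
      using U(3) sm1 by (subst (asm) suminf_ennreal2) auto
    thus ?thesis by (simp add: ennreal_less_iff suminf_nonneg sm1)
  qed
  have s2: "(\<lambda>i. w * (1/2)^Suc i) sums (w * 1)" by (intro sums_mult power_half_series)
  have smt: "summable t" unfolding t_def using sm1 s2 by (intro summable_add) (auto simp: sums_iff)
  have sut: "(\<Sum>i. t i) < 2 * w"
    unfolding t_def using sm1 s2 su1 by (subst suminf_add[symmetric]) (auto simp: sums_iff)
  have tpos: "t i > 0" for i unfolding t_def using w by (intro add_nonneg_pos) auto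
  define e where "e i = t i powr (1/s)" for i
  have epos: "e i > 0" for i using tpos[of i] by (simp add: e_def)
  have es: "e i powr s = t i" for i using s tpos[of i] by (simp add: e_def powr_powr)
  have de: "diameter (U i) \<le> e i" for i
  proof -
    have "(diameter (U i) powr s) powr (1/s) \<le> e i" unfolding e_def
      using w s by (intro powr_mono2) (auto simp: t_def)
    thus ?thesis using s diameter_ge_0[OF U(2)] by (simp add: powr_powr)
  qed
  define M where "M a b = {i. U i \<inter> {a..b} \<noteq> {}}" for a b
  have sind: "summable (\<lambda>i. if P i then t i else 0)" for P
    by (rule summable_comparison_test[OF _ smt]) (use tpos in \<open>auto intro!: exI[of _ 0] simp: less_imp_le\<close>)
  \<comment> \<open>The length clause is what permits \<open>e i / d \<le> (e i / d) powr s\<close>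
    in the next step; the cost clause is what averaging passes on to a smaller interval.\<close>
  define Inv where "Inv a b \<longleftrightarrow> \<alpha> \<le> a \<and> a < b \<and> b \<le> \<beta> \<and> (\<forall>i\<in>M a b. e i \<le> b - a) \<and>
     (\<Sum>i. if i \<in> M a b then t i else 0) \<le> \<theta> * (b - a) powr s" for a b
  have powr_le_imp: "x \<le> y" if "x powr s \<le> y powr s" "0 \<le> y" "0 \<le> x" for x y :: real
    using that powr_less_mono2[of s y x] s by linarith
  have Inv0: "Inv \<alpha> \<beta>"
  proof -
    have "e i \<le> \<beta> - \<alpha>" for i
    proof (rule powr_le_imp)
      have "t i \<le> (\<Sum>i. t i)" using tpos smt sum_le_suminf[of t "{i}"] by (auto simp: less_imp_le)
      also have "\<dots> \<le> \<theta> * (\<beta> - \<alpha>) powr s" using sut by (simp add: w_def)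
      also have "\<dots> \<le> 1 * (\<beta> - \<alpha>) powr s" using \<theta> by (intro mult_right_mono) auto
      finally show "e i powr s \<le> (\<beta> - \<alpha>) powr s" by (simp add: es)
    qed (use ab epos[of i] in auto)
    moreover have "(\<Sum>i. if i \<in> M \<alpha> \<beta> then t i else 0) \<le> (\<Sum>i. t i)"
      by (intro suminf_le sind smt) (use tpos in \<open>auto simp: less_imp_le\<close>)
    ultimately show ?thesis using sut ab by (auto simp: Inv_def w_def)
  qed
  have hits: "U i \<subseteq> {u..u + e i}" if "u = Inf (U i)" for u i
    using subset_interval_diameter[of "U i"] U(2)[of i] de[of i] that by (cases "U i = {}") force+
  have Step: "\<exists>n\<ge>N. \<exists>a' b'. a \<le> a' \<and> b' \<le> b \<and> b' - a' \<le> (b - a) / 2 \<and> {a'..b'} \<subseteq> E n \<and> Inv a' b'"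
    if I: "Inv a b" for a b N
  proof -
    have le: "\<alpha> \<le> a" "a < b" "b \<le> \<beta>" and big: "\<And>i. i \<in> M a b \<Longrightarrow> e i \<le> b - a"
      and cost: "(\<Sum>i. if i \<in> M a b then t i else 0) \<le> \<theta> * (b - a) powr s"
      using I by (auto simp: Inv_def)
    define d where "d = b - a"
    have d: "d > 0" using le by (simp add: d_def)
    \<comment> \<open>Chosen so that \<open>L * (c * d) = 10 * d powr s\<close>: the total averaged
      cost \<open>5 * \<theta> * d powr s\<close> then falls short of 3/4 * 10 * \<theta> * d powr
      s, which it would exceed if every remaining centre were bad.\<close>
    define L where "L = 10 * d powr (s - 1) / c"
    have L: "L > 0" using d c by (simp add: L_def)
    have dps: "d powr (s - 1) * d = d powr s" using d by (simp add: powr_diff)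
    obtain n \<rho> r X where n: "n \<ge> N" and r: "0 < r" "r \<le> \<rho>" "r \<le> d / 4" and X: "finite X"
      "\<And>x. x \<in> X \<Longrightarrow> {x - r..x + r} \<subseteq> {a..b} \<inter> E n"
      "\<And>x y. x \<in> X \<Longrightarrow> y \<in> X \<Longrightarrow> x \<noteq> y \<Longrightarrow> \<rho> \<le> \<bar>x - y\<bar>"
      "c * d \<le> real (card X) * \<rho>" "L * \<rho> \<le> r powr s"
      using step[OF le, of "d/4" L N] d L unfolding d_def by auto
    have rho: "\<rho> > 0" using r by simp
    define H where "H i = {x\<in>X. U i \<inter> {x - r..x + r} \<noteq> {}}" for i
    have finH: "finite (H i)" for i using X by (simp add: H_def)
    have HM: "i \<in> M a b" if "x \<in> H i" for x i using that X(2)[of x] by (auto simp: H_def M_def)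
    have cardH: "real (card (H i)) \<le> (e i + 2 * r) / \<rho> + 1" for i
    proof -
      have "H i \<subseteq> {Inf (U i) - r..Inf (U i) + e i + r}"
        using hits[of "Inf (U i)" i] by (force simp: H_def)
      from card_separated_le[OF _ this rho] show ?thesis
        using X(3) r epos[of i] by (auto simp: H_def algebra_simps)
    qed
    \<comment> \<open>Elements longer than the next balls would break the length clause, so every
      centre they touch is discarded; the cost of the other elements is averaged over the remaining
      centres.\<close>
    define Big where "Big = {i. i \<in> M a b \<and> e i > 2 * r}"
    have finBig: "finite Big"
    proof -
      have "t \<longlonglongrightarrow> 0" using smt by (rule summable_LIMSEQ_zero)
      hence "eventually (\<lambda>i. t i < (2 * r) powr s) sequentially"
        using r by (intro order_tendstoD) auto
      then obtain i0 where i0: "\<And>i. i \<ge> i0 \<Longrightarrow> t i < (2 * r) powr s" by (auto simp: eventually_sequentially)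
      have "Big \<subseteq> {..<i0}"
      proof
        fix i assume "i \<in> Big"
        hence "(2 * r) powr s \<le> t i" using r s by (auto simp: Big_def es[symmetric] intro!: powr_mono2)
        thus "i \<in> {..<i0}" using i0[of i] by (auto simp: not_le[symmetric])
      qed
      thus ?thesis by (rule finite_subset) simp
    qed
    define K where "K = (\<Union>i\<in>Big. H i)"
    have finK: "finite K" using finBig finH by (auto simp: K_def)
    have KX: "K \<subseteq> X" by (auto simp: K_def H_def)
    have cX: "real (card X) * \<rho> > 0" using X(4) c d by (smt (verit) mult_pos_pos)
    have Kbound: "real (card K) \<le> real (card X) / 4"
    proof -
      have each: "real (card (H i)) * \<rho> \<le> (2 * d + 1 / L * d powr s) * (t i / d powr s)" if "i \<in> Big" for i
      proof -
        have ei: "e i \<le> d" "e i > 2 * r" using that big by (auto simp: Big_def d_def)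
        have "e i / d \<le> (e i / d) powr s"
          using ei d epos[of i] s powr_mono'[of s 1 "e i / d"] by simp
        also have "\<dots> = t i / d powr s" using d epos[of i] by (simp add: powr_divide es)
        finally have 1: "e i \<le> d * (t i / d powr s)" using d by (simp add: field_simps)
        have "L * \<rho> \<le> t i"
          using X(5) powr_mono2[of s r "e i"] s r ei by (auto simp: es)
        hence "\<rho> \<le> 1 / L * t i" using L by (simp add: field_simps)
        hence 2: "\<rho> \<le> 1 / L * d powr s * (t i / d powr s)" using d by simp
        have "real (card (H i)) * \<rho> \<le> ((e i + 2 * r) / \<rho> + 1) * \<rho>"
          using cardH rho by (intro mult_right_mono) auto
        also have "\<dots> = e i + 2 * r + \<rho>" using rho by (simp add: field_simps)
        also have "\<dots> \<le> 2 * e i + \<rho>" using ei by simp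
        also have "\<dots> \<le> 2 * (d * (t i / d powr s)) + 1 / L * d powr s * (t i / d powr s)"
          using 1 2 by linarith
        finally show ?thesis by (simp add: algebra_simps)
      qed
      have sumBig: "(\<Sum>i\<in>Big. t i) \<le> \<theta> * d powr s"
      proof -
        have "(\<Sum>i\<in>Big. t i) = (\<Sum>i\<in>Big. if i \<in> M a b then t i else 0)"
          by (intro sum.cong) (auto simp: Big_def)
        also have "\<dots> \<le> (\<Sum>i. if i \<in> M a b then t i else 0)"
          by (intro sum_le_suminf sind finBig) (use tpos in \<open>auto simp: less_imp_le\<close>)
        finally show ?thesis using cost by (simp add: d_def)
      qed
      have "real (card K) \<le> (\<Sum>i\<in>Big. real (card (H i)))"
        unfolding K_def of_nat_sum[symmetric] of_nat_le_iff by (rule card_UN_le[OF finBig])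
      hence "real (card K) * \<rho> \<le> (\<Sum>i\<in>Big. real (card (H i))) * \<rho>" using rho by simp
      also have "\<dots> = (\<Sum>i\<in>Big. real (card (H i)) * \<rho>)" by (simp add: sum_distrib_right)
      also have "\<dots> \<le> (\<Sum>i\<in>Big. (2 * d + 1 / L * d powr s) * (t i / d powr s))"
        by (intro sum_mono each)
      also have "\<dots> = (2 * d + 1 / L * d powr s) * ((\<Sum>i\<in>Big. t i) / d powr s)"
        by (simp add: sum_distrib_left sum_divide_distrib)
      also have "\<dots> \<le> (2 * d + 1 / L * d powr s) * \<theta>"
        using sumBig d L by (intro mult_left_mono) (auto simp: field_simps)
      also have "1 / L * d powr s = c * d / 10"
        using c d dps unfolding L_def by (simp add: field_simps)
      also have "(2 * d + c * d / 10) * \<theta> \<le> 4 * d * \<theta>"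
      proof (intro mult_right_mono)
        have "c * d \<le> 1 * d" using c d by (intro mult_right_mono) auto
        thus "2 * d + c * d / 10 \<le> 4 * d" using d by simp
      qed (use \<theta> in auto)
      also have "\<dots> = c * d / 4" by (simp add: \<theta>_def)
      also have "\<dots> \<le> real (card X) * \<rho> / 4" using X(4) by simp
      finally have "real (card K) * \<rho> \<le> (real (card X) / 4) * \<rho>" by simp
      thus ?thesis using rho by simp
    qed
    define \<Phi> where "\<Phi> x = (\<Sum>i. if x \<in> H i \<and> i \<notin> Big then t i else 0)" for x
    have sumPhi: "(\<Sum>x\<in>X. \<Phi> x) \<le> 5 * \<theta> * d powr s"
    proof -
      have "(\<Sum>x\<in>X. \<Phi> x) = (\<Sum>i. \<Sum>x\<in>X. if x \<in> H i \<and> i \<notin> Big then t i else 0)"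
        unfolding \<Phi>_def by (intro suminf_sum[symmetric] sind)
      also have "\<dots> \<le> (\<Sum>i. 5 * (if i \<in> M a b then t i else 0))"
      proof (intro suminf_le summable_mult sind summable_sum)
        fix i
        show "(\<Sum>x\<in>X. if x \<in> H i \<and> i \<notin> Big then t i else 0) \<le> 5 * (if i \<in> M a b then t i else 0)"
        proof (cases "i \<in> M a b \<and> i \<notin> Big")
          case True
          have "(\<Sum>x\<in>X. if x \<in> H i \<and> i \<notin> Big then t i else 0) = (\<Sum>x\<in>H i. t i)"
            using True X(1) by (intro sum.mono_neutral_cong_right) (auto simp: H_def)
          also have "\<dots> = real (card (H i)) * t i" by simp
          \<comment> \<open>An element of length at most 2 * r <= 2 * \<rho> meets the balls of
            radius r around at most 4 + 1 points that are \<rho>-separated.\<close>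
          also have "\<dots> \<le> 5 * t i"
          proof (intro mult_right_mono)
            have "(e i + 2 * r) / \<rho> + 1 \<le> (4 * \<rho>) / \<rho> + 1"
              using True r rho by (intro add_right_mono divide_right_mono) (auto simp: Big_def)
            thus "real (card (H i)) \<le> 5" using cardH[of i] rho by simp
          qed (use tpos[of i] in auto)
          finally show ?thesis using True by simp
        next
          case False
          hence "(\<Sum>x\<in>X. if x \<in> H i \<and> i \<notin> Big then t i else 0) = 0"
            using HM by (intro sum.neutral) auto
          thus ?thesis using tpos[of i] by simp
        qed
      qed
      also have "\<dots> = 5 * (\<Sum>i. if i \<in> M a b then t i else 0)" by (intro suminf_mult sind)
      also have "\<dots> \<le> 5 * (\<theta> * d powr s)" using cost by (simp add: d_def)
      finally show ?thesis by simp
    qed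
    have Phi0: "\<Phi> x \<ge> 0" for x unfolding \<Phi>_def by (intro suminf_nonneg sind) (use tpos in \<open>auto simp: less_imp_le\<close>)
    have "\<exists>x\<in>X - K. \<Phi> x \<le> \<theta> * (2 * r) powr s"
    proof (rule ccontr)
      assume "\<not> ?thesis"
      hence gt: "\<theta> * (2 * r) powr s < \<Phi> x" if "x \<in> X - K" for x using that by force
      have "card (X - K) = card X - card K" using finK KX by (intro card_Diff_subset)
      hence "real (card (X - K)) = real (card X) - real (card K)"
        using card_mono[OF X(1) KX] by simp
      hence cXK: "real (card (X - K)) \<ge> 3/4 * real (card X)" using Kbound by simp
      have "5 * \<theta> * d powr s < 3/4 * (c * d) * (L * \<theta>)"
      proof -
        have "L * (c * d) = 10 * d powr s"
          using c dps unfolding L_def by (simp add: field_simps)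
        moreover have "3/4 * (c * d) * (L * \<theta>) = 3/4 * \<theta> * (L * (c * d))" by simp
        ultimately have eq: "3/4 * (c * d) * (L * \<theta>) = 30/4 * \<theta> * d powr s" by simp
        show ?thesis unfolding eq using \<theta> d by simp
      qed
      also have "\<dots> \<le> 3/4 * (real (card X) * \<rho>) * (L * \<theta>)"
        using X(4) L \<theta> by (intro mult_right_mono mult_left_mono) auto
      also have "\<dots> = (3/4 * real (card X)) * (\<theta> * (L * \<rho>))" by simp
      also have "\<dots> \<le> real (card (X - K)) * (\<theta> * (2 * r) powr s)"
      proof (intro mult_mono cXK mult_nonneg_nonneg mult_left_mono)
        have "r powr s \<le> (2 * r) powr s" using r s by (intro powr_mono2) auto
        thus "L * \<rho> \<le> (2 * r) powr s" using X(5) by simp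
      qed (use \<theta> L rho in auto)
      also have "\<dots> = (\<Sum>x\<in>X - K. \<theta> * (2 * r) powr s)" by simp
      also have "\<dots> \<le> (\<Sum>x\<in>X - K. \<Phi> x)" using gt by (intro sum_mono less_imp_le) auto
      also have "\<dots> \<le> (\<Sum>x\<in>X. \<Phi> x)" using Phi0 X(1) by (intro sum_mono2) auto
      finally show False using sumPhi by simp
    qed
    then obtain x where x: "x \<in> X" "x \<notin> K" "\<Phi> x \<le> \<theta> * (2 * r) powr s" by auto
    have Mx: "i \<in> M (x - r) (x + r) \<longleftrightarrow> x \<in> H i \<and> i \<notin> Big" for i
      using x HM[of x i] by (auto simp: M_def H_def K_def)
    have sub: "{x - r..x + r} \<subseteq> {a..b}" "{x - r..x + r} \<subseteq> E n" using X(2)[OF x(1)] by auto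
    have ends: "a \<le> x - r" "x + r \<le> b" using sub(1) r by auto
    have "Inv (x - r) (x + r)"
      unfolding Inv_def
    proof (intro conjI ballI)
      fix i assume "i \<in> M (x - r) (x + r)"
      hence "x \<in> H i" "i \<notin> Big" using Mx by auto
      thus "e i \<le> x + r - (x - r)" using HM[of x i] by (auto simp: Big_def)
    next
      show "(\<Sum>i. if i \<in> M (x - r) (x + r) then t i else 0) \<le> \<theta> * (x + r - (x - r)) powr s"
        using x(3) unfolding Mx \<Phi>_def by simp
    qed (use ends le r in auto)
    thus ?thesis using n sub ends r by (intro exI[of _ n] conjI exI[of _ "x - r"] exI[of _ "x + r"]) (auto simp: d_def)
  qed
  define Good where "Good (k::nat) = (\<lambda>(a, b, n::nat). Inv a b \<and> (k > 0 \<longrightarrow> {a..b} \<subseteq> E n))" for k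
  have "\<exists>f. \<forall>k. Good k (f k) \<and> (case f k of (a, b, n) \<Rightarrow> case f (Suc k) of (a', b', n') \<Rightarrow>
      a \<le> a' \<and> b' \<le> b \<and> b' - a' \<le> (b - a) / 2 \<and> n < n')"
  proof (rule dependent_nat_choice)
    show "\<exists>x. Good 0 x" using Inv0 by (auto simp: Good_def)
    fix x k assume "Good k x"
    moreover obtain a b n where x: "x = (a, b, n)" by (cases x)
    ultimately have "Inv a b" by (simp add: Good_def)
    from Step[OF this, of "Suc n"] obtain n' a' b' where "n' \<ge> Suc n" "a \<le> a'" "b' \<le> b"
      "b' - a' \<le> (b - a) / 2" "{a'..b'} \<subseteq> E n'" "Inv a' b'" by blast
    thus "\<exists>y. Good (Suc k) y \<and> (case x of (a, b, n) \<Rightarrow> case y of (a', b', n') \<Rightarrow>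
      a \<le> a' \<and> b' \<le> b \<and> b' - a' \<le> (b - a) / 2 \<and> n < n')"
      unfolding x by (intro exI[of _ "(a', b', n')"]) (auto simp: Good_def)
  qed
  then obtain f where "\<forall>k. Good k (f k) \<and> (case f k of (a, b, n) \<Rightarrow> case f (Suc k) of (a', b', n') \<Rightarrow>
      a \<le> a' \<and> b' \<le> b \<and> b' - a' \<le> (b - a) / 2 \<and> n < n')" ..
  hence f: "Good k (f k)" "(case f k of (a, b, n) \<Rightarrow> case f (Suc k) of (a', b', n') \<Rightarrow>
      a \<le> a' \<and> b' \<le> b \<and> b' - a' \<le> (b - a) / 2 \<and> n < n')" for k by auto
  define A where "A k = fst (f k)" for k
  define B where "B k = fst (snd (f k))" for k
  define n where "n k = snd (snd (f k))" for k
  have I: "Inv (A k) (B k)" and sub: "k > 0 \<Longrightarrow> {A k..B k} \<subseteq> E (n k)" for k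
    using f(1)[of k] by (auto simp: Good_def A_def B_def n_def split: prod.splits)
  have ABn: "A k \<le> A (Suc k)" "B (Suc k) \<le> B k" "B (Suc k) - A (Suc k) \<le> (B k - A k) / 2" "n k < n (Suc k)" for k
    using f(2)[of k] by (auto simp: A_def B_def n_def split: prod.splits)
  have lim: "B k - A k \<le> (\<beta> - \<alpha>) * (1/2)^k" for k
  proof (induction k)
    case 0 show ?case using I[of 0] by (simp add: Inv_def)
  next
    case (Suc k) thus ?case using ABn(3)[of k] by simp
  qed
  have AB: "A k \<le> B k" for k using I[of k] by (simp add: Inv_def)
  have lim0: "(\<lambda>k. B k - A k) \<longlonglongrightarrow> 0"
  proof (rule tendsto_sandwich[OF _ _ tendsto_const])
    show "(\<lambda>k. (\<beta> - \<alpha>) * (1/2)^k) \<longlonglongrightarrow> 0"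
      by (intro tendsto_mult_right_zero LIMSEQ_power_zero) auto
  qed (use lim AB in auto)
  have "\<exists>z. ((\<forall>k. A k \<le> z) \<and> A \<longlonglongrightarrow> z) \<and> ((\<forall>k. z \<le> B k) \<and> B \<longlonglongrightarrow> z)"
  proof (rule nested_sequence_unique)
    show "(\<lambda>k. A k - B k) \<longlonglongrightarrow> 0" using tendsto_minus[OF lim0] by simp
  qed (use ABn AB in auto)
  then obtain z where z: "\<And>k. A k \<le> z" "\<And>k. z \<le> B k" by blast
  have smn: "strict_mono n" using ABn(4) by (simp add: strict_mono_Suc_iff)
  have "infinite (n ` {0<..})"
    using smn by (subst finite_image_iff) (auto intro: strict_mono_imp_inj_on inj_on_subset simp: infinite_Ioi)
  moreover have "n ` {0<..} \<subseteq> {m. z \<in> E m}"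
  proof clarify
    fix k :: nat assume "0 < k"
    moreover have "z \<in> {A k..B k}" using z by simp
    ultimately show "z \<in> E (n k)" using sub[of k] by blast
  qed
  ultimately have "infinite {m. z \<in> E m}" by (rule infinite_super[rotated])
  moreover have "z \<in> {\<alpha>..\<beta>}" using z[of 0] I[of 0] by (auto simp: Inv_def)
  ultimately obtain i where i: "z \<in> U i" using U(1) by blast
  \<comment> \<open>The limit point lies in \<open>U i\<close>, so this element meets every interval
    of the sequence and is no longer than any of them.\<close>
  have "e i \<le> B k - A k" for k
  proof -
    have "z \<in> U i \<inter> {A k..B k}" using i z[of k] by simp
    hence "i \<in> M (A k) (B k)" by (auto simp: M_def)
    thus ?thesis using I[of k] by (auto simp: Inv_def)
  qed
  hence "e i \<le> 0" using lim0 by (intro LIMSEQ_le_const) auto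
  thus False using epos[of i] by simp
qed

section \<open>Sublevel sets of functions of class C2\<close>

text \<open>Double counting in integral form: a pointwise bound for the number of sets through x is
  integrated over the interval. It reduces the mean estimates below to counting solutions at a
  single point.\<close>

lemma sum_measure_le_of_card:
  fixes A :: "'i \<Rightarrow> real set" and B :: "'j \<Rightarrow> real set"
  assumes "finite I" "finite K" "\<alpha> \<le> \<beta>"
    and A: "\<And>i. i \<in> I \<Longrightarrow> A i \<in> sets lborel" "\<And>i. i \<in> I \<Longrightarrow> A i \<subseteq> {\<alpha>..\<beta>}"
    and B: "\<And>j. j \<in> K \<Longrightarrow> B j \<in> sets lborel" "\<And>j. j \<in> K \<Longrightarrow> B j \<subseteq> {\<alpha>..\<beta>}"
    and le: "\<And>x. x \<in> {\<alpha>..\<beta>} \<Longrightarrow>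
      real (card {i\<in>I. x \<in> A i}) \<le> c0 + c1 * real (card {j\<in>K. x \<in> B j})"
  shows "(\<Sum>i\<in>I. measure lborel (A i)) \<le> c0 * (\<beta> - \<alpha>) + c1 * (\<Sum>j\<in>K. measure lborel (B j))"
proof -
  have fin: "emeasure lborel S < \<infinity>" if "S \<subseteq> {\<alpha>..\<beta>}" for S
    using emeasure_mono[OF that, of lborel] assms(3) by (auto simp: order_le_less_trans)
  have int: "integrable lborel (indicator S :: real \<Rightarrow> real)" if "S \<in> sets lborel" "S \<subseteq> {\<alpha>..\<beta>}" for S
    using that fin[of S] by (intro integrable_real_indicator) auto
  have cnt: "(\<Sum>i\<in>I. indicator (A i) x) = real (card {i\<in>I. x \<in> A i})" if "finite I" 
    for A :: "'k \<Rightarrow> real set" and I x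
    using that by (simp add: indicator_def sum.If_cases Int_def)
  have "(\<Sum>i\<in>I. measure lborel (A i)) = (\<Sum>i\<in>I. LINT x|lborel. indicator (A i) x)"
    by simp
  also have "\<dots> = (LINT x|lborel. (\<Sum>i\<in>I. indicator (A i) x))"
    using A int by (subst Bochner_Integration.integral_sum) auto
  also have "\<dots> \<le> (LINT x|lborel. c0 * indicator {\<alpha>..\<beta>} x + c1 * (\<Sum>j\<in>K. indicator (B j) x))"
  proof (rule integral_mono)
    show "integrable lborel (\<lambda>x. \<Sum>i\<in>I. indicator (A i) x :: real)"
      using A int by (intro Bochner_Integration.integrable_sum) auto
    show "integrable lborel (\<lambda>x. c0 * indicator {\<alpha>..\<beta>} x + c1 * (\<Sum>j\<in>K. indicator (B j) x) :: real)"
      using B int by (intro Bochner_Integration.integrable_add integrable_mult_right Bochner_Integration.integrable_sum) auto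
    fix x :: real
    show "(\<Sum>i\<in>I. indicator (A i) x) \<le> c0 * indicator {\<alpha>..\<beta>} x + c1 * (\<Sum>j\<in>K. indicator (B j) x)"
    proof (cases "x \<in> {\<alpha>..\<beta>}")
      case True
      thus ?thesis using le[OF True] cnt[OF assms(1), of A x] cnt[OF assms(2), of B x] by simp
    next
      case False
      hence "x \<notin> A i" if "i \<in> I" for i using A(2)[OF that] by blast
      moreover have "x \<notin> B j" if "j \<in> K" for j using B(2)[OF that] False by blast
      ultimately have "(\<Sum>i\<in>I. indicator (A i) x) = (0::real)" "(\<Sum>j\<in>K. indicator (B j) x) = (0::real)"
        by (auto intro!: sum.neutral simp: indicator_def)
      thus ?thesis using False by simp
    qed
  qed
  also have "\<dots> = c0 * (\<beta> - \<alpha>) + c1 * (LINT x|lborel. (\<Sum>j\<in>K. indicator (B j) x))"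
    using B int assms(3) by (subst Bochner_Integration.integral_add) 
      (auto intro!: Bochner_Integration.integrable_sum integrable_mult_right)
  also have "(LINT x|lborel. (\<Sum>j\<in>K. indicator (B j) x)) = (\<Sum>j\<in>K. measure lborel (B j))"
    using B int by (subst Bochner_Integration.integral_sum) auto
  finally show ?thesis .
qed

lemma measure_le_diameter:
  fixes S :: "real set"
  assumes "S \<in> sets lborel" "bounded S"
  shows "measure lborel S \<le> diameter S"
proof (cases "S = {}")
  case False
  have "measure lborel S \<le> measure lborel {Inf S..Inf S + diameter S}"
    by (rule measure_mono_fmeasurable[OF subset_interval_diameter[OF assms(2) False]])
       (use assms in \<open>auto intro: fmeasurable_compact\<close>)
  also have "\<dots> = diameter S" using diameter_ge_0[OF assms(2)] by simp
  finally show ?thesis .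
qed auto

lemma compact_sublevel:
  fixes f :: "real \<Rightarrow> real"
  assumes "continuous_on {\<alpha>..\<beta>} f"
  shows "compact {x\<in>{\<alpha>..\<beta>}. f x \<le> r}"
proof -
  have "closed ({\<alpha>..\<beta>} \<inter> f -` {..r})"
    by (intro continuous_closed_preimage assms) auto
  moreover have "{\<alpha>..\<beta>} \<inter> f -` {..r} = {x\<in>{\<alpha>..\<beta>}. f x \<le> r}" by auto
  ultimately have "closed {x\<in>{\<alpha>..\<beta>}. f x \<le> r}" by simp
  moreover have "bounded {x\<in>{\<alpha>..\<beta>}. f x \<le> r}"
    by (rule bounded_subset[OF bounded_closed_interval[of \<alpha> \<beta>]]) auto
  ultimately show ?thesis by (simp add: compact_eq_bounded_closed)
qed

lemma abs_ge_const_sign: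
  fixes f :: "real \<Rightarrow> real"
  assumes "continuous_on {\<alpha>..\<beta>} f" "0 < k" "\<And>x. x \<in> {\<alpha>..\<beta>} \<Longrightarrow> k \<le> \<bar>f x\<bar>"
  shows "(\<forall>x\<in>{\<alpha>..\<beta>}. k \<le> f x) \<or> (\<forall>x\<in>{\<alpha>..\<beta>}. f x \<le> - k)"
proof (rule ccontr)
  assume "\<not> ?thesis"
  then obtain x y where xy: "x \<in> {\<alpha>..\<beta>}" "y \<in> {\<alpha>..\<beta>}" "f x < k" "f y > - k" by force
  hence "f x \<le> - k" "f y \<ge> k" using assms(3)[of x] assms(3)[of y] by auto
  hence le: "f x \<le> 0" "0 \<le> f y" using assms(2) by linarith+
  have "connected (f ` {\<alpha>..\<beta>})" by (intro connected_continuous_image assms) auto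
  from connectedD_interval[OF this imageI[OF xy(1)] imageI[OF xy(2)] le]
  obtain z where "z \<in> {\<alpha>..\<beta>}" "f z = 0" by force
  thus False using assms(2) assms(3)[of z] by simp
qed

text \<open>The factor stays on the left because D will be a minimal derivative, which may
  vanish.\<close>

lemma diameter_mult_le:
  fixes U :: "real set"
  assumes "bounded U" "0 \<le> D" "0 \<le> e" "\<And>x y. x \<in> U \<Longrightarrow> y \<in> U \<Longrightarrow> D * \<bar>x - y\<bar> \<le> e"
  shows "D * diameter U \<le> e"
proof (cases "D = 0")
  case False
  hence D: "D > 0" using assms by simp
  have "diameter U \<le> e / D"
  proof (rule diameter_le)
    fix x y assume "x \<in> U" "y \<in> U"
    thus "norm (x - y) \<le> e / D" using assms(4)[of x y] D by (simp add: field_simps)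
  qed (use assms D in auto)
  thus ?thesis using D by (simp add: field_simps)
qed (use assms in auto)

lemma diameter_mult_square_le:
  fixes U :: "real set"
  assumes "bounded U" "0 < k" "0 \<le> e" "\<And>x y. x \<in> U \<Longrightarrow> y \<in> U \<Longrightarrow> k * (x - y)\<^sup>2 \<le> e"
  shows "k * (diameter U)\<^sup>2 \<le> e"
proof -
  have "1 * diameter U \<le> sqrt (e / k)"
  proof (rule diameter_mult_le)
    fix x y assume "x \<in> U" "y \<in> U"
    hence "(x - y)\<^sup>2 \<le> e / k" using assms(4)[of x y] assms(2) by (simp add: field_simps)
    thus "1 * \<bar>x - y\<bar> \<le> sqrt (e / k)" using real_sqrt_le_mono by fastforce
  qed (use assms in auto)
  hence "(diameter U)\<^sup>2 \<le> (sqrt (e / k))\<^sup>2" using diameter_ge_0[OF assms(1)] by (intro power_mono) auto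
  thus ?thesis using assms by (simp add: field_simps)
qed

locale C2_function =
  fixes \<alpha> \<beta> :: real and g g' g'' :: "real \<Rightarrow> real" and M :: real
  assumes ab: "\<alpha> < \<beta>" "\<beta> - \<alpha> \<le> 1"
    and deriv: "\<And>x. x \<in> {\<alpha>..\<beta>} \<Longrightarrow> (g has_real_derivative g' x) (at x)"
      "\<And>x. x \<in> {\<alpha>..\<beta>} \<Longrightarrow> (g' has_real_derivative g'' x) (at x)"
    and cont'': "continuous_on {\<alpha>..\<beta>} g''"
    and bound: "\<And>x. x \<in> {\<alpha>..\<beta>} \<Longrightarrow> \<bar>g'' x\<bar> \<le> M"
begin

lemma M_nonneg: "0 \<le> M" using bound[of \<alpha>] ab by force

lemma cont: "continuous_on {\<alpha>..\<beta>} g"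
  using deriv(1) DERIV_isCont by (intro continuous_at_imp_continuous_on) blast

lemma cont': "continuous_on {\<alpha>..\<beta>} g'"
  using deriv(2) DERIV_isCont by (intro continuous_at_imp_continuous_on) blast

lemma taylor:
  assumes "u \<in> {\<alpha>..\<beta>}" "v \<in> {\<alpha>..\<beta>}"
  obtains t where "t \<in> {\<alpha>..\<beta>}" "g v = g u + g' u * (v - u) + g'' t / 2 * (v - u)\<^sup>2"
proof (cases "u = v")
  case True
  thus ?thesis using that[of u] assms by simp
next
  case False
  define d where "d m = (if m = 0 then g else if m = 1 then g' else g'')" for m :: nat
  have "\<exists>t. (if v < u then v < t \<and> t < u else u < t \<and> t < v) \<and>
      g v = (\<Sum>m<2. d m u / fact m * (v - u) ^ m) + d 2 t / fact 2 * (v - u) ^ 2"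
    by (rule Taylor[of 2 d g \<alpha> \<beta>]) (use assms False deriv in \<open>auto simp: d_def less_2_cases_iff\<close>)
  then obtain t where t: "if v < u then v < t \<and> t < u else u < t \<and> t < v"
     "g v = (\<Sum>m<2. d m u / fact m * (v - u) ^ m) + d 2 t / fact 2 * (v - u) ^ 2" by blast
  have "t \<in> {\<alpha>..\<beta>}" using t(1) assms by (auto split: if_splits)
  moreover have "g v = g u + g' u * (v - u) + g'' t / 2 * (v - u)\<^sup>2"
    using t(2) by (simp add: d_def numeral_2_eq_2)
  ultimately show ?thesis by (rule that)
qed

lemma mvt:
  assumes "u \<in> {\<alpha>..\<beta>}" "v \<in> {\<alpha>..\<beta>}"
  obtains t where "t \<in> {min u v..max u v}" "g v - g u = g' t * (v - u)"
proof -
  consider "u = v" | "u < v" | "v < u" by linarith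
  thus ?thesis
  proof cases
    case 2
    have "\<exists>z>u. z < v \<and> g v - g u = (v - u) * g' z"
      by (rule MVT2) (use 2 assms deriv in auto)
    then obtain z where "u < z" "z < v" "g v - g u = (v - u) * g' z" by blast
    thus ?thesis using 2 by (intro that[of z]) (auto simp: mult.commute)
  next
    case 3
    have "\<exists>z>v. z < u \<and> g u - g v = (u - v) * g' z"
      by (rule MVT2) (use 3 assms deriv in auto)
    then obtain z where "v < z" "z < u" "g u - g v = (u - v) * g' z" by blast
    thus ?thesis using 3 by (intro that[of z]) (auto simp: algebra_simps)
  qed (use that in auto)
qed

lemma deriv_lipschitz:
  assumes "u \<in> {\<alpha>..\<beta>}" "v \<in> {\<alpha>..\<beta>}"
  shows "\<bar>g' v - g' u\<bar> \<le> M * \<bar>v - u\<bar>"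
proof (cases "u = v")
  case False
  have *: "\<bar>g' y - g' x\<bar> \<le> M * \<bar>y - x\<bar>" if "x < y" "x \<in> {\<alpha>..\<beta>}" "y \<in> {\<alpha>..\<beta>}" for x y
  proof -
    have "\<exists>z>x. z < y \<and> g' y - g' x = (y - x) * g'' z"
      by (rule MVT2) (use that deriv in auto)
    then obtain z where z: "x < z" "z < y" "g' y - g' x = (y - x) * g'' z" by blast
    have "\<bar>g'' z\<bar> \<le> M" using z that by (intro bound) auto
    thus ?thesis using that unfolding z(3) abs_mult by (simp add: mult.commute mult_right_mono)
  qed
  show ?thesis using *[of u v] *[of v u] False assms by (cases "u < v") (auto simp: abs_minus_commute)
qed auto

lemma compact_small: "compact {x\<in>{\<alpha>..\<beta>}. \<bar>g x\<bar> \<le> e \<and> \<bar>g' x\<bar> \<le> \<Lambda>}"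
proof -
  have "compact {x\<in>{\<alpha>..\<beta>}. max (\<bar>g x\<bar> - e) (\<bar>g' x\<bar> - \<Lambda>) \<le> 0}"
    by (intro compact_sublevel continuous_intros cont cont')
  thus ?thesis by (simp add: conj_commute)
qed

text \<open>Where \<open>g\<close> is convex or concave, the sublevel set is split at the critical point.\<close>

lemma small_set_split:
  assumes k: "0 < k" and e: "0 < e"
    and alt: "(\<forall>x\<in>{\<alpha>..\<beta>}. k \<le> \<bar>g' x\<bar>) \<or> (\<forall>x\<in>{\<alpha>..\<beta>}. k \<le> \<bar>g'' x\<bar>)"
    and ne: "{x\<in>{\<alpha>..\<beta>}. \<bar>g x\<bar> \<le> e \<and> \<bar>g' x\<bar> \<le> \<Lambda>} \<noteq> {}" (is "?E \<noteq> {}")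
  obtains x0 U1 U2 where "x0 \<in> ?E" "?E = U1 \<union> U2"
    "\<And>U. U = U1 \<or> U = U2 \<Longrightarrow> bounded U \<and> \<bar>g' x0\<bar> * diameter U \<le> 2 * e \<and> k * (diameter U)\<^sup>2 \<le> 4 * e"
proof -
  \<comment> \<open>Taking x0 where |g'| is least on the set makes one number D control the
    diameters here and the enlargement of the set later.\<close>
  have "continuous_on ?E (\<lambda>x. \<bar>g' x\<bar>)"
    by (intro continuous_intros continuous_on_subset[OF cont']) auto
  from continuous_attains_inf[OF compact_small ne this]
  obtain x0 where x0: "x0 \<in> ?E" "\<And>y. y \<in> ?E \<Longrightarrow> \<bar>g' x0\<bar> \<le> \<bar>g' y\<bar>" by auto
  define D where "D = \<bar>g' x0\<bar>"
  have bE: "bounded ?E" using compact_small by (rule compact_imp_bounded)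
  define U1 where "U1 = {x\<in>?E. 0 \<le> g' x}"
  define U2 where "U2 = {x\<in>?E. g' x \<le> 0}"
  have EU: "?E = U1 \<union> U2" by (auto simp: U1_def U2_def)
  have bU: "bounded U" if "U = U1 \<or> U = U2" for U
    using that bE by (auto simp: U1_def U2_def intro: bounded_subset)
  have main: "D * \<bar>x - y\<bar> \<le> 2 * e \<and> k * (x - y)\<^sup>2 \<le> 4 * e"
    if U: "U = U1 \<or> U = U2" and "x \<in> U" "y \<in> U" "x < y" for U x y
  proof -
    have xy: "x \<in> ?E" "y \<in> ?E" using that by (auto simp: U1_def U2_def)
    hence J: "x \<in> {\<alpha>..\<beta>}" "y \<in> {\<alpha>..\<beta>}" by auto
    have g2: "\<bar>g x - g y\<bar> \<le> 2 * e" using xy by auto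
    have Dx: "D \<le> \<bar>g' x\<bar>" "D \<le> \<bar>g' y\<bar>" using x0(2) xy by (auto simp: D_def)
    show ?thesis
    proof (cases "\<forall>x\<in>{\<alpha>..\<beta>}. k \<le> \<bar>g' x\<bar>")
      case True
      obtain t where t: "t \<in> {min x y..max x y}" "g y - g x = g' t * (y - x)"
        using mvt[OF J] by blast
      have tJ: "t \<in> {\<alpha>..\<beta>}" using t J \<open>x < y\<close> by auto
      have sgn: "(\<forall>x\<in>{\<alpha>..\<beta>}. k \<le> g' x) \<or> (\<forall>x\<in>{\<alpha>..\<beta>}. g' x \<le> - k)"
        by (rule abs_ge_const_sign[OF cont' k]) (use True in auto)
      \<comment> \<open>g is monotone in this case, so the mean value point t also satisfies |g t|
        <= e. Either it lies in the set, where D is minimal, or |g' t| exceeds \<Lambda>, which is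
        at least D.\<close>
      have gt: "\<bar>g t\<bar> \<le> e"
      proof -
        obtain t1 where t1: "t1 \<in> {min x t..max x t}" "g t - g x = g' t1 * (t - x)" using mvt[OF J(1) tJ] by blast
        obtain t2 where t2: "t2 \<in> {min t y..max t y}" "g y - g t = g' t2 * (y - t)" using mvt[OF tJ J(2)] by blast
        have tt: "t1 \<in> {\<alpha>..\<beta>}" "t2 \<in> {\<alpha>..\<beta>}" "x \<le> t" "t \<le> y" using t1 t2 t J \<open>x < y\<close> by auto
        from sgn show ?thesis
        proof
          assume "\<forall>x\<in>{\<alpha>..\<beta>}. k \<le> g' x"
          hence "k \<le> g' t1" "k \<le> g' t2" using tt by auto
          hence "0 \<le> g t - g x" "0 \<le> g y - g t" unfolding t1 t2 using k tt by (auto intro!: mult_nonneg_nonneg)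
          thus ?thesis using xy by auto
        next
          assume "\<forall>x\<in>{\<alpha>..\<beta>}. g' x \<le> - k"
          hence "g' t1 \<le> -k" "g' t2 \<le> - k" using tt by auto
          hence "g t - g x \<le> 0" "g y - g t \<le> 0" unfolding t1 t2 using k tt by (auto intro!: mult_nonpos_nonneg)
          thus ?thesis using xy by auto
        qed
      qed
      have "D \<le> \<bar>g' t\<bar>"
      proof (cases "\<bar>g' t\<bar> \<le> \<Lambda>")
        case True
        thus ?thesis using x0(2)[of t] gt tJ by (auto simp: D_def)
      next
        case False
        thus ?thesis using x0(1) by (auto simp: D_def)
      qed
      moreover have "k \<le> \<bar>g' t\<bar>" using True tJ by blast
      moreover have g2': "\<bar>g' t\<bar> * \<bar>x - y\<bar> \<le> 2 * e"
        using g2 unfolding abs_minus_commute[of "g x"] t(2) abs_mult by (simp add: abs_minus_commute)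
      ultimately have 1: "D * \<bar>x - y\<bar> \<le> 2 * e" and 2: "k * \<bar>x - y\<bar> \<le> 2 * e"
        by (auto intro: order_trans[OF mult_right_mono g2'])
      \<comment> \<open>The length of the interval is at most 1, which turns the linear bound into
        the quadratic one required in both cases.\<close>
      have "\<bar>x - y\<bar> \<le> 1" using J ab by auto
      hence "(k * \<bar>x - y\<bar>) * \<bar>x - y\<bar> \<le> (2 * e) * 1" using e by (intro mult_mono[OF 2]) auto
      moreover have "\<bar>x - y\<bar> * \<bar>x - y\<bar> = (x - y)\<^sup>2" by (metis power2_abs power2_eq_square)
      hence "(k * \<bar>x - y\<bar>) * \<bar>x - y\<bar> = k * (x - y)\<^sup>2" by (simp only: mult.assoc)
      ultimately show ?thesis using 1 e by linarith
    next
      case False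
      hence "\<forall>x\<in>{\<alpha>..\<beta>}. k \<le> \<bar>g'' x\<bar>" using alt by blast
      hence sgn: "(\<forall>x\<in>{\<alpha>..\<beta>}. k \<le> g'' x) \<or> (\<forall>x\<in>{\<alpha>..\<beta>}. g'' x \<le> - k)"
        by (intro abs_ge_const_sign[OF cont'' k]) auto
      \<comment> \<open>Of the two Taylor expansions, from x and from y, the signs of g' and g''
        select the one whose linear and quadratic terms have the same sign; both are then bounded by
        |g x - g y| <= 2 * e.\<close>
      obtain t where t: "t \<in> {\<alpha>..\<beta>}" "g y = g x + g' x * (y - x) + g'' t / 2 * (y - x)\<^sup>2"
        using taylor[OF J] by blast
      obtain u where u: "u \<in> {\<alpha>..\<beta>}" "g x = g y + g' y * (x - y) + g'' u / 2 * (x - y)\<^sup>2"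
        using taylor[OF J(2,1)] by blast
      define z where "z = (y - x)\<^sup>2"
      have z: "z \<ge> 0" "(x - y)\<^sup>2 = z" by (auto simp: z_def power2_commute)
      have zz: "k / 2 * z \<le> g'' v / 2 * z" if "k \<le> g'' v" for v using that z by (intro mult_right_mono) auto
      have zz': "k / 2 * z \<le> - (g'' v / 2 * z)" if "g'' v \<le> - k" for v
      proof -
        have "k / 2 * z \<le> (- g'' v / 2) * z" using that z by (intro mult_right_mono) auto
        thus ?thesis by simp
      qed
      have DD: "D * (y - x) \<le> \<bar>g' x\<bar> * (y - x)" "D * (y - x) \<le> \<bar>g' y\<bar> * (y - x)"
        using Dx \<open>x < y\<close> by (auto intro: mult_right_mono)
      have D0: "0 \<le> D * (y - x)" using \<open>x < y\<close> by (auto simp: D_def)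
      have "D * (y - x) + k / 2 * z \<le> 2 * e"
      proof (cases "U = U1")
        case True
        hence p: "0 \<le> g' x" "0 \<le> g' y" using that by (auto simp: U1_def)
        from sgn show ?thesis
        proof
          assume "\<forall>x\<in>{\<alpha>..\<beta>}. k \<le> g'' x"
          thus ?thesis using t zz[of t] DD p g2 by (auto simp: z_def)
        next
          assume "\<forall>x\<in>{\<alpha>..\<beta>}. g'' x \<le> - k"
          hence "g'' u \<le> - k" using u by blast
          moreover have "g' y * (x - y) = - (g' y * (y - x))" by (simp add: algebra_simps)
          ultimately show ?thesis using u(2) zz'[of u] DD p g2 unfolding z by auto
        qed
      next
        case False
        hence p: "g' x \<le> 0" "g' y \<le> 0" using that by (auto simp: U2_def)
        from sgn show ?thesis
        proof
          assume "\<forall>x\<in>{\<alpha>..\<beta>}. k \<le> g'' x"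
          hence "k \<le> g'' u" using u by blast
          moreover have "g' y * (x - y) = - (g' y * (y - x))" by (simp add: algebra_simps)
          ultimately show ?thesis using u(2) zz[of u] DD p g2 unfolding z by auto
        next
          assume "\<forall>x\<in>{\<alpha>..\<beta>}. g'' x \<le> - k"
          hence "g'' t \<le> - k" using t by blast
          thus ?thesis using t(2) zz'[of t] DD p g2 by (auto simp: z_def)
        qed
      qed
      moreover have "0 \<le> k * z" using k z by simp
      ultimately have "D * (y - x) \<le> 2 * e" "k * z \<le> 4 * e" using D0 by linarith+
      thus ?thesis unfolding z using \<open>x < y\<close> by simp
    qed
  qed
  have main2: "D * \<bar>x - y\<bar> \<le> 2 * e \<and> k * (x - y)\<^sup>2 \<le> 4 * e"
    if U: "U = U1 \<or> U = U2" and "x \<in> U" "y \<in> U" for U x y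
  proof (cases x y rule: linorder_cases)
    case greater
    thus ?thesis using main[OF U that(3,2)] by (simp add: abs_minus_commute[of x y] power2_commute[of x y])
  qed (use main[OF U that(2,3)] e in auto)
  show ?thesis
  proof (rule that[OF x0(1) EU])
    fix U assume U: "U = U1 \<or> U = U2"
    show "bounded U \<and> \<bar>g' x0\<bar> * diameter U \<le> 2 * e \<and> k * (diameter U)\<^sup>2 \<le> 4 * e"
    proof (intro conjI bU[OF U])
      show "\<bar>g' x0\<bar> * diameter U \<le> 2 * e"
        by (rule diameter_mult_le[OF bU[OF U]]) (use main2[OF U] e in \<open>auto simp: D_def\<close>)
      show "k * (diameter U)\<^sup>2 \<le> 4 * e"
        by (rule diameter_mult_square_le[OF bU[OF U] k]) (use main2[OF U] e in auto)
    qed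
  qed
qed

text \<open>Turns a single point of a small set into a lower bound for the measure of an enlarged
  set. The interval of length y has x0 as an endpoint and points towards the farther end of
  {\<alpha>..\<beta>}, hence the bound by half the length.\<close>

lemma neighbourhood_measure:
  assumes "x0 \<in> {\<alpha>..\<beta>}" "\<bar>g x0\<bar> \<le> e0" "0 \<le> y" "y \<le> (\<beta> - \<alpha>) / 2"
    and le: "\<bar>g' x0\<bar> * y + M * y\<^sup>2 / 2 \<le> e - e0" and \<Lambda>: "\<bar>g' x0\<bar> + M * y \<le> \<Lambda>"
  shows "y \<le> measure lborel {x\<in>{\<alpha>..\<beta>}. \<bar>g x\<bar> \<le> e \<and> \<bar>g' x\<bar> \<le> \<Lambda>}"
proof -
  define u where "u = (if x0 \<le> (\<alpha> + \<beta>) / 2 then x0 else x0 - y)"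
  have u: "\<alpha> \<le> u" "u + y \<le> \<beta>" "u \<le> x0" "x0 \<le> u + y" using assms(1,3,4) by (auto simp: u_def)
  have "{u..u + y} \<subseteq> {x\<in>{\<alpha>..\<beta>}. \<bar>g x\<bar> \<le> e \<and> \<bar>g' x\<bar> \<le> \<Lambda>}"
  proof
    fix x assume x: "x \<in> {u..u + y}"
    hence J: "x \<in> {\<alpha>..\<beta>}" and d: "\<bar>x - x0\<bar> \<le> y" using u by auto
    obtain t where t: "t \<in> {\<alpha>..\<beta>}" "g x = g x0 + g' x0 * (x - x0) + g'' t / 2 * (x - x0)\<^sup>2"
      using taylor[OF assms(1) J] by blast
    have "\<bar>g' x0 * (x - x0)\<bar> \<le> \<bar>g' x0\<bar> * y" unfolding abs_mult using d by (intro mult_left_mono) auto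
    moreover have "\<bar>g'' t / 2 * (x - x0)\<^sup>2\<bar> \<le> M / 2 * y\<^sup>2"
      unfolding abs_mult using bound[OF t(1)] d M_nonneg
      by (intro mult_mono) (auto intro!: power_mono simp: power2_le_iff_abs_le assms)
    ultimately have "\<bar>g x\<bar> \<le> e" using t(2) assms(2) le by simp
    moreover have "\<bar>g' x\<bar> \<le> \<Lambda>"
    proof -
      have "M * \<bar>x - x0\<bar> \<le> M * y" using d M_nonneg by (intro mult_left_mono) auto
      thus ?thesis using deriv_lipschitz[OF assms(1) J] \<Lambda> by linarith
    qed
    ultimately show "x \<in> {x\<in>{\<alpha>..\<beta>}. \<bar>g x\<bar> \<le> e \<and> \<bar>g' x\<bar> \<le> \<Lambda>}" using J by simp
  qed
  hence "measure lborel {u..u + y} \<le> measure lborel {x\<in>{\<alpha>..\<beta>}. \<bar>g x\<bar> \<le> e \<and> \<bar>g' x\<bar> \<le> \<Lambda>}"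
    using compact_small fmeasurable_compact by (intro measure_mono_fmeasurable) auto
  thus ?thesis using assms by simp
qed

end

section \<open>Integer vectors and linear forms along an arc\<close>

lemma card_le_fibres:
  assumes "finite S" "\<And>y. card {x\<in>S. \<phi> x = y} \<le> n"
  shows "card S \<le> n * card (\<phi> ` S)"
proof -
  have "S = (\<Union>y\<in>\<phi> ` S. {x\<in>S. \<phi> x = y})" by auto
  hence "card S \<le> (\<Sum>y\<in>\<phi> ` S. card {x\<in>S. \<phi> x = y})"
    using card_UN_le[of "\<phi> ` S" "\<lambda>y. {x\<in>S. \<phi> x = y}"] assms(1) by simp
  also have "\<dots> \<le> (\<Sum>y\<in>\<phi> ` S. n)" by (intro sum_mono assms)
  finally show ?thesis by (simp add: mult.commute)
qed

lemma ints_near: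
  fixes r N :: real
  assumes "0 \<le> N"
  shows "finite {w::int. \<bar>of_int w - r\<bar> \<le> N}" "real (card {w::int. \<bar>of_int w - r\<bar> \<le> N}) \<le> 2 * N + 1"
proof -
  have eq: "{w::int. \<bar>of_int w - r\<bar> \<le> N} = {\<lceil>r - N\<rceil>..\<lfloor>r + N\<rfloor>}"
    by (auto simp: abs_le_iff ceiling_le_iff le_floor_iff)
  show "finite {w::int. \<bar>of_int w - r\<bar> \<le> N}" unfolding eq by simp
  have "real (nat (\<lfloor>r + N\<rfloor> + 1 - \<lceil>r - N\<rceil>)) \<le> 2 * N + 1"
    using assms by (cases "\<lfloor>r + N\<rfloor> + 1 - \<lceil>r - N\<rceil> \<ge> 0") (simp, linarith, simp)
  thus "real (card {w::int. \<bar>of_int w - r\<bar> \<le> N}) \<le> 2 * N + 1" unfolding eq by simp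
qed

text \<open>In a triple (a, b, p) the integer p replaces the distance to the nearest integer by an
  absolute value; \<open>height\<close> therefore ignores it.\<close>

type_synonym ivec = "int \<times> int \<times> int"

definition height :: "ivec \<Rightarrow> real" where
  "height v = (case v of (a, b, p) \<Rightarrow> max \<bar>of_int a\<bar> \<bar>of_int b\<bar>)"

definition smul :: "int \<Rightarrow> ivec \<Rightarrow> ivec" where
  "smul k v = (case v of (a, b, p) \<Rightarrow> (k * a, k * b, k * p))"

definition primitive :: "ivec \<Rightarrow> bool" where
  "primitive v = (case v of (a, b, p) \<Rightarrow> gcd (gcd a b) p = 1)"

text \<open>The coordinates of the cross product are listed with the third one first.\<close>

definition cross :: "ivec \<Rightarrow> ivec \<Rightarrow> ivec" where
  "cross v w = (case v of (a, b, p) \<Rightarrow> case w of (a', b', p') \<Rightarrow>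
     (a * b' - a' * b, b * p' - b' * p, p * a' - p' * a))"

lemma height_smul: "height (smul k v) = \<bar>of_int k\<bar> * height v"
  by (auto simp: height_def smul_def abs_mult max_mult_distrib_left split: prod.splits)

lemma height_diff: "height (v - w) \<le> height v + height w"
  by (cases v; cases w) (auto simp: height_def)

lemma height_eq_0_or_ge_1: "height v = 0 \<or> 1 \<le> height v"
proof (cases v)
  case (fields a b p)
  have "height v = of_int (max \<bar>a\<bar> \<bar>b\<bar>)" unfolding fields by (simp add: height_def)
  moreover have "max \<bar>a\<bar> \<bar>b\<bar> = 0 \<or> 1 \<le> max \<bar>a\<bar> \<bar>b\<bar>" by linarith
  ultimately show ?thesis by auto
qed

lemma cross_diff_right: "cross v (w - w') = cross v w - cross v w'"
  by (cases v; cases w; cases w') (simp add: cross_def algebra_simps)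

text \<open>The Bezout combination that gives 1 on the coordinates of v gives the multiplier k when
  applied to the coordinates of w.\<close>

lemma cross_eq_0_imp_smul:
  assumes "primitive v" "cross v w = 0"
  obtains k where "w = smul k v"
proof -
  obtain a b p where v: "v = (a, b, p)" by (cases v)
  obtain a' b' p' where w: "w = (a', b', p')" by (cases w)
  have eq: "a * b' = a' * b" "b * p' = b' * p" "p * a' = p' * a"
    using assms(2) by (auto simp: cross_def v w zero_prod_def)
  obtain s t where st: "s * a + t * b = gcd a b" using bezout_int by blast
  obtain q r where qr: "q * gcd a b + r * p = gcd (gcd a b) p" using bezout_int by blast
  have one: "q * s * a + q * t * b + r * p = 1"
  proof -
    have "q * (s * a + t * b) + r * p = 1" using qr st assms(1) by (simp add: primitive_def v)
    thus ?thesis by (simp add: algebra_simps)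
  qed
  define k where "k = q * s * a' + q * t * b' + r * p'"
  have "a' = a' * (q * s * a + q * t * b + r * p)" unfolding one by simp
  also have "\<dots> = q * s * a * a' + q * t * (a' * b) + r * (p * a')" by (simp add: algebra_simps)
  also have "\<dots> = k * a" unfolding eq(1)[symmetric] eq(3) by (simp add: k_def algebra_simps)
  finally have 1: "a' = k * a" .
  have "b' = b' * (q * s * a + q * t * b + r * p)" unfolding one by simp
  also have "\<dots> = q * s * (a * b') + q * t * b * b' + r * (b' * p)" by (simp add: algebra_simps)
  also have "\<dots> = k * b" unfolding eq(1) eq(2)[symmetric] by (simp add: k_def algebra_simps)
  finally have 2: "b' = k * b" .
  have "p' = p' * (q * s * a + q * t * b + r * p)" unfolding one by simp
  also have "\<dots> = q * s * (p' * a) + q * t * (b * p') + r * p * p'" by (simp add: algebra_simps)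
  also have "\<dots> = k * p" unfolding eq(3)[symmetric] eq(2) by (simp add: k_def algebra_simps)
  finally have 3: "p' = k * p" .
  show ?thesis using 1 2 3 by (intro that[of k]) (simp add: smul_def v w)
qed

lemma eq_smul_primitive:
  assumes "v \<noteq> 0"
  obtains k v0 where "v = smul k v0" "1 \<le> k" "primitive v0"
proof -
  obtain a b p where v: "v = (a, b, p)" by (cases v)
  define k where "k = gcd (gcd a b) p"
  have k: "k > 0" using assms by (auto simp: k_def v zero_prod_def gcd_pos_int)
  have dv: "k dvd a" "k dvd b" "k dvd p" unfolding k_def by (auto intro: dvd_trans)
  define v0 where "v0 = (a div k, b div k, p div k)"
  have "gcd (gcd (a div k) (b div k)) (p div k) = 1"
  proof -
    have "k * gcd (gcd (a div k) (b div k)) (p div k) = gcd (gcd (k * (a div k)) (k * (b div k))) (k * (p div k))"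
      using k gcd_mult_distrib_int[of k "gcd (a div k) (b div k)" "p div k"]
        gcd_mult_distrib_int[of k "a div k" "b div k"] by simp
    also have "\<dots> = k * 1" using dv by (simp add: k_def)
    finally show ?thesis using k by simp
  qed
  thus ?thesis using k dv by (intro that[of k v0]) (auto simp: smul_def v0_def v primitive_def)
qed

text \<open>Which alternative of \<open>alt\<close> holds may depend on the direction (u, v), but
  then it holds on the whole arc with the same c. This is the uniform form of nondegeneracy at one
  point, spread to a neighbourhood by continuity.\<close>

locale arc =
  fixes \<alpha> \<beta> :: real and f1 f1' f1'' f2 f2' f2'' l l' l'' :: "real \<Rightarrow> real" and c A :: real
  assumes ab: "\<alpha> < \<beta>" "\<beta> - \<alpha> \<le> 1" and c: "0 < c" "c \<le> 1" and A: "1 \<le> A"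
    and deriv_f1: "\<And>x. x \<in> {\<alpha>..\<beta>} \<Longrightarrow> (f1 has_real_derivative f1' x) (at x)"
      "\<And>x. x \<in> {\<alpha>..\<beta>} \<Longrightarrow> (f1' has_real_derivative f1'' x) (at x)" "continuous_on {\<alpha>..\<beta>} f1''"
    and deriv_f2: "\<And>x. x \<in> {\<alpha>..\<beta>} \<Longrightarrow> (f2 has_real_derivative f2' x) (at x)"
      "\<And>x. x \<in> {\<alpha>..\<beta>} \<Longrightarrow> (f2' has_real_derivative f2'' x) (at x)" "continuous_on {\<alpha>..\<beta>} f2''"
    and deriv_l: "\<And>x. x \<in> {\<alpha>..\<beta>} \<Longrightarrow> (l has_real_derivative l' x) (at x)"
      "\<And>x. x \<in> {\<alpha>..\<beta>} \<Longrightarrow> (l' has_real_derivative l'' x) (at x)" "continuous_on {\<alpha>..\<beta>} l''"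
    and bounds_f1: "\<And>x. x \<in> {\<alpha>..\<beta>} \<Longrightarrow> \<bar>f1 x\<bar> \<le> A" "\<And>x. x \<in> {\<alpha>..\<beta>} \<Longrightarrow> \<bar>f1' x\<bar> \<le> A"
      "\<And>x. x \<in> {\<alpha>..\<beta>} \<Longrightarrow> \<bar>f1'' x\<bar> \<le> A"
    and bounds_f2: "\<And>x. x \<in> {\<alpha>..\<beta>} \<Longrightarrow> \<bar>f2 x\<bar> \<le> A" "\<And>x. x \<in> {\<alpha>..\<beta>} \<Longrightarrow> \<bar>f2' x\<bar> \<le> A"
      "\<And>x. x \<in> {\<alpha>..\<beta>} \<Longrightarrow> \<bar>f2'' x\<bar> \<le> A"
    and bounds_l: "\<And>x. x \<in> {\<alpha>..\<beta>} \<Longrightarrow> \<bar>l x\<bar> \<le> A" "\<And>x. x \<in> {\<alpha>..\<beta>} \<Longrightarrow> \<bar>l' x\<bar> \<le> A"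
      "\<And>x. x \<in> {\<alpha>..\<beta>} \<Longrightarrow> \<bar>l'' x\<bar> \<le> A"
    and f1'_ge: "\<And>x. x \<in> {\<alpha>..\<beta>} \<Longrightarrow> c \<le> \<bar>f1' x\<bar>"
    and alt: "\<And>u v :: real. (\<forall>x\<in>{\<alpha>..\<beta>}. c * max \<bar>u\<bar> \<bar>v\<bar> \<le> \<bar>u * f1' x + v * f2' x\<bar>) \<or>
      (\<forall>x\<in>{\<alpha>..\<beta>}. c * max \<bar>u\<bar> \<bar>v\<bar> \<le> \<bar>u * f1'' x + v * f2'' x\<bar>)"
begin

text \<open>The parameter \<open>\<kappa>\<close> is 0 for the homogeneous and 1 for the inhomogeneous linear form.\<close>

definition F :: "real \<Rightarrow> ivec \<Rightarrow> real \<Rightarrow> real" where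
  "F \<kappa> v x = (case v of (a, b, p) \<Rightarrow> of_int a * f1 x + of_int b * f2 x + of_int p + \<kappa> * l x)"

definition F' :: "real \<Rightarrow> ivec \<Rightarrow> real \<Rightarrow> real" where
  "F' \<kappa> v x = (case v of (a, b, p) \<Rightarrow> of_int a * f1' x + of_int b * f2' x + \<kappa> * l' x)"

definition F'' :: "real \<Rightarrow> ivec \<Rightarrow> real \<Rightarrow> real" where
  "F'' \<kappa> v x = (case v of (a, b, p) \<Rightarrow> of_int a * f1'' x + of_int b * f2'' x + \<kappa> * l'' x)"

definition E :: "real \<Rightarrow> ivec \<Rightarrow> real \<Rightarrow> real \<Rightarrow> real set" where
  "E \<kappa> v e \<Lambda> = {x\<in>{\<alpha>..\<beta>}. \<bar>F \<kappa> v x\<bar> \<le> e \<and> \<bar>F' \<kappa> v x\<bar> \<le> \<Lambda>}"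

lemma F_diff: "F \<kappa> v x - F \<kappa> w x = F 0 (v - w) x" "F' \<kappa> v x - F' \<kappa> w x = F' 0 (v - w) x"
  by (cases v; cases w; simp add: F_def F'_def algebra_simps)+

lemma F_smul: "F 0 (smul k v) x = of_int k * F 0 v x" "F' 0 (smul k v) x = of_int k * F' 0 v x"
  by (cases v; simp add: F_def F'_def smul_def algebra_simps)+

lemma lin_bound:
  assumes "\<bar>u\<bar> \<le> A" "\<bar>v\<bar> \<le> A" "\<bar>w\<bar> \<le> A" "\<bar>\<kappa>\<bar> \<le> 1" "\<bar>a\<bar> \<le> H" "\<bar>b\<bar> \<le> H" "1 \<le> (H::real)"
  shows "\<bar>a * u + b * v + \<kappa> * w\<bar> \<le> 3 * A * H"
proof -
  have "\<bar>a * u\<bar> \<le> H * A" "\<bar>b * v\<bar> \<le> H * A" "1 * A \<le> H * A"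
    unfolding abs_mult using assms A by (auto intro!: mult_mono mult_right_mono)
  moreover have "\<bar>\<kappa> * w\<bar> \<le> 1 * A"
    unfolding abs_mult using assms A by (intro mult_mono) auto
  ultimately show ?thesis by (auto simp: algebra_simps)
qed

lemma F'_bound:
  assumes "x \<in> {\<alpha>..\<beta>}" "\<bar>\<kappa>\<bar> \<le> 1" "height v \<le> H" "1 \<le> H"
  shows "\<bar>F' \<kappa> v x\<bar> \<le> 3 * A * H" "\<bar>F'' \<kappa> v x\<bar> \<le> 3 * A * H"
  using assms bounds_f1 bounds_f2 bounds_l
  by (auto simp: F'_def F''_def height_def split: prod.splits intro!: lin_bound)

lemma C2_F:
  assumes "\<bar>\<kappa>\<bar> \<le> 1" "height v \<le> H" "1 \<le> H"
  shows "C2_function \<alpha> \<beta> (F \<kappa> v) (F' \<kappa> v) (F'' \<kappa> v) (3 * A * H)"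
proof
  show "\<bar>F'' \<kappa> v x\<bar> \<le> 3 * A * H" if "x \<in> {\<alpha>..\<beta>}" for x using F'_bound that assms by blast
  show "continuous_on {\<alpha>..\<beta>} (F'' \<kappa> v)"
    unfolding F''_def by (cases v) (auto intro!: continuous_intros deriv_f1 deriv_f2 deriv_l)
  fix x assume "x \<in> {\<alpha>..\<beta>}"
  thus "(F \<kappa> v has_real_derivative F' \<kappa> v x) (at x)" "(F' \<kappa> v has_real_derivative F'' \<kappa> v x) (at x)"
    unfolding F_def F'_def F''_def
    by (cases v; auto intro!: derivative_eq_intros deriv_f1 deriv_f2 deriv_l simp: algebra_simps)+
qed (use ab in auto)

lemma E_measurable: "E \<kappa> v e \<Lambda> \<in> sets lborel" "E \<kappa> v e \<Lambda> \<subseteq> {\<alpha>..\<beta>}" "compact (E \<kappa> v e \<Lambda>)"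
proof -
  have "continuous_on {\<alpha>..\<beta>} f" if "\<And>x. x \<in> {\<alpha>..\<beta>} \<Longrightarrow> (f has_real_derivative f' x) (at x)" for f f'
    using that DERIV_isCont by (intro continuous_at_imp_continuous_on) blast
  note cs = this[OF deriv_f1(1)] this[OF deriv_f2(1)] this[OF deriv_l(1)]
    this[OF deriv_f1(2)] this[OF deriv_f2(2)] this[OF deriv_l(2)]
  have "continuous_on {\<alpha>..\<beta>} (F \<kappa> v)" "continuous_on {\<alpha>..\<beta>} (F' \<kappa> v)"
    unfolding F_def F'_def by (cases v; auto intro!: continuous_intros cs)+
  hence "compact {x\<in>{\<alpha>..\<beta>}. max (\<bar>F \<kappa> v x\<bar> - e) (\<bar>F' \<kappa> v x\<bar> - \<Lambda>) \<le> 0}"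
    by (intro compact_sublevel continuous_intros)
  thus "compact (E \<kappa> v e \<Lambda>)" by (simp add: E_def conj_commute)
  thus "E \<kappa> v e \<Lambda> \<in> sets lborel" using borel_compact by simp
qed (auto simp: E_def)

lemma E_fmeasurable: "E \<kappa> v e \<Lambda> \<in> fmeasurable lborel"
  using E_measurable fmeasurable_compact by blast

lemma f1_expanding:
  assumes "x \<in> {\<alpha>..\<beta>}" "y \<in> {\<alpha>..\<beta>}"
  shows "c * \<bar>x - y\<bar> \<le> \<bar>f1 x - f1 y\<bar>"
proof -
  interpret C2_function \<alpha> \<beta> f1 f1' f1'' A
    by standard (use ab deriv_f1 bounds_f1 in auto)
  obtain t where t: "t \<in> {min y x..max y x}" "f1 x - f1 y = f1' t * (x - y)" using mvt[OF assms(2,1)] by blast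
  have "t \<in> {\<alpha>..\<beta>}" using t(1) assms by auto
  thus ?thesis unfolding t(2) abs_mult using f1'_ge by (intro mult_right_mono) auto
qed

text \<open>The function w * f1 has slope at least c * |w|, so each integer accounts for length at
  most 2 * e / (c * |w|), while only O(|w|) integers are within reach. The factor |w| cancels, and
  the bound is uniform in w.\<close>

lemma near_int_f1:
  fixes w :: int
  assumes w: "w \<noteq> 0" and e: "0 \<le> e" "e \<le> 256"
  defines "G \<equiv> {x\<in>{\<alpha>..\<beta>}. \<exists>w1::int. \<bar>of_int w1 - of_int w * f1 x\<bar> \<le> e}"
  shows "G \<in> sets lborel" "measure lborel G \<le> (2 * A + 513) * 2 / c * e"
proof -
  define T where "T = {w1::int. \<bar>of_int w1 - 0\<bar> \<le> A * \<bar>of_int w\<bar> + 256}"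
  define P where "P w1 = {x\<in>{\<alpha>..\<beta>}. \<bar>of_int w1 - of_int w * f1 x\<bar> \<le> e}" for w1 :: int
  have w1: "1 \<le> \<bar>real_of_int w\<bar>" using w by linarith
  have T: "finite T" "real (card T) \<le> 2 * (A * \<bar>of_int w\<bar> + 256) + 1"
    unfolding T_def using A by (intro ints_near add_nonneg_nonneg mult_nonneg_nonneg; simp)+
  have GU: "G = (\<Union>w1\<in>T. P w1)"
  proof -
    have "w1 \<in> T" if "x \<in> P w1" for x w1
    proof -
      have "\<bar>of_int w * f1 x\<bar> \<le> \<bar>of_int w\<bar> * A"
        unfolding abs_mult using that bounds_f1(1)[of x] by (intro mult_left_mono) (auto simp: P_def)
      thus ?thesis using that e by (auto simp: P_def T_def mult.commute)
    qed
    thus ?thesis by (auto simp: G_def P_def)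
  qed
  have contf: "continuous_on {\<alpha>..\<beta>} f1"
    using deriv_f1(1) DERIV_isCont by (intro continuous_at_imp_continuous_on) blast
  have cP: "compact (P w1)" for w1
    unfolding P_def by (intro compact_sublevel continuous_intros contf)
  have mP: "P w1 \<in> sets lborel" for w1 using borel_compact[OF cP] by simp
  show "G \<in> sets lborel" unfolding GU using T(1) mP by (intro sets.finite_UN) auto
  have "measure lborel G \<le> (\<Sum>w1\<in>T. measure lborel (P w1))"
    unfolding GU using cP fmeasurable_compact T(1) by (intro measure_UNION_le) (auto simp: mP[simplified])
  also have "\<dots> \<le> (\<Sum>w1\<in>T. 2 * e / (c * \<bar>of_int w\<bar>))"
  proof (intro sum_mono)
    fix w1
    have "measure lborel (P w1) \<le> diameter (P w1)"
      using mP cP by (intro measure_le_diameter compact_imp_bounded)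
    also have "\<dots> \<le> 2 * e / (c * \<bar>of_int w\<bar>)"
    proof (rule diameter_le)
      fix x y assume xy: "x \<in> P w1" "y \<in> P w1"
      have "\<bar>of_int w\<bar> * (c * \<bar>x - y\<bar>) \<le> \<bar>of_int w\<bar> * \<bar>f1 x - f1 y\<bar>"
        using f1_expanding[of x y] xy by (intro mult_left_mono) (auto simp: P_def)
      also have "\<dots> = \<bar>of_int w * f1 x - of_int w * f1 y\<bar>" by (simp add: abs_mult[symmetric] algebra_simps)
      also have "\<dots> \<le> 2 * e" using xy by (auto simp: P_def)
      finally show "norm (x - y) \<le> 2 * e / (c * \<bar>of_int w\<bar>)" using c w1 by (simp add: field_simps)
    qed (use c e in auto)
    finally show "measure lborel (P w1) \<le> 2 * e / (c * \<bar>of_int w\<bar>)" .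
  qed
  also have "\<dots> = real (card T) * (2 * e / (c * \<bar>of_int w\<bar>))" by simp
  also have "\<dots> \<le> ((2 * A + 513) * \<bar>of_int w\<bar>) * (2 * e / (c * \<bar>of_int w\<bar>))"
    using T(2) w1 c e by (intro mult_right_mono) (auto simp: algebra_simps)
  also have "\<dots> = (2 * A + 513) * 2 / c * e" using w1 c by (simp add: field_simps)
  finally show "measure lborel G \<le> (2 * A + 513) * 2 / c * e" .
qed

end

section \<open>The homogeneous estimate\<close>

context arc
begin

text \<open>Eliminating one unknown at a time from the two forms: the derivatives, together with the
  lower bound for f1', control w3, and the values control the other two coordinates. For nonzero w3
  this makes (w1 / w3, w2 / w3) a rational point near (f1 x, f2 x).\<close>

lemma cross_bounds:
  assumes "x \<in> {\<alpha>..\<beta>}" "\<bar>F 0 v x\<bar> \<le> e" "\<bar>F 0 w x\<bar> \<le> e" "\<bar>F' 0 v x\<bar> \<le> L" "\<bar>F' 0 w x\<bar> \<le> L"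
    "height v \<le> H" "height w \<le> H"
  shows "case cross v w of (w3, w1, w2) \<Rightarrow> c * \<bar>of_int w3\<bar> \<le> 2 * H * L \<and>
    \<bar>of_int w1 - of_int w3 * f1 x\<bar> \<le> 2 * H * e \<and> \<bar>of_int w2 - of_int w3 * f2 x\<bar> \<le> 2 * H * e"
proof -
  obtain a b p where v: "v = (a, b, p)" by (cases v)
  obtain a' b' p' where w: "w = (a', b', p')" by (cases w)
  have H: "\<bar>real_of_int a\<bar> \<le> H" "\<bar>real_of_int b\<bar> \<le> H" "\<bar>real_of_int a'\<bar> \<le> H" "\<bar>real_of_int b'\<bar> \<le> H"
    using assms by (auto simp: v w height_def)
  have H0: "0 \<le> H" using H(1) by linarith
  have prod: "\<bar>u * s - u' * s'\<bar> \<le> 2 * H * d" if "\<bar>u\<bar> \<le> H" "\<bar>u'\<bar> \<le> H" "\<bar>s\<bar> \<le> d" "\<bar>s'\<bar> \<le> d" for u u' s s' d :: real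
  proof -
    have "\<bar>u * s\<bar> \<le> H * d" "\<bar>u' * s'\<bar> \<le> H * d" unfolding abs_mult using that H0 by (auto intro!: mult_mono)
    thus ?thesis by linarith
  qed
  define w3 where "w3 = a * b' - a' * b"
  have "c * \<bar>of_int w3\<bar> \<le> \<bar>f1' x\<bar> * \<bar>of_int w3\<bar>" using f1'_ge[OF assms(1)] by (intro mult_right_mono) auto
  also have "\<dots> = \<bar>of_int b' * F' 0 v x - of_int b * F' 0 w x\<bar>"
    by (simp add: abs_mult[symmetric] w3_def F'_def v w algebra_simps)
  also have "\<dots> \<le> 2 * H * L" using H assms by (intro prod) auto
  finally have 1: "c * \<bar>of_int w3\<bar> \<le> 2 * H * L" .
  have "of_int (b * p' - b' * p) - of_int w3 * f1 x = of_int b * F 0 w x - of_int b' * F 0 v x"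
    by (simp add: w3_def F_def v w algebra_simps)
  hence 2: "\<bar>of_int (b * p' - b' * p) - of_int w3 * f1 x\<bar> \<le> 2 * H * e"
    using prod[OF H(2) H(4) assms(3) assms(2)] by (simp only:)
  have "of_int (p * a' - p' * a) - of_int w3 * f2 x = of_int a' * F 0 v x - of_int a * F 0 w x"
    by (simp add: w3_def F_def v w algebra_simps)
  hence 3: "\<bar>of_int (p * a' - p' * a) - of_int w3 * f2 x\<bar> \<le> 2 * H * e"
    using prod[OF H(3) H(1) assms(2) assms(3)] by (simp only:)
  show ?thesis using 1 2 3 by (simp only: cross_def v w w3_def prod.case)
qed

text \<open>At each point the primitive vectors of comparable height at which the form is small are
  injected, up to bounded multiplicity, into the cross products with one of them, and the latter
  are rational points so close to the curve that their mean number is bounded.\<close>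

lemma primitive_sum_bounded:
  assumes L: "0 \<le> L"
  obtains C where "0 \<le> C" "\<And>j V. finite V \<Longrightarrow>
      (\<And>v. v \<in> V \<Longrightarrow> primitive v \<and> 2 ^ j \<le> height v \<and> height v < 2 * 2 ^ j) \<Longrightarrow>
      (\<Sum>v\<in>V. measure lborel (E 0 v (64 / 4 ^ j) L)) \<le> C"
proof -
  \<comment> \<open>From \<open>cross_bounds\<close> with heights below 2 * h: c * |w3| is at most 2
    * (2 * h) * L.\<close>
  define B where "B = 4 * L / c"
  have B: "0 \<le> B" using L c by (simp add: B_def)
  define C2 where "C2 = (2 * A + 513) * 2 / c * 256"
  have C2: "0 \<le> C2" using A c by (simp add: C2_def)
  \<comment> \<open>At most 513 integers lie within 256 of a real number, once for w1 and once for
    w2; 7 counts the multipliers k with |k| <= 3 in a fibre.\<close>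
  define N where "N = (513 * 513 * 7 :: real)"
  define C where "C = N * 1 * (\<beta> - \<alpha>) + N * ((2 * B + 1) * C2)"
  show ?thesis
  proof (rule that[of C])
    show "0 \<le> C" using B C2 ab by (auto simp: C_def N_def)
    fix j :: nat and V :: "ivec set"
    assume V: "finite V" "\<And>v. v \<in> V \<Longrightarrow> primitive v \<and> 2 ^ j \<le> height v \<and> height v < 2 * 2 ^ j"
    define h where "h = (2::real) ^ j"
    have h: "1 \<le> h" by (simp add: h_def)
    have hh: "(4::real) ^ j = h * h" by (simp add: h_def power_mult_distrib[symmetric])
    define W where "W = {w::int. w \<noteq> 0 \<and> \<bar>of_int w\<bar> \<le> B * h}"
    \<comment> \<open>The error 2 * (2 * h) * (64 / h^2) that \<open>cross_bounds\<close> allows for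
      w1 and w2.\<close>
    define e where "e = 256 / h"
    have e: "0 \<le> e" "e \<le> 256" using h by (auto simp: e_def field_simps)
    define G where "G w = {x\<in>{\<alpha>..\<beta>}. \<exists>w1::int. \<bar>of_int w1 - of_int w * f1 x\<bar> \<le> e}" for w :: int
    have Wfin: "finite {w::int. \<bar>of_int w - 0\<bar> \<le> B * h}" "real (card {w::int. \<bar>of_int w - 0\<bar> \<le> B * h}) \<le> 2 * (B * h) + 1"
      by (rule ints_near; use B h in simp)+
    have W: "finite W" "real (card W) \<le> 2 * (B * h) + 1"
    proof -
      have sub: "W \<subseteq> {w::int. \<bar>of_int w - 0\<bar> \<le> B * h}" by (auto simp: W_def)
      show "finite W" using finite_subset[OF sub Wfin(1)] .
      show "real (card W) \<le> 2 * (B * h) + 1" using card_mono[OF Wfin(1) sub] Wfin(2) by linarith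
    qed
    have "(\<Sum>v\<in>V. measure lborel (E 0 v (64 / 4 ^ j) L))
       \<le> (N * 1) * (\<beta> - \<alpha>) + N * (\<Sum>w\<in>W. measure lborel (G w))"
    proof (rule sum_measure_le_of_card)
      fix x assume x: "x \<in> {\<alpha>..\<beta>}"
      define S where "S = {v\<in>V. x \<in> E 0 v (64 / 4 ^ j) L}"
      have fS: "finite S" using V(1) by (simp add: S_def)
      have "real (card S) \<le> N * 1 + N * real (card {w\<in>W. x \<in> G w})"
      proof (cases "S = {}")
        case False
        then obtain v0 where v0: "v0 \<in> S" by blast
        define K where "K = insert 0 {w\<in>W. x \<in> G w}"
        have K: "finite K" "card K \<le> 1 + card {w\<in>W. x \<in> G w}"
          unfolding K_def using W(1) by (auto simp: card_insert_if)
        define P where "P f w = {w1::int. \<bar>of_int w1 - of_int w * f x\<bar> \<le> 256}" for f :: "real \<Rightarrow> real" and w :: int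
        have P: "finite (P f w)" "card (P f w) \<le> 513" for f w
          unfolding P_def using ints_near[of 256 "of_int w * f x"] by auto
        have P12: "finite (P f1 w \<times> P f2 w)" "card (P f1 w \<times> P f2 w) \<le> 513 * 513" for w
          using P mult_le_mono[OF P(2)[of f1 w] P(2)[of f2 w]] by (auto simp: card_cartesian_product)
        have cr: "cross v0 v \<in> (SIGMA w:K. P f1 w \<times> P f2 w)" if "v \<in> S" for v
        proof -
          obtain w3 w1 w2 where w: "cross v0 v = (w3, w1, w2)" by (cases "cross v0 v")
          have "case cross v0 v of (w3, w1, w2) \<Rightarrow> c * \<bar>of_int w3\<bar> \<le> 2 * (2 * h) * L \<and>
            \<bar>of_int w1 - of_int w3 * f1 x\<bar> \<le> 2 * (2 * h) * (64 / 4 ^ j) \<and>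
            \<bar>of_int w2 - of_int w3 * f2 x\<bar> \<le> 2 * (2 * h) * (64 / 4 ^ j)"
            using that v0 V(2)[of v] V(2)[of v0] by (intro cross_bounds x) (auto simp: S_def E_def h_def)
          moreover have "2 * (2 * h) * (64 / 4 ^ j) = e" unfolding hh e_def using h by (simp add: field_simps)
          ultimately have *: "c * \<bar>of_int w3\<bar> \<le> 4 * h * L" "\<bar>of_int w1 - of_int w3 * f1 x\<bar> \<le> e"
            "\<bar>of_int w2 - of_int w3 * f2 x\<bar> \<le> e" unfolding w by auto
          have "\<bar>of_int w3\<bar> \<le> B * h" using *(1) c by (simp add: B_def field_simps)
          hence "w3 \<in> K" using *(2) x by (auto simp: K_def W_def G_def)
          thus ?thesis using * e(2) by (auto simp: w P_def)
        qed
        have fib: "card {v\<in>S. cross v0 v = y} \<le> 7" for y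
        proof (cases "{v\<in>S. cross v0 v = y} = {}")
          case False
          then obtain v1 where v1: "v1 \<in> S" "cross v0 v1 = y" by blast
          have "{v\<in>S. cross v0 v = y} \<subseteq> (\<lambda>k. v1 + smul k v0) ` {-3..3}"
          proof clarify
            fix v assume v: "v \<in> S" "y = cross v0 v"
            have "cross v0 (v - v1) = 0" using v v1 by (simp add: cross_diff_right)
            moreover have "primitive v0" using v0 V(2) by (auto simp: S_def)
            ultimately obtain k where k: "v - v1 = smul k v0" using cross_eq_0_imp_smul by blast
            have "\<bar>of_int k\<bar> * h \<le> \<bar>of_int k\<bar> * height v0"
              using v0 V(2)[of v0] by (intro mult_left_mono) (auto simp: S_def h_def)
            also have "\<dots> = height (v - v1)" by (simp add: k height_smul)
            also have "\<dots> \<le> height v + height v1" by (rule height_diff)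
            also have "\<dots> < 4 * h" using v v1 V(2)[of v] V(2)[of v1] by (auto simp: S_def h_def)
            finally have "\<bar>real_of_int k\<bar> < 4" using h by simp
            hence "k \<in> {-3..3}" by auto
            moreover have "v = v1 + smul k v0" using k by (simp add: algebra_simps flip: k)
            ultimately show "v \<in> (\<lambda>k. v1 + smul k v0) ` {-3..3}" by blast
          qed
          hence "card {v\<in>S. cross v0 v = y} \<le> card ((\<lambda>k. v1 + smul k v0) ` {-3..(3::int)})"
            by (intro card_mono) auto
          also have "\<dots> \<le> card {-3..(3::int)}" by (intro card_image_le) auto
          finally show ?thesis by simp
        next
          case True
          thus ?thesis by (simp only: card.empty)
        qed
        have "card S \<le> 7 * card (cross v0 ` S)" by (rule card_le_fibres[OF fS fib])
        also have "card (cross v0 ` S) \<le> card (SIGMA w:K. P f1 w \<times> P f2 w)"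
        proof (rule card_mono)
          show "finite (SIGMA w:K. P f1 w \<times> P f2 w)" using K P by (auto intro!: finite_SigmaI)
          show "cross v0 ` S \<subseteq> (SIGMA w:K. P f1 w \<times> P f2 w)" using cr by (rule image_subsetI)
        qed
        also have "\<dots> = (\<Sum>w\<in>K. card (P f1 w \<times> P f2 w))" using K P12(1) by (intro card_SigmaI) blast+
        also have "\<dots> \<le> (\<Sum>w\<in>K. 513 * 513)" by (intro sum_mono P12)
        also have "\<dots> \<le> (1 + card {w\<in>W. x \<in> G w}) * (513 * 513)" using K by simp
        finally have "card S \<le> 7 * ((1 + card {w\<in>W. x \<in> G w}) * (513 * 513))" by simp
        hence "real (card S) \<le> real (7 * ((1 + card {w\<in>W. x \<in> G w}) * (513 * 513)))" by (rule of_nat_mono)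
        thus ?thesis by (simp add: N_def algebra_simps)
      qed (simp add: N_def)
      thus "real (card {v \<in> V. x \<in> E 0 v (64 / 4 ^ j) L}) \<le> N * 1 + N * real (card {w \<in> W. x \<in> G w})"
        by (simp add: S_def)
    next
      fix w assume "w \<in> W"
      hence "w \<noteq> 0" by (simp add: W_def)
      from near_int_f1(1)[OF this e] show "G w \<in> sets lborel" unfolding G_def .
      show "G w \<subseteq> {\<alpha>..\<beta>}" by (auto simp: G_def)
    qed (use ab in \<open>auto simp only: V(1) W(1) E_measurable\<close>)
    also have "(\<Sum>w\<in>W. measure lborel (G w)) \<le> (\<Sum>w\<in>W. (2 * A + 513) * 2 / c * e)"
    proof (rule sum_mono)
      fix w assume "w \<in> W"
      hence "w \<noteq> 0" by (simp add: W_def)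
      from near_int_f1(2)[OF this e] show "measure lborel (G w) \<le> (2 * A + 513) * 2 / c * e" unfolding G_def .
    qed
    \<comment> \<open>About h values of w face sets of measure about 1 / h each, so the mean number
      of cross products is bounded independently of j.\<close>
    also have "\<dots> = real (card W) * (C2 / h)" by (simp add: C2_def e_def)
    also have "\<dots> \<le> ((2 * B + 1) * h) * (C2 / h)"
      using W(2) h C2 by (intro mult_right_mono) (auto simp: algebra_simps)
    also have "\<dots> = (2 * B + 1) * C2" using h by simp
    finally show "(\<Sum>v\<in>V. measure lborel (E 0 v (64 / 4 ^ j) L)) \<le> C"
      by (simp add: C_def N_def)
  qed
qed

end

section \<open>Smaller thresholds and vectors that are not primitive\<close>

lemma measure_Un_le_diameter:
  fixes S :: "real set"
  assumes "S \<in> sets lborel" "bounded U1" "bounded U2" "S = U1 \<union> U2"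
  shows "measure lborel S \<le> diameter U1 + diameter U2"
proof -
  define V where "V U = (if U = {} then {} else {Inf U..Inf U + diameter U})" for U :: "real set"
  have V: "U \<subseteq> V U" "V U \<in> fmeasurable lborel" "measure lborel (V U) = diameter U" if "bounded U" for U
    using subset_interval_diameter[OF that] diameter_ge_0[OF that] by (auto simp: V_def intro: fmeasurable_compact)
  have "measure lborel S \<le> measure lborel (V U1 \<union> V U2)"
    by (rule measure_mono_fmeasurable)
      (use V(1)[OF assms(2)] V(1)[OF assms(3)] V(2)[OF assms(2)] V(2)[OF assms(3)] assms(1,4) in \<open>auto intro: fmeasurable.Un\<close>)
  also have "\<dots> \<le> measure lborel (V U1) + measure lborel (V U2)"
    using V assms by (intro measure_Un_le) (auto simp: fmeasurable_def)
  finally show ?thesis using V assms by simp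
qed

lemma dyadic_level:
  fixes x :: real
  assumes "1 \<le> x"
  obtains j :: nat where "2 ^ j \<le> x" "x < 2 * 2 ^ j"
proof -
  obtain n where n: "x < 2 ^ n" using real_arch_pow[of 2 x] by auto
  define m where "m = (LEAST n. x < 2 ^ n)"
  have m: "x < 2 ^ m" unfolding m_def by (rule LeastI) (rule n)
  have "m \<noteq> 0" using m assms by (intro notI) simp
  then obtain j where j: "m = Suc j" by (cases m) auto
  have "\<not> x < 2 ^ j" using not_less_Least[of j "\<lambda>n. x < 2 ^ n"] j by (auto simp: m_def)
  thus ?thesis using m j by (intro that[of j]) auto
qed

context arc
begin

text \<open>Raising the threshold from e' to e = 64 / 4^j lengthens the set at least by the factor
  sqrt (e / e'), up to a constant. A tangency is the worst case; at a dominant first derivative the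
  gain would be e / e'.\<close>

lemma small_set_shrink:
  obtains C where "0 \<le> C" "\<And>v j e'. 2 ^ j \<le> height v \<Longrightarrow> height v < 2 * 2 ^ j \<Longrightarrow> 0 < e' \<Longrightarrow>
    2 * e' \<le> 64 / 4 ^ j \<Longrightarrow>
    measure lborel (E 0 v e' 4) \<le> C * sqrt e' * 2 ^ j * measure lborel (E 0 v (64 / 4 ^ j) 6)"
proof -
  \<comment> \<open>Small enough that the linear and the quadratic growth each use at most e / 4;
    the factor \<beta> - \<alpha> keeps the stretched interval inside half of the arc.\<close>
  define c1 where "c1 = c * (\<beta> - \<alpha>) / (48 * A)"
  have c1: "0 < c1" using c A ab by (simp add: c1_def)
  have c1': "c1 \<le> c / (48 * A)" "c1 \<le> 1 / 48"
  proof -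
    have "c * (\<beta> - \<alpha>) \<le> c * 1" using c ab by (intro mult_left_mono) auto
    thus 1: "c1 \<le> c / (48 * A)" unfolding c1_def using A by (intro divide_right_mono) auto
    have "c / (48 * A) \<le> 1 / 48" using c A by (intro frac_le) auto
    thus "c1 \<le> 1 / 48" using 1 by simp
  qed
  show ?thesis
  proof (rule that[of "1 / (4 * c1)"])
    fix v j and e' :: real
    assume v: "2 ^ j \<le> height v" "height v < 2 * 2 ^ j" and e': "0 < e'" "2 * e' \<le> 64 / 4 ^ j"
    define h where "h = (2::real) ^ j"
    have h: "1 \<le> h" by (simp add: h_def)
    have hh: "(4::real) ^ j = h * h" by (simp add: h_def power_mult_distrib[symmetric])
    interpret C2_function \<alpha> \<beta> "F 0 v" "F' 0 v" "F'' 0 v" "3 * A * (2 * h)"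
    proof (rule C2_F)
      show "height v \<le> 2 * h" using v by (simp add: h_def)
      show "1 \<le> 2 * h" using h by simp
    qed simp
    have E: "E 0 v e \<Lambda> = {x\<in>{\<alpha>..\<beta>}. \<bar>F 0 v x\<bar> \<le> e \<and> \<bar>F' 0 v x\<bar> \<le> \<Lambda>}" for e \<Lambda> by (simp add: E_def)
    show "measure lborel (E 0 v e' 4) \<le> 1 / (4 * c1) * sqrt e' * 2 ^ j * measure lborel (E 0 v (64 / 4 ^ j) 6)"
    proof (cases "E 0 v e' 4 = {}")
      case False
      have k: "0 < c * h" using c h by simp
      have alt': "(\<forall>x\<in>{\<alpha>..\<beta>}. c * h \<le> \<bar>F' 0 v x\<bar>) \<or> (\<forall>x\<in>{\<alpha>..\<beta>}. c * h \<le> \<bar>F'' 0 v x\<bar>)"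
      proof -
        obtain a b p where vv: "v = (a, b, p)" by (cases v)
        have "c * h \<le> c * max \<bar>of_int a\<bar> \<bar>of_int b\<bar>"
          using v c by (intro mult_left_mono) (auto simp: vv height_def h_def)
        thus ?thesis using alt[of "of_int a" "of_int b"] by (auto simp: vv F'_def F''_def intro: order_trans)
      qed
      obtain x0 U1 U2 where x0: "x0 \<in> E 0 v e' 4" and EU: "E 0 v e' 4 = U1 \<union> U2"
        and U: "\<And>U. U = U1 \<or> U = U2 \<Longrightarrow> bounded U \<and> \<bar>F' 0 v x0\<bar> * diameter U \<le> 2 * e' \<and> c * h * (diameter U)\<^sup>2 \<le> 4 * e'"
        using small_set_split[OF k e'(1) alt' False[unfolded E]] unfolding E[symmetric] by blast
      define D where "D = \<bar>F' 0 v x0\<bar>"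
      define d where "d = max (diameter U1) (diameter U2)"
      have D: "0 \<le> D" "D \<le> 4" using x0 by (auto simp: D_def E_def)
      have d0: "0 \<le> d" using U diameter_ge_0 by (auto simp: d_def le_max_iff_disj)
      have d: "D * d \<le> 2 * e'" "c * h * d\<^sup>2 \<le> 4 * e'" unfolding d_def D_def max_def using U by auto
      have mE: "measure lborel (E 0 v e' 4) \<le> 2 * d"
        using measure_Un_le_diameter[OF E_measurable(1) _ _ EU] U by (force simp: d_def)
      define e where "e = 64 / (h * h)"
      \<comment> \<open>\<sigma> = sqrt (e' / e), the ratio of lengths at a tangency; it is at most
        1.\<close>
      define \<sigma> where "\<sigma> = sqrt e' * h / 8"
      have \<sigma>2: "\<sigma>\<^sup>2 * e = e'" using e' h by (simp add: \<sigma>_def e_def power_mult_distrib power_divide field_simps power2_eq_square)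
      have e: "0 < e" "2 * e' \<le> e" using h e' by (auto simp: e_def hh)
      have \<sigma>: "0 < \<sigma>" using e' h by (simp add: \<sigma>_def)
      have "\<sigma>\<^sup>2 * e \<le> 1\<^sup>2 * e" using \<sigma>2 e e' by simp
      hence "\<sigma>\<^sup>2 \<le> 1\<^sup>2" using e by (simp add: mult_le_cancel_right)
      hence \<sigma>1: "\<sigma> \<le> 1" by (rule power2_le_imp_le) simp
      \<comment> \<open>Stretching d by 1 / \<sigma> multiplies the quadratic term by e / e' and the
        linear term by no more than that, so both remain of order e.\<close>
      define y where "y = c1 * d / \<sigma>"
      have y0: "0 \<le> y" using c1 d0 \<sigma> by (simp add: y_def)
      have Dy: "D * y \<le> e / 4"
      proof -
        have "D * y = c1 * (D * d) / \<sigma>" by (simp add: y_def)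
        also have "\<dots> \<le> c1 * (2 * e') / \<sigma>" using d c1 \<sigma> by (intro divide_right_mono mult_left_mono) auto
        also have "\<dots> = 2 * c1 * \<sigma> * e" unfolding \<sigma>2[symmetric] using \<sigma> by (simp add: power2_eq_square)
        also have "\<dots> \<le> 2 * (1/48) * 1 * e" using c1 c1' \<sigma> \<sigma>1 e by (intro mult_mono) auto
        finally show ?thesis using e by simp
      qed
      have chy: "c * h * y\<^sup>2 \<le> 4 * c1\<^sup>2 * e"
      proof -
        have "c * h * y\<^sup>2 = c1\<^sup>2 / \<sigma>\<^sup>2 * (c * h * d\<^sup>2)" by (simp add: y_def power_mult_distrib power_divide)
        also have "\<dots> \<le> c1\<^sup>2 / \<sigma>\<^sup>2 * (4 * e')" using d by (intro mult_left_mono) auto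
        also have "\<dots> = 4 * c1\<^sup>2 * e" unfolding \<sigma>2[symmetric] using \<sigma> by simp
        finally show ?thesis .
      qed
      have My: "3 * A * (2 * h) * y\<^sup>2 / 2 \<le> e / 4"
      proof -
        have "3 * A * (2 * h) * y\<^sup>2 / 2 = 3 * A / c * (c * h * y\<^sup>2)" using c by simp
        also have "\<dots> \<le> 3 * A / c * (4 * c1\<^sup>2 * e)" using chy A c by (intro mult_left_mono) auto
        also have "\<dots> = (12 * A / c * c1) * c1 * e" by (simp add: power2_eq_square)
        also have "\<dots> \<le> (1/4) * 1 * e"
        proof (intro mult_mono)
          have "12 * A / c * c1 \<le> 12 * A / c * (c / (48 * A))" using c1' A c by (intro mult_left_mono) auto
          thus "12 * A / c * c1 \<le> 1 / 4" using A c by simp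
        qed (use c1 c1' A c e in auto)
        finally show ?thesis by simp
      qed
      have hy: "(h * y)\<^sup>2 \<le> ((\<beta> - \<alpha>) / (3 * A))\<^sup>2"
      proof -
        have "(h * y)\<^sup>2 = h / c * (c * h * y\<^sup>2)" using c by (simp add: power2_eq_square)
        also have "\<dots> \<le> h / c * (4 * c1\<^sup>2 * e)" using chy c h by (intro mult_left_mono) auto
        also have "\<dots> = (256 * c1\<^sup>2 / c) / h" using h by (simp add: e_def)
        also have "\<dots> \<le> (256 * c1\<^sup>2 / c) / 1" using h c by (intro divide_left_mono) auto
        also have "\<dots> = c * ((\<beta> - \<alpha>) / (3 * A))\<^sup>2" using c A by (simp add: c1_def power_divide power_mult_distrib power2_eq_square field_simps)
        also have "\<dots> \<le> 1 * ((\<beta> - \<alpha>) / (3 * A))\<^sup>2" using c by (intro mult_right_mono) auto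
        finally show ?thesis by simp
      qed
      have hy': "h * y \<le> (\<beta> - \<alpha>) / (3 * A)" using hy by (rule power2_le_imp_le) (use ab A in auto)
      have "y \<le> h * y" using h y0 by (simp add: mult_le_cancel_right1)
      also have "\<dots> \<le> (\<beta> - \<alpha>) / (3 * A)" by (rule hy')
      also have "\<dots> \<le> (\<beta> - \<alpha>) / 2" using ab A by (intro divide_left_mono) auto
      finally have y1: "y \<le> (\<beta> - \<alpha>) / 2" .
      have "(\<beta> - \<alpha>) / (3 * A) \<le> 1 / (3 * A)" using ab A by (intro divide_right_mono) auto
      hence "6 * A * (h * y) \<le> 6 * A * (1 / (3 * A))" using hy' A by (intro mult_left_mono) auto
      hence L: "D + 3 * A * (2 * h) * y \<le> 6" using D A by (simp add: field_simps)
      have "y \<le> measure lborel (E 0 v e 6)"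
        unfolding E
        by (rule neighbourhood_measure[of x0 e']) (use x0 y0 y1 Dy My L e in \<open>auto simp: E_def D_def\<close>)
      hence "d * c1 \<le> \<sigma> * measure lborel (E 0 v e 6)" using \<sigma> by (simp add: y_def field_simps)
      hence "2 * d \<le> 2 / c1 * \<sigma> * measure lborel (E 0 v e 6)" using c1 by (simp add: field_simps)
      also have "2 / c1 * \<sigma> = 1 / (4 * c1) * sqrt e' * h" by (simp add: \<sigma>_def)
      finally show ?thesis using mE by (simp add: e_def hh h_def)
    qed (use c1 e' in simp)
  qed (use c1 in simp)
qed

text \<open>Each vector is a multiple of a primitive one. A primitive vector at dyadic level j has
  about 2^t / 2^j multiples of admissible height, and the shrinking factor is proportional to 2^j;
  the product does not depend on j, so every level contributes equally and the factor t + 3 counts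
  the levels 0 to t + 2.\<close>

lemma homogeneous_sum_bounded:
  obtains C where "0 \<le> C" "\<And>t e' V. finite V \<Longrightarrow> 0 < e' \<Longrightarrow> e' < 1 \<Longrightarrow> e' \<le> 2 / 4 ^ t \<Longrightarrow>
      (\<And>v. v \<in> V \<Longrightarrow> v \<noteq> 0 \<and> height v \<le> 4 * 2 ^ t) \<Longrightarrow>
      (\<Sum>v\<in>V. measure lborel (E 0 v e' 4)) \<le> C * (2 ^ t * sqrt e') * (real t + 3)"
proof -
  obtain C0 where C0: "0 \<le> C0" "\<And>j V. finite V \<Longrightarrow>
      (\<And>v. v \<in> V \<Longrightarrow> primitive v \<and> 2 ^ j \<le> height v \<and> height v < 2 * 2 ^ j) \<Longrightarrow>
      (\<Sum>v\<in>V. measure lborel (E 0 v (64 / 4 ^ j) 6)) \<le> C0"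
    by (rule primitive_sum_bounded[of 6]) (simp, blast)
  obtain C1 where C1: "0 \<le> C1" "\<And>v j e'. 2 ^ j \<le> height v \<Longrightarrow> height v < 2 * 2 ^ j \<Longrightarrow> 0 < e' \<Longrightarrow>
    2 * e' \<le> 64 / 4 ^ j \<Longrightarrow>
    measure lborel (E 0 v e' 4) \<le> C1 * sqrt e' * 2 ^ j * measure lborel (E 0 v (64 / 4 ^ j) 6)"
    using small_set_shrink by blast
  show ?thesis
  proof (rule that[of "4 * C1 * C0"])
    fix t :: nat and e' :: real and V
    assume V: "finite V" "\<And>v. v \<in> V \<Longrightarrow> v \<noteq> 0 \<and> height v \<le> 4 * 2 ^ t"
      and e': "0 < e'" "e' < 1" "e' \<le> 2 / 4 ^ t"
    define V' where "V' = {v\<in>V. 1 \<le> height v}"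
    have V': "finite V'" "\<And>v. v \<in> V' \<Longrightarrow> v \<noteq> 0 \<and> 1 \<le> height v \<and> height v \<le> 4 * 2 ^ t"
      using V by (auto simp: V'_def)
    \<comment> \<open>A nonzero vector of height 0 is (0, 0, p), and its form is a nonzero integer
      constant, which cannot be at most e' < 1.\<close>
    have zero: "measure lborel (E 0 v e' 4) = 0" if "v \<in> V - V'" for v
    proof -
      have h0: "height v = 0" "v \<noteq> 0" using height_eq_0_or_ge_1[of v] that V(2)[of v] by (auto simp: V'_def)
      obtain a b p where v: "v = (a, b, p)" by (cases v)
      have "\<bar>real_of_int a\<bar> \<le> height v" "\<bar>real_of_int b\<bar> \<le> height v" by (auto simp: v height_def)
      hence "a = 0" "b = 0" using h0 by auto
      hence "p \<noteq> 0" using h0 by (auto simp: v zero_prod_def)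
      hence "1 \<le> \<bar>real_of_int p\<bar>" by linarith
      hence "E 0 v e' 4 = {}" using e' \<open>a = 0\<close> \<open>b = 0\<close> by (auto simp: E_def F_def v)
      thus ?thesis by simp
    qed
    have "\<exists>k u. v = smul k u \<and> 1 \<le> k \<and> primitive u" if "v \<in> V'" for v
      using V'(2)[OF that] eq_smul_primitive[of v] by metis
    then obtain kk pr where kp: "\<And>v. v \<in> V' \<Longrightarrow> v = smul (kk v) (pr v) \<and> 1 \<le> kk v \<and> primitive (pr v)"
      by metis
    have hpr: "height v = of_int (kk v) * height (pr v)" if "v \<in> V'" for v
      using kp[OF that] height_smul[of "kk v" "pr v"] by simp
    have pr1: "1 \<le> height (pr v)" "height (pr v) \<le> 4 * 2 ^ t" if "v \<in> V'" for v
    proof -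
      have "height (pr v) \<noteq> 0" using hpr[OF that] V'(2)[OF that] by auto
      thus 1: "1 \<le> height (pr v)" using height_eq_0_or_ge_1 by blast
      have "1 * height (pr v) \<le> of_int (kk v) * height (pr v)"
        using kp[OF that] 1 by (intro mult_right_mono) auto
      thus "height (pr v) \<le> 4 * 2 ^ t" using hpr[OF that] V'(2)[OF that] by simp
    qed
    have Esub: "measure lborel (E 0 v e' 4) \<le> measure lborel (E 0 (pr v) e' 4)" if "v \<in> V'" for v
    proof (rule measure_mono_fmeasurable)
      have k1: "1 \<le> \<bar>real_of_int (kk v)\<bar>" using kp[OF that] by linarith
      have le: "\<bar>y\<bar> \<le> \<bar>of_int (kk v) * y\<bar>" for y :: real
        unfolding abs_mult using k1 mult_right_mono[of 1 "\<bar>real_of_int (kk v)\<bar>" "\<bar>y\<bar>"] by simp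
      show "E 0 v e' 4 \<subseteq> E 0 (pr v) e' 4"
      proof
        fix x assume "x \<in> E 0 v e' 4"
        hence "x \<in> E 0 (smul (kk v) (pr v)) e' 4" using kp[OF that] by simp
        thus "x \<in> E 0 (pr v) e' 4"
          unfolding E_def F_smul using le[of "F 0 (pr v) x"] le[of "F' 0 (pr v) x"] by auto
      qed
    qed (use E_fmeasurable E_measurable in auto)
    define P where "P = pr ` V'"
    have P: "finite P" using V' by (simp add: P_def)
    have Pp: "primitive u \<and> 1 \<le> height u \<and> height u \<le> 4 * 2 ^ t" if "u \<in> P" for u
      using that kp pr1 by (auto simp: P_def)
    have "\<exists>j. 2 ^ j \<le> height u \<and> height u < 2 * 2 ^ j" if "u \<in> P" for u
      using dyadic_level[of "height u"] Pp[OF that] by blast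
    then obtain lev where lev: "\<And>u. u \<in> P \<Longrightarrow> 2 ^ lev u \<le> height u \<and> height u < 2 * 2 ^ lev u" by metis
    have lev_le: "lev u \<le> t + 2" if "u \<in> P" for u
    proof -
      have "(2::real) ^ lev u \<le> 2 ^ (t + 2)" using lev[OF that] Pp[OF that] by simp
      thus ?thesis by (rule power_le_imp_le_exp[rotated]) simp
    qed
    have fib: "real (card {v\<in>V'. pr v = u}) * 2 ^ lev u \<le> 4 * 2 ^ t" if "u \<in> P" for u
    proof -
      define n where "n = nat \<lfloor>4 * 2 ^ t / height u\<rfloor>"
      have hu: "1 \<le> height u" using Pp[OF that] by simp
      have "inj_on kk {v\<in>V'. pr v = u}"
        using kp by (intro inj_onI) (metis (mono_tags, lifting) mem_Collect_eq)
      moreover have "kk ` {v\<in>V'. pr v = u} \<subseteq> {1..int n}"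
      proof clarify
        fix v assume v: "v \<in> V'" "u = pr v"
        have "of_int (kk v) * height u \<le> 4 * 2 ^ t" using hpr[OF v(1)] V'(2)[OF v(1)] v(2) by simp
        hence "of_int (kk v) \<le> 4 * 2 ^ t / height u" using hu by (simp add: field_simps)
        hence "kk v \<le> \<lfloor>4 * 2 ^ t / height u\<rfloor>" by (simp add: le_floor_iff)
        moreover have "1 \<le> kk v" using kp[OF v(1)] by blast
        ultimately show "kk v \<in> {1..int n}" unfolding n_def atLeastAtMost_iff by linarith
      qed
      ultimately have "card {v\<in>V'. pr v = u} \<le> n"
        using card_inj_on_le[of kk "{v\<in>V'. pr v = u}" "{1..int n}"] by simp
      hence "real (card {v\<in>V'. pr v = u}) \<le> real n" by simp
      also have "\<dots> \<le> 4 * 2 ^ t / height u" using hu by (simp add: n_def)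
      finally have "real (card {v\<in>V'. pr v = u}) * height u \<le> 4 * 2 ^ t" using hu by (simp add: field_simps)
      moreover have "real (card {v\<in>V'. pr v = u}) * 2 ^ lev u \<le> real (card {v\<in>V'. pr v = u}) * height u"
        using lev[OF that] by (intro mult_left_mono) auto
      ultimately show ?thesis by simp
    qed
    define g where "g u = measure lborel (E 0 u (64 / 4 ^ lev u) 6)" for u
    have g0: "0 \<le> g u" for u by (simp add: g_def)
    have "(\<Sum>v\<in>V. measure lborel (E 0 v e' 4)) = (\<Sum>v\<in>V'. measure lborel (E 0 v e' 4))"
      using V zero by (intro sum.mono_neutral_right) (auto simp: V'_def)
    also have "\<dots> \<le> (\<Sum>v\<in>V'. measure lborel (E 0 (pr v) e' 4))" by (intro sum_mono Esub)
    also have "\<dots> = (\<Sum>u\<in>P. \<Sum>v\<in>{v\<in>V'. pr v = u}. measure lborel (E 0 (pr v) e' 4))"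
      using V' P by (intro sum.group[symmetric]) (auto simp: P_def)
    also have "\<dots> = (\<Sum>u\<in>P. real (card {v\<in>V'. pr v = u}) * measure lborel (E 0 u e' 4))"
      by (intro sum.cong) auto
    also have "\<dots> \<le> (\<Sum>u\<in>P. 4 * C1 * (2 ^ t * sqrt e') * g u)"
    proof (intro sum_mono)
      fix u assume u: "u \<in> P"
      have "(4::real) ^ lev u \<le> 4 ^ (t + 2)" using lev_le[OF u] by (intro power_increasing) auto
      hence "64 / 4 ^ (t + 2) \<le> 64 / (4::real) ^ lev u" by (intro divide_left_mono) auto
      moreover have "2 * e' \<le> 64 / 4 ^ (t + 2)" using e'(3) by (simp add: power_add)
      ultimately have "2 * e' \<le> 64 / 4 ^ lev u" by linarith
      from C1(2)[OF _ _ e'(1) this] lev[OF u]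
      have "measure lborel (E 0 u e' 4) \<le> C1 * sqrt e' * 2 ^ lev u * g u" by (auto simp: g_def)
      hence "real (card {v\<in>V'. pr v = u}) * measure lborel (E 0 u e' 4)
        \<le> real (card {v\<in>V'. pr v = u}) * (C1 * sqrt e' * 2 ^ lev u * g u)" by (intro mult_left_mono) auto
      also have "\<dots> = (real (card {v\<in>V'. pr v = u}) * 2 ^ lev u) * (C1 * sqrt e' * g u)" by simp
      also have "\<dots> \<le> (4 * 2 ^ t) * (C1 * sqrt e' * g u)"
        using C1 e' g0 by (intro mult_right_mono fib u) auto
      finally show "real (card {v\<in>V'. pr v = u}) * measure lborel (E 0 u e' 4)
        \<le> 4 * C1 * (2 ^ t * sqrt e') * g u" by (simp add: mult_ac)
    qed
    also have "\<dots> = 4 * C1 * (2 ^ t * sqrt e') * (\<Sum>u\<in>P. g u)" by (simp add: sum_distrib_left)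
    finally have main: "(\<Sum>v\<in>V. measure lborel (E 0 v e' 4)) \<le> 4 * C1 * (2 ^ t * sqrt e') * (\<Sum>u\<in>P. g u)" .
    have "(\<Sum>u\<in>P. g u) = (\<Sum>j\<in>{..t + 2}. \<Sum>u\<in>{u\<in>P. lev u = j}. g u)"
      using P lev_le by (intro sum.group[symmetric]) auto
    also have "\<dots> \<le> (\<Sum>j\<in>{..t + 2}. C0)"
    proof (intro sum_mono)
      fix j
      have "(\<Sum>u\<in>{u\<in>P. lev u = j}. g u) = (\<Sum>u\<in>{u\<in>P. lev u = j}. measure lborel (E 0 u (64 / 4 ^ j) 6))"
        by (intro sum.cong) (auto simp: g_def)
      also have "\<dots> \<le> C0" using P Pp lev by (intro C0) auto
      finally show "(\<Sum>u\<in>{u\<in>P. lev u = j}. g u) \<le> C0" .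
    qed
    also have "\<dots> = C0 * (real t + 3)" by simp
    finally have "4 * C1 * (2 ^ t * sqrt e') * (\<Sum>u\<in>P. g u) \<le> 4 * C1 * (2 ^ t * sqrt e') * (C0 * (real t + 3))"
      using C1(1) e'(1) by (intro mult_left_mono) auto
    with main show "(\<Sum>v\<in>V. measure lborel (E 0 v e' 4)) \<le> 4 * C1 * C0 * (2 ^ t * sqrt e') * (real t + 3)"
      by (simp add: mult_ac)
  qed (use C0 C1 in simp)
qed

end

section \<open>Inhomogeneous forms with small derivative\<close>

context arc
begin

lemma finite_heights: "finite {v. height v \<le> H \<and> E \<kappa> v e \<Lambda> \<noteq> {}}"
proof -
  define B where "B = \<lceil>2 * A * \<bar>H\<bar> + \<bar>\<kappa>\<bar> * A + \<bar>e\<bar>\<rceil> + \<lceil>\<bar>H\<bar>\<rceil>"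
  have "{v. height v \<le> H \<and> E \<kappa> v e \<Lambda> \<noteq> {}} \<subseteq> {-B..B} \<times> {-B..B} \<times> {-B..B}"
  proof clarify
    fix a b p :: int
    assume h: "height (a, b, p) \<le> H" and "E \<kappa> (a, b, p) e \<Lambda> \<noteq> {}"
    then obtain x where x: "x \<in> {\<alpha>..\<beta>}" "\<bar>F \<kappa> (a, b, p) x\<bar> \<le> e" by (auto simp: E_def)
    have a: "\<bar>real_of_int a\<bar> \<le> \<bar>H\<bar>" and b: "\<bar>real_of_int b\<bar> \<le> \<bar>H\<bar>" using h by (auto simp: height_def)
    have "\<bar>of_int a * f1 x\<bar> \<le> \<bar>H\<bar> * A" "\<bar>of_int b * f2 x\<bar> \<le> \<bar>H\<bar> * A" "\<bar>\<kappa> * l x\<bar> \<le> \<bar>\<kappa>\<bar> * A"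
      unfolding abs_mult using a b bounds_f1(1)[OF x(1)] bounds_f2(1)[OF x(1)] bounds_l(1)[OF x(1)]
      by (auto intro!: mult_mono mult_left_mono)
    hence "\<bar>real_of_int p\<bar> \<le> \<bar>H\<bar> * A + \<bar>H\<bar> * A + \<bar>\<kappa>\<bar> * A + \<bar>e\<bar>"
      using x(2) unfolding F_def prod.case by linarith
    hence "\<bar>real_of_int p\<bar> \<le> 2 * A * \<bar>H\<bar> + \<bar>\<kappa>\<bar> * A + \<bar>e\<bar>" by (simp add: algebra_simps)
    moreover have "0 \<le> 2 * A * \<bar>H\<bar> + \<bar>\<kappa>\<bar> * A + \<bar>e\<bar>" using A by simp
    moreover have "0 \<le> \<bar>H\<bar>" by simp
    ultimately have "\<bar>a\<bar> \<le> B" "\<bar>b\<bar> \<le> B" "\<bar>p\<bar> \<le> B" using a b unfolding B_def by linarith+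
    thus "(a \<in> {-B..B}) \<and> (b, p) \<in> {-B..B} \<times> {-B..B}" by auto
  qed
  thus ?thesis by (rule finite_subset) auto
qed

text \<open>Passing to differences doubles the bounds for height, value and derivative, which is the
  origin of 4 * 2^t, 2 / 4^t and 4 in the homogeneous estimate. At this threshold 2^t * sqrt e' is
  the constant sqrt 2, and t >= 1 makes e' < 1.\<close>

lemma inhomogeneous_sum_bounded:
  obtains C where "0 \<le> C" "\<And>t V. finite V \<Longrightarrow> 1 \<le> t \<Longrightarrow> (\<And>v. v \<in> V \<Longrightarrow> height v < 2 * 2 ^ t) \<Longrightarrow>
      (\<Sum>v\<in>V. measure lborel (E 1 v (1 / 4 ^ t) 2)) \<le> C * (real t + 3)"
proof -
  obtain C where C: "0 \<le> C" "\<And>t e' V. finite V \<Longrightarrow> 0 < e' \<Longrightarrow> e' < 1 \<Longrightarrow> e' \<le> 2 / 4 ^ t \<Longrightarrow>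
      (\<And>v. v \<in> V \<Longrightarrow> v \<noteq> 0 \<and> height v \<le> 4 * 2 ^ t) \<Longrightarrow>
      (\<Sum>v\<in>V. measure lborel (E 0 v e' 4)) \<le> C * (2 ^ t * sqrt e') * (real t + 3)"
    using homogeneous_sum_bounded by blast
  show ?thesis
  proof (rule that[of "1 + C * sqrt 2"])
    fix t :: nat and V
    assume V: "finite V" "1 \<le> t" "\<And>v. v \<in> V \<Longrightarrow> height v < 2 * 2 ^ t"
    define K where "K = (\<lambda>(v, w). v - w) ` (V \<times> V) - {0}"
    have K: "finite K" using V by (simp add: K_def)
    define e' where "e' = 2 / (4::real) ^ t"
    have "(4::real) ^ 1 \<le> 4 ^ t" using V by (intro power_increasing) auto
    hence e': "0 < e'" "e' < 1" by (auto simp: e'_def)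
    have Kh: "v \<noteq> 0 \<and> height v \<le> 4 * 2 ^ t" if "v \<in> K" for v
    proof -
      obtain u w where uw: "u \<in> V" "w \<in> V" "v = u - w" using \<open>v \<in> K\<close> by (auto simp: K_def)
      have "v \<noteq> 0" using that by (simp add: K_def)
      moreover have "height v \<le> 4 * 2 ^ t"
        using height_diff[of u w] V(3)[OF uw(1)] V(3)[OF uw(2)] uw(3) by simp
      ultimately show ?thesis by blast
    qed
    have "(\<Sum>v\<in>V. measure lborel (E 1 v (1 / 4 ^ t) 2)) \<le> 1 * (\<beta> - \<alpha>) + 1 * (\<Sum>v\<in>K. measure lborel (E 0 v e' 4))"
    proof (rule sum_measure_le_of_card)
      fix x assume x: "x \<in> {\<alpha>..\<beta>}"
      define S where "S = {v\<in>V. x \<in> E 1 v (1 / 4 ^ t) 2}"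
      have S: "finite S" using V by (simp add: S_def)
      have "real (card S) \<le> 1 + 1 * real (card {v\<in>K. x \<in> E 0 v e' 4})"
      proof (cases "S = {}")
        case False
        then obtain v1 where v1: "v1 \<in> S" by blast
        have "(\<lambda>v. v - v1) ` (S - {v1}) \<subseteq> {v\<in>K. x \<in> E 0 v e' 4}"
        proof (rule image_subsetI)
          fix v assume v: "v \<in> S - {v1}"
          have "v - v1 \<noteq> 0" "v \<in> V" "v1 \<in> V" using v v1 by (auto simp: S_def)
          hence "v - v1 \<in> K" unfolding K_def by blast
          moreover have "x \<in> E 0 (v - v1) e' 4"
          proof -
            have "\<bar>F 1 v x\<bar> \<le> 1 / 4 ^ t" "\<bar>F 1 v1 x\<bar> \<le> 1 / 4 ^ t" "\<bar>F' 1 v x\<bar> \<le> 2" "\<bar>F' 1 v1 x\<bar> \<le> 2"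
              using v v1 by (auto simp: S_def E_def)
            hence "\<bar>F 0 (v - v1) x\<bar> \<le> e'" "\<bar>F' 0 (v - v1) x\<bar> \<le> 4" unfolding e'_def F_diff[of 1, symmetric] by linarith+
            thus ?thesis using x by (simp add: E_def)
          qed
          ultimately show "v - v1 \<in> {v\<in>K. x \<in> E 0 v e' 4}" by blast
        qed
        moreover have "inj_on (\<lambda>v. v - v1) (S - {v1})" by (rule inj_onI) simp
        ultimately have "card (S - {v1}) \<le> card {v\<in>K. x \<in> E 0 v e' 4}" using K by (intro card_inj_on_le) auto
        moreover have "card S = Suc (card (S - {v1}))" using S v1 by (metis card_Suc_Diff1)
        ultimately show ?thesis by simp
      next
        case True
        show ?thesis unfolding True by simp
      qed
      thus "real (card {v \<in> V. x \<in> E 1 v (1 / 4 ^ t) 2}) \<le> 1 + 1 * real (card {v \<in> K. x \<in> E 0 v e' 4})"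
        by (simp add: S_def)
    qed (use ab in \<open>auto simp only: V(1) K E_measurable\<close>)
    also have "\<dots> \<le> 1 + C * (2 ^ t * sqrt e') * (real t + 3)"
      using C(2)[OF K e', of t] Kh ab by (auto simp: e'_def)
    also have "2 ^ t * sqrt e' = sqrt 2"
    proof -
      have "sqrt ((4::real) ^ t) = 2 ^ t" by (simp add: real_sqrt_power)
      thus ?thesis by (simp add: e'_def real_sqrt_divide)
    qed
    also have "1 + C * sqrt 2 * (real t + 3) \<le> (1 + C * sqrt 2) * (real t + 3)" by (simp add: algebra_simps)
    finally show "(\<Sum>v\<in>V. measure lborel (E 1 v (1 / 4 ^ t) 2)) \<le> (1 + C * sqrt 2) * (real t + 3)" .
  qed (use C in auto)
qed

text \<open>Cost is compared with the measure of the set enlarged to threshold 1 / q^2, where q =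
  2^t. If the least derivative D is at least q^(-1/2), diameter about \<delta> / D stands against
  length about 1 / (q^2 * D); otherwise diameter about (\<delta> / q)^(1/2) stands against length
  about q^(-3/2). The two ratios give the two terms.\<close>

lemma small_derivative_content:
  obtains C t0 where "0 \<le> C" "\<And>s t \<delta>. 0 < s \<Longrightarrow> s \<le> 1 \<Longrightarrow> t0 \<le> t \<Longrightarrow> 0 < \<delta> \<Longrightarrow> \<delta> \<le> 1 / (2 * 4 ^ t) \<Longrightarrow>
    hcontent s {x\<in>{\<alpha>..\<beta>}. \<exists>v. 2 ^ t \<le> height v \<and> height v < 2 * 2 ^ t \<and> \<bar>F 1 v x\<bar> \<le> \<delta> \<and> \<bar>F' 1 v x\<bar> \<le> 1}
      \<le> ennreal (C * (real t + 3) * (\<delta> powr s * 4 ^ t + (\<delta> / 2 ^ t) powr (s / 2) * (2 ^ t) powr (3 / 2)))"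
proof -
  obtain C0 where C0: "0 \<le> C0" "\<And>t V. finite V \<Longrightarrow> 1 \<le> t \<Longrightarrow> (\<And>v. v \<in> V \<Longrightarrow> height v < 2 * 2 ^ t) \<Longrightarrow>
      (\<Sum>v\<in>V. measure lborel (E 1 v (1 / 4 ^ t) 2)) \<le> C0 * (real t + 3)"
    using inhomogeneous_sum_bounded by blast
  define c1 where "c1 = (\<beta> - \<alpha>) / (12 * A)"
  have c1: "0 < c1" "c1 \<le> (\<beta> - \<alpha>) / 2" "12 * A * c1 \<le> 1" "c1 \<le> 1/12"
  proof -
    show "0 < c1" "12 * A * c1 \<le> 1" using ab A by (auto simp: c1_def)
    show "c1 \<le> (\<beta> - \<alpha>) / 2" unfolding c1_def using ab A by (intro divide_left_mono) auto
    have "c1 \<le> 1 / 12" unfolding c1_def using ab A by (intro frac_le) auto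
    thus "c1 \<le> 1/12" .
  qed
  define C1 where "C1 = 8 / (c * c1)"
  have C1: "0 < C1" using c c1 by (simp add: C1_def)
  \<comment> \<open>From this level on, the derivatives of l, at most A in absolute value, use up no
    more than half of the lower bound c * q.\<close>
  obtain t0 :: nat where t0: "2 * A / c \<le> 2 ^ t0" using real_arch_pow[of 2 "2 * A / c"] by (auto intro: less_imp_le)
  show ?thesis
  proof (rule that[of "2 * C1 * C0" "max 1 t0"])
    fix s \<delta> :: real and t :: nat
    assume s: "0 < s" "s \<le> 1" and t: "max 1 t0 \<le> t" and \<delta>: "0 < \<delta>" "\<delta> \<le> 1 / (2 * 4 ^ t)"
    define q where "q = (2::real) ^ t"
    have qq: "(4::real) ^ t = q * q" by (simp add: q_def power_mult_distrib[symmetric])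
    have q1: "1 \<le> q" by (simp add: q_def)
    have "(2::real) ^ t0 \<le> q" unfolding q_def using t by (intro power_increasing) auto
    hence "2 * A / c \<le> q" using t0 by simp
    hence q: "2 * A \<le> c * q" using c by (simp add: field_simps)
    define X where "X = C1 * (\<delta> powr s * (q * q) + (\<delta> / q) powr (s / 2) * q powr (3 / 2))"
    have X: "0 \<le> X" using C1 q1 by (simp add: X_def)
    define V where "V = {v. q \<le> height v \<and> height v < 2 * q \<and> E 1 v \<delta> 1 \<noteq> {}}"
    have "V \<subseteq> {v. height v \<le> 2 * q \<and> E 1 v \<delta> 1 \<noteq> {}}" by (auto simp: V_def)
    hence V: "finite V" using finite_heights finite_subset by blast
    have each: "hcontent s (E 1 v \<delta> 1) \<le> ennreal (2 * X * measure lborel (E 1 v (1 / 4 ^ t) 2))" if "v \<in> V" for v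
    proof -
      have v: "q \<le> height v" "height v < 2 * q" and ne: "E 1 v \<delta> 1 \<noteq> {}" using that by (auto simp: V_def)
      interpret C2_function \<alpha> \<beta> "F 1 v" "F' 1 v" "F'' 1 v" "3 * A * (2 * q)"
      proof (rule C2_F)
        show "height v \<le> 2 * q" using v by simp
        show "1 \<le> 2 * q" using q1 by simp
      qed simp
      have E: "E 1 v e \<Lambda> = {x\<in>{\<alpha>..\<beta>}. \<bar>F 1 v x\<bar> \<le> e \<and> \<bar>F' 1 v x\<bar> \<le> \<Lambda>}" for e \<Lambda> by (simp add: E_def)
      define k where "k = c * q / 2"
      have k: "0 < k" using c q1 by (simp add: k_def)
      have alt': "(\<forall>x\<in>{\<alpha>..\<beta>}. k \<le> \<bar>F' 1 v x\<bar>) \<or> (\<forall>x\<in>{\<alpha>..\<beta>}. k \<le> \<bar>F'' 1 v x\<bar>)"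
      proof -
        obtain a b p where vv: "v = (a, b, p)" by (cases v)
        have "c * q \<le> c * max \<bar>of_int a\<bar> \<bar>of_int b\<bar>"
          using v c by (intro mult_left_mono) (auto simp: vv height_def)
        hence cq: "2 * k \<le> c * max \<bar>of_int a\<bar> \<bar>of_int b\<bar>" "A \<le> k" using q by (auto simp: k_def)
        from alt[of "of_int a" "of_int b"] show ?thesis
        proof (elim disjE)
          assume *: "\<forall>x\<in>{\<alpha>..\<beta>}. c * max \<bar>real_of_int a\<bar> \<bar>real_of_int b\<bar> \<le> \<bar>of_int a * f1' x + of_int b * f2' x\<bar>"
          have "k \<le> \<bar>F' 1 v x\<bar>" if "x \<in> {\<alpha>..\<beta>}" for x
            using bspec[OF * that] bounds_l(2)[OF that] cq by (simp add: F'_def vv)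
          thus ?thesis by blast
        next
          assume *: "\<forall>x\<in>{\<alpha>..\<beta>}. c * max \<bar>real_of_int a\<bar> \<bar>real_of_int b\<bar> \<le> \<bar>of_int a * f1'' x + of_int b * f2'' x\<bar>"
          have "k \<le> \<bar>F'' 1 v x\<bar>" if "x \<in> {\<alpha>..\<beta>}" for x
            using bspec[OF * that] bounds_l(3)[OF that] cq by (simp add: F''_def vv)
          thus ?thesis by blast
        qed
      qed
      obtain x0 U1 U2 where x0: "x0 \<in> E 1 v \<delta> 1" and EU: "E 1 v \<delta> 1 = U1 \<union> U2"
        and U: "\<And>U. U = U1 \<or> U = U2 \<Longrightarrow> bounded U \<and> \<bar>F' 1 v x0\<bar> * diameter U \<le> 2 * \<delta> \<and> k * (diameter U)\<^sup>2 \<le> 4 * \<delta>"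
        using small_set_split[OF k \<delta>(1) alt' ne[unfolded E]] unfolding E[symmetric] by blast
      define D where "D = \<bar>F' 1 v x0\<bar>"
      have D: "0 \<le> D" "D \<le> 1" using x0 by (auto simp: D_def E_def)
      \<comment> \<open>The transition q^(-1/2) is where e / D equals (e / q)^(1/2) for e = 1 / q^2,
        that is, where the second derivative takes over from the first.\<close>
      define r where "r = q powr (-1/2)"
      have r: "0 < r" "r \<le> 1" "r * r = 1 / q" 
      proof -
        show "0 < r" using q1 by (simp add: r_def)
        show "r \<le> 1" unfolding r_def using q1 powr_mono[of "-1/2" 0 q] by simp
        have "r * r = q powr (-1/2 + -1/2)" unfolding r_def by (rule powr_add[symmetric])
        thus "r * r = 1 / q" using q1 by (simp add: powr_minus_divide)
      qed
      define D1 where "D1 = max D r"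
      have D1: "0 < D1" "D \<le> D1" "r \<le> D1" using r by (auto simp: D1_def)
      define e where "e = 1 / (q * q)"
      have e: "0 < e" "2 * \<delta> \<le> e" using q1 \<delta> by (auto simp: e_def qq field_simps)
      \<comment> \<open>Equal to c1 / (q^2 * D) above the transition and to c1 * q^(-3/2) below
        it.\<close>
      define y where "y = c1 * e / D1"
      have y0: "0 < y" using c1 e D1 by (simp add: y_def)
      have "1 / q \<le> D1 * D1" using mult_mono[OF D1(3) D1(3)] r D1 by simp
      hence D1q: "1 \<le> q * D1 * D1" using q1 by (simp add: field_simps)
      have eD1: "e / D1 \<le> 1"
      proof -
        have "1 \<le> q * (q * D1)"
        proof -
          have "1 * 1 \<le> q * q" using q1 by (intro mult_mono) auto
          moreover have "D1 \<le> 1" using D r by (simp add: D1_def)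
          hence "q * D1 * D1 \<le> q * D1 * 1" using q1 D1 by (intro mult_left_mono) auto
          hence "1 \<le> q * D1" using D1q by simp
          hence "1 * 1 \<le> q * (q * D1)" using q1 by (intro mult_mono) auto
          thus ?thesis by simp
        qed
        thus ?thesis using q1 D1 by (simp add: e_def field_simps)
      qed
      have y1: "y \<le> (\<beta> - \<alpha>) / 2"
      proof -
        have "c1 * (e / D1) \<le> c1 * 1" using eD1 c1 by (intro mult_left_mono) auto
        moreover have "y = c1 * (e / D1)" by (simp add: y_def)
        ultimately show ?thesis using c1 by linarith
      qed
      have qy: "q * (e / D1) * (e / D1) \<le> e"
      proof -
        have "q * (e / D1) * (e / D1) * 1 \<le> q * (e / D1) * (e / D1) * (q * D1 * D1)"
          using D1q q1 e D1 by (intro mult_left_mono) auto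
        also have "\<dots> = (q * q * e) * e" using D1 by simp
        also have "q * q * e = 1" using q1 by (simp add: e_def)
        finally show ?thesis by simp
      qed
      have Dy: "D * y \<le> e / 4"
      proof -
        have "D * y \<le> D1 * y" using D1 y0 by (intro mult_right_mono) auto
        also have "\<dots> = c1 * e" using D1 by (simp add: y_def)
        also have "\<dots> \<le> (1/4) * e" using c1 e by (intro mult_right_mono) auto
        finally show ?thesis by simp
      qed
      have My: "3 * A * (2 * q) * y\<^sup>2 / 2 \<le> e / 4"
      proof -
        have "3 * A * (2 * q) * y\<^sup>2 / 2 = (3 * A * c1 * c1) * (q * (e / D1) * (e / D1))"
          by (simp add: y_def power2_eq_square)
        also have "\<dots> \<le> (1/4) * e"
        proof (intro mult_mono qy)
          have "(12 * A * c1) * c1 \<le> 1 * 1" using c1 A by (intro mult_mono) auto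
          thus "3 * A * c1 * c1 \<le> 1 / 4" by simp
        qed (use c1 A q1 e in auto)
        finally show ?thesis by simp
      qed
      have L: "D + 3 * A * (2 * q) * y \<le> 2"
      proof -
        have "q * (e / D1) \<le> 1"
        proof -
          have "q * (e / D1) = 1 / (q * D1)" using q1 by (simp add: e_def)
          moreover have "1 \<le> q * D1"
          proof -
            have "D1 \<le> 1" using D r by (simp add: D1_def)
            hence "q * D1 * D1 \<le> q * D1 * 1" using q1 D1 by (intro mult_left_mono) auto
            thus ?thesis using D1q by simp
          qed
          ultimately show ?thesis by simp
        qed
        hence "6 * A * c1 * (q * (e / D1)) \<le> 6 * A * c1 * 1" using A c1 by (intro mult_left_mono) auto
        thus ?thesis using c1 D by (simp add: y_def algebra_simps)
      qed
      have yE: "y \<le> measure lborel (E 1 v e 2)"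
        unfolding E
        by (rule neighbourhood_measure[of x0 \<delta>]) (use x0 y0 y1 Dy My L e in \<open>auto simp: E_def D_def\<close>)
      have diam: "diameter U powr s \<le> X * measure lborel (E 1 v e 2)" if "U = U1 \<or> U = U2" for U
      proof -
        define d where "d = diameter U"
        have d: "0 \<le> d" "D * d \<le> 2 * \<delta>" "k * d\<^sup>2 \<le> 4 * \<delta>"
          using U[OF that] diameter_ge_0 by (auto simp: d_def D_def)
        have "d powr s \<le> X * y"
        proof (cases "r \<le> D")
          case True
          hence DD: "D1 = D" "0 < D" using r by (auto simp: D1_def)
          have "d \<le> 2 * \<delta> / D" using d DD by (simp add: field_simps)
          hence "d powr s \<le> (2 * \<delta> / D) powr s" using d s by (intro powr_mono2) auto
          also have "\<dots> = 2 powr s * \<delta> powr s * (1 / D) powr s" using \<delta> DD by (simp add: powr_divide powr_mult)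
          also have "\<dots> \<le> 2 * \<delta> powr s * (1 / D)"
          proof (intro mult_mono)
            show "2 powr s \<le> 2" using s powr_mono[of s 1 2] by simp
            show "(1 / D) powr s \<le> 1 / D" using s DD D powr_mono[of s 1 "1 / D"] by simp
          qed (use DD in auto)
          also have "\<dots> = (2 / c1) * (\<delta> powr s * (q * q)) * y" using q1 c1 DD by (simp add: y_def e_def)
          also have "\<dots> \<le> X * y"
          proof (intro mult_right_mono)
            have "2 / c1 \<le> C1" unfolding C1_def using c c1 by (intro frac_le) (auto simp: mult_le_cancel_right2)
            hence "2 / c1 * (\<delta> powr s * (q * q)) \<le> C1 * (\<delta> powr s * (q * q) + (\<delta> / q) powr (s / 2) * q powr (3 / 2))"
              using c1 q1 C1 by (intro mult_mono) auto
            thus "2 / c1 * (\<delta> powr s * (q * q)) \<le> X" by (simp add: X_def)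
          qed (use y0 in auto)
          finally show ?thesis .
        next
          case False
          hence DD: "D1 = r" by (simp add: D1_def)
          have "d\<^sup>2 \<le> 8 / c * (\<delta> / q)" using d(3) c q1 by (simp add: k_def field_simps)
          hence "d\<^sup>2 powr (s / 2) \<le> (8 / c * (\<delta> / q)) powr (s / 2)" using d s by (intro powr_mono2) auto
          also have "d\<^sup>2 powr (s / 2) = d powr s"
          proof (cases "d = 0")
            case False
            hence "d\<^sup>2 = d powr 2" using d by (simp add: powr_numeral)
            thus ?thesis by (simp add: powr_powr)
          qed simp
          also have "(8 / c * (\<delta> / q)) powr (s / 2) = (8 / c) powr (s / 2) * (\<delta> / q) powr (s / 2)"
            by (rule powr_mult)
          also have "\<dots> \<le> 8 / c * (\<delta> / q) powr (s / 2)"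
          proof (intro mult_right_mono)
            have "1 \<le> 8 / c" using c by simp
            thus "(8 / c) powr (s / 2) \<le> 8 / c" using s powr_mono[of "s / 2" 1 "8 / c"] by simp
          qed auto
          also have "\<dots> = C1 * ((\<delta> / q) powr (s / 2) * q powr (3/2)) * y"
          proof -
            have "q powr (3/2) * e = r"
            proof -
              have "q powr (3/2) * e = q powr (3/2) / q powr 2" using q1 by (simp add: e_def powr_numeral power2_eq_square)
              also have "\<dots> = q powr (3/2 - 2)" by (rule powr_diff[symmetric])
              finally show ?thesis by (simp add: r_def)
            qed
            hence "q powr (3/2) * y = c1" using r by (simp add: y_def DD mult.left_commute)
            hence "C1 * ((\<delta> / q) powr (s / 2) * q powr (3/2)) * y = C1 * c1 * (\<delta> / q) powr (s / 2)"
              by (simp add: mult_ac)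
            thus ?thesis using c1 by (simp add: C1_def)
          qed
          also have "\<dots> \<le> X * y"
            unfolding X_def using C1 y0 q1 by (intro mult_right_mono mult_left_mono) auto
          finally show ?thesis .
        qed
        also have "\<dots> \<le> X * measure lborel (E 1 v e 2)" using yE X by (intro mult_left_mono) auto
        finally show ?thesis by (simp add: d_def)
      qed
      have "hcontent s (E 1 v \<delta> 1) \<le> hcontent s U1 + hcontent s U2" unfolding EU by (rule hcontent_Un)
      also have "\<dots> \<le> ennreal (diameter U1 powr s) + ennreal (diameter U2 powr s)"
        using U by (intro add_mono hcontent_le_diameter) auto
      also have "\<dots> \<le> ennreal (X * measure lborel (E 1 v e 2)) + ennreal (X * measure lborel (E 1 v e 2))"
        using diam by (intro add_mono ennreal_leI) auto
      also have "\<dots> = ennreal (2 * X * measure lborel (E 1 v e 2))"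
        using X by (subst ennreal_plus[symmetric]) auto
      finally show ?thesis by (simp add: e_def qq)
    qed
    have "{x\<in>{\<alpha>..\<beta>}. \<exists>v. q \<le> height v \<and> height v < 2 * q \<and> \<bar>F 1 v x\<bar> \<le> \<delta> \<and> \<bar>F' 1 v x\<bar> \<le> 1} \<subseteq> (\<Union>v\<in>V. E 1 v \<delta> 1)"
    proof clarify
      fix x a b p assume "x \<in> {\<alpha>..\<beta>}" "q \<le> height (a, b, p)" "height (a, b, p) < 2 * q"
        "\<bar>F 1 (a, b, p) x\<bar> \<le> \<delta>" "\<bar>F' 1 (a, b, p) x\<bar> \<le> 1"
      hence "x \<in> E 1 (a, b, p) \<delta> 1" "(a, b, p) \<in> V" by (auto simp: V_def E_def)
      thus "x \<in> (\<Union>v\<in>V. E 1 v \<delta> 1)" by blast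
    qed
    hence "hcontent s {x\<in>{\<alpha>..\<beta>}. \<exists>v. q \<le> height v \<and> height v < 2 * q \<and> \<bar>F 1 v x\<bar> \<le> \<delta> \<and> \<bar>F' 1 v x\<bar> \<le> 1}
      \<le> hcontent s (\<Union>v\<in>V. E 1 v \<delta> 1)" by (rule hcontent_mono)
    also have "\<dots> \<le> (\<Sum>v\<in>V. hcontent s (E 1 v \<delta> 1))" by (rule hcontent_UN_finite[OF V])
    also have "\<dots> \<le> (\<Sum>v\<in>V. ennreal (2 * X * measure lborel (E 1 v (1 / 4 ^ t) 2)))" by (intro sum_mono each)
    also have "\<dots> = ennreal (2 * X * (\<Sum>v\<in>V. measure lborel (E 1 v (1 / 4 ^ t) 2)))"
      using X by (subst sum_ennreal) (auto simp: sum_distrib_left)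
    also have "\<dots> \<le> ennreal (2 * X * (C0 * (real t + 3)))"
    proof (intro ennreal_leI mult_left_mono C0(2)[OF V])
      fix v assume "v \<in> V" thus "height v < 2 * 2 ^ t" by (simp add: V_def q_def)
    qed (use t X in auto)
    also have "2 * X * (C0 * (real t + 3)) = 2 * C1 * C0 * (real t + 3) *
       (\<delta> powr s * 4 ^ t + (\<delta> / 2 ^ t) powr (s / 2) * (2 ^ t) powr (3 / 2))"
      unfolding X_def qq by (simp only: q_def mult_ac)
    finally show "hcontent s {x\<in>{\<alpha>..\<beta>}. \<exists>v. 2 ^ t \<le> height v \<and> height v < 2 * 2 ^ t \<and> \<bar>F 1 v x\<bar> \<le> \<delta> \<and> \<bar>F' 1 v x\<bar> \<le> 1}
      \<le> ennreal (2 * C1 * C0 * (real t + 3) * (\<delta> powr s * 4 ^ t + (\<delta> / 2 ^ t) powr (s / 2) * (2 ^ t) powr (3 / 2)))"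
      by (simp add: q_def)
  qed (use C0 C1 in auto)
qed

end

section \<open>Forms with large derivative\<close>

lemma harm_le_ln:
  assumes "1 \<le> n"
  shows "harm n \<le> 1 + ln (real n)"
proof -
  obtain m where n: "n = Suc m" using assms by (cases n) auto
  have "harm (Suc m) - ln (real (Suc m)) \<le> harm (Suc 0) - ln (real (Suc 0))"
    using decseq_harm_diff_ln by (rule decseqD) simp
  thus ?thesis by (simp add: n harm_expand)
qed

text \<open>The values \<open>a u + w\<close> are \<open>c\<close>-separated, so their reciprocals sum like a harmonic series.\<close>

lemma sum_inverse_affine_le:
  fixes u w c B :: real and S :: "int set"
  assumes c: "0 < c" "c \<le> 1" and u: "c \<le> \<bar>u\<bar>" and B: "1 \<le> B"
    and S: "finite S" "\<And>a. a \<in> S \<Longrightarrow> 3/4 \<le> \<bar>of_int a * u + w\<bar> \<and> \<bar>of_int a * u + w\<bar> \<le> B"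
  shows "(\<Sum>a\<in>S. 1 / \<bar>of_int a * u + w\<bar>) \<le> 4 / c * (1 + ln (2 * B / c))"
proof -
  define g where "g a = of_int a * u + w" for a :: int
  define k where "k a = nat \<lceil>\<bar>g a\<bar> / c\<rceil>" for a
  define K where "K = nat \<lceil>B / c\<rceil>"
  have gpos: "0 < \<bar>g a\<bar> / c" if "a \<in> S" for a 
  proof -
    have "0 < \<bar>g a\<bar>" using S(2)[OF that] unfolding g_def by linarith
    thus ?thesis using c by simp
  qed
  have k: "1 \<le> k a" "k a \<le> K" "\<bar>g a\<bar> \<le> c * real (k a)" "c * (real (k a) - 1) < \<bar>g a\<bar>" if "a \<in> S" for a
  proof -
    show "1 \<le> k a" using gpos[OF that] by (simp add: k_def Suc_le_eq)
    show "k a \<le> K" unfolding k_def K_def using S(2)[OF that] c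
      by (intro nat_mono ceiling_mono divide_right_mono) (auto simp: g_def)
    have "real (k a) = of_int \<lceil>\<bar>g a\<bar> / c\<rceil>" using gpos[OF that] by (simp add: k_def)
    hence "\<bar>g a\<bar> / c \<le> real (k a)" "real (k a) < \<bar>g a\<bar> / c + 1" by linarith+
    thus "\<bar>g a\<bar> \<le> c * real (k a)" "c * (real (k a) - 1) < \<bar>g a\<bar>" using c by (auto simp: field_simps)
  qed
  have le: "1 / \<bar>g a\<bar> \<le> 2 / c * inverse (real (k a))" if "a \<in> S" for a
  proof -
    have "c * real (k a) \<le> 2 * \<bar>g a\<bar>"
    proof (cases "k a = 1")
      \<comment> \<open>In the first bucket the reciprocal is bounded only thanks to the lower bound
        3/4.\<close>
      case True
      thus ?thesis using S(2)[OF that] c by (simp add: g_def)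
    next
      case False
      hence "2 \<le> k a" using k(1)[OF that] by simp
      hence "c * real (k a) \<le> c * (2 * (real (k a) - 1))" using c by (intro mult_left_mono) auto
      also have "\<dots> = 2 * (c * (real (k a) - 1))" by simp
      finally show ?thesis using k(4)[OF that] by linarith
    qed
    hence "1 / (2 * \<bar>g a\<bar>) \<le> 1 / (c * real (k a))"
      using k(1)[OF that] c by (intro divide_left_mono mult_pos_pos) (use gpos[OF that] in \<open>auto simp: zero_less_divide_iff\<close>)
    thus ?thesis by (simp add: field_simps)
  qed
  \<comment> \<open>Values in the same bucket with the same sign differ by less than c, so
    \<open>c\<close>-separation makes bucket and sign determine a; the sign accounts for a factor
    2.\<close>
  define \<phi> where "\<phi> a = (k a, g a > 0)" for a
  have inj: "inj_on \<phi> S"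
  proof (rule inj_onI)
    fix a b assume ab: "a \<in> S" "b \<in> S" "\<phi> a = \<phi> b"
    hence kk: "k a = k b" "(g a > 0) = (g b > 0)" by (auto simp: \<phi>_def)
    have "\<bar>g a - g b\<bar> < c"
      using k(3,4)[OF ab(1)] k(3,4)[OF ab(2)] kk by (cases "g a > 0") (auto simp: algebra_simps)
    moreover have "g a - g b = of_int (a - b) * u" by (simp add: g_def algebra_simps)
    ultimately have "\<bar>of_int (a - b)\<bar> * \<bar>u\<bar> < c" by (simp add: abs_mult)
    moreover have "\<bar>of_int (a - b)\<bar> * c \<le> \<bar>of_int (a - b)\<bar> * \<bar>u\<bar>" using u by (intro mult_left_mono) auto
    ultimately have "\<bar>of_int (a - b)\<bar> * c < 1 * c" by simp
    hence "\<bar>real_of_int (a - b)\<bar> < 1" using c by (simp add: mult_less_cancel_right)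
    thus "a = b" by linarith
  qed
  have "(\<Sum>a\<in>S. 1 / \<bar>g a\<bar>) \<le> (\<Sum>a\<in>S. 2 / c * inverse (real (fst (\<phi> a))))"
    using le by (intro sum_mono) (auto simp: \<phi>_def)
  also have "\<dots> = (\<Sum>z\<in>\<phi> ` S. 2 / c * inverse (real (fst z)))"
    using inj by (simp add: sum.reindex)
  also have "\<dots> \<le> (\<Sum>z\<in>{1..K} \<times> (UNIV::bool set). 2 / c * inverse (real (fst z)))"
    using c k by (intro sum_mono2) (auto simp: \<phi>_def)
  also have "\<dots> = (\<Sum>n\<in>{1..K}. \<Sum>b\<in>(UNIV::bool set). 2 / c * inverse (real n))"
    by (simp only: sum.cartesian_product split_def)
  also have "\<dots> = 4 / c * harm K" by (simp add: harm_def sum_distrib_left UNIV_bool)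
  also have "\<dots> \<le> 4 / c * (1 + ln (2 * B / c))"
  proof (intro mult_left_mono)
    have Bc: "1 \<le> B / c" using B c by simp
    hence K1: "1 \<le> K" by (simp add: K_def Suc_le_eq)
    have "real K \<le> B / c + 1" using Bc by (simp add: K_def)
    also have "\<dots> \<le> 2 * B / c" using Bc by simp
    finally have "ln (real K) \<le> ln (2 * B / c)" using K1 by (subst ln_le_cancel_iff) (auto intro: less_le_trans)
    thus "harm K \<le> 1 + ln (2 * B / c)" using harm_le_ln[OF K1] by simp
  qed (use c in auto)
  finally show ?thesis by (simp add: g_def)
qed

context arc
begin

text \<open>On pieces of length about 1 / Q the derivative can be frozen at the left endpoint.
  Writing (\<delta> / D)^s as \<delta>^s * D^(1-s) / D and bounding D^(1-s) by a constant times
  Q^(1-s) leaves the sum of 1 / D, which over a is harmonic because c <= |f1'|. About Q pieces, O(Q)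
  values of b and boundedly many p give the power Q^(3-s).\<close>

lemma large_derivative_content:
  obtains C where "0 \<le> C" "\<And>\<kappa> s Q \<delta>. \<bar>\<kappa>\<bar> \<le> 1 \<Longrightarrow> 0 < s \<Longrightarrow> s \<le> 1 \<Longrightarrow> 1 \<le> Q \<Longrightarrow> 0 < \<delta> \<Longrightarrow> \<delta> \<le> 1 \<Longrightarrow>
    hcontent s {x\<in>{\<alpha>..\<beta>}. \<exists>v. height v \<le> Q \<and> \<bar>F \<kappa> v x\<bar> \<le> \<delta> \<and> 1 \<le> \<bar>F' \<kappa> v x\<bar>}
      \<le> ennreal (C * \<delta> powr s * Q powr (3 - s) * (1 + ln Q))"
proof -
  define C3 where "C3 = 4 / c * (1 + ln (6 * A / c))"
  have Ac: "1 \<le> 6 * A / c" using A c by simp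
  have C3: "0 \<le> C3" using Ac c by (simp add: C3_def)
  define C where "C = 13 * A * (12 * A * (5 * (3 * C3)))"
  show ?thesis
  proof (rule that[of C])
    show "0 \<le> C" using A C3 by (simp add: C_def)
    fix \<kappa> s Q \<delta> :: real
    assume \<kappa>: "\<bar>\<kappa>\<bar> \<le> 1" and s: "0 < s" "s \<le> 1" and Q: "1 \<le> Q" and \<delta>: "0 < \<delta>" "\<delta> \<le> 1"
    have lnQ: "0 \<le> ln Q" using Q by simp
    \<comment> \<open>The second derivative is at most 3 * A * Q, so with 12 * A * Q pieces F'
      varies by at most 1/4 on each, and 1 <= |F'| leaves at least 3/4 at the endpoint.\<close>
    define n where "n = nat \<lceil>12 * A * Q\<rceil>"
    have AQ: "1 \<le> A * Q" using mult_mono[of 1 A 1 Q] A Q by simp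
    have n: "12 * A * Q \<le> real n" "real n \<le> 13 * A * Q"
      unfolding n_def using AQ by linarith+
    have n0: "0 < real n" using n AQ by linarith
    define \<eta> where "\<eta> = (\<beta> - \<alpha>) / n"
    have \<eta>: "0 < \<eta>" "12 * A * Q * \<eta> \<le> 1"
    proof -
      show "0 < \<eta>" using ab n0 by (simp add: \<eta>_def)
      have "12 * A * Q * \<eta> \<le> real n * \<eta>" using n \<open>0 < \<eta>\<close> by (intro mult_right_mono) auto
      also have "\<dots> \<le> 1" using n0 ab by (simp add: \<eta>_def)
      finally show "12 * A * Q * \<eta> \<le> 1" .
    qed
    define x where "x i = \<alpha> + real i * \<eta>" for i
    define P where "P i = {y\<in>{\<alpha>..\<beta>}. x i \<le> y \<and> y \<le> x i + \<eta>}" for i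
    have xJ: "x i \<in> {\<alpha>..\<beta>}" if "i < n" for i
    proof -
      have "real i * \<eta> \<le> real n * \<eta>" using that \<eta> by (intro mult_right_mono) auto
      also have "\<dots> = \<beta> - \<alpha>" using n0 by (simp add: \<eta>_def)
      finally show ?thesis using \<eta> by (simp add: x_def)
    qed
    define U where "U i v = {y\<in>P i. \<bar>F \<kappa> v y\<bar> \<le> \<delta>}" for i v
    define R where "R i = {v. height v \<le> Q \<and> 3/4 \<le> \<bar>F' \<kappa> v (x i)\<bar> \<and> U i v \<noteq> {}}" for i
    have near: "\<bar>F' \<kappa> v y - F' \<kappa> v (x i)\<bar> \<le> 1/4" "\<bar>F \<kappa> v y - F \<kappa> v (x i)\<bar> \<le> 1"
      and expand: "z \<in> P i \<Longrightarrow> (\<bar>F' \<kappa> v (x i)\<bar> - 1/4) * \<bar>y - z\<bar> \<le> \<bar>F \<kappa> v y - F \<kappa> v z\<bar>"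
      if v: "height v \<le> Q" and i: "i < n" and y: "y \<in> P i" for v i y z
    proof -
      interpret C2_function \<alpha> \<beta> "F \<kappa> v" "F' \<kappa> v" "F'' \<kappa> v" "3 * A * Q"
        using \<kappa> v Q by (rule C2_F)
      have yJ: "y \<in> {\<alpha>..\<beta>}" and yx: "\<bar>y - x i\<bar> \<le> \<eta>" if "y \<in> P i" for y using that by (auto simp: P_def)
      have n4: "\<bar>F' \<kappa> v y - F' \<kappa> v (x i)\<bar> \<le> 1/4" if "y \<in> P i" for y
      proof -
        have "\<bar>F' \<kappa> v y - F' \<kappa> v (x i)\<bar> \<le> 3 * A * Q * \<bar>y - x i\<bar>" by (rule deriv_lipschitz[OF xJ[OF i] yJ[OF that]])
        also have "\<dots> \<le> 3 * A * Q * \<eta>" using yx[OF that] A Q by (intro mult_left_mono) auto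
        finally show ?thesis using \<eta> by simp
      qed
      show "\<bar>F' \<kappa> v y - F' \<kappa> v (x i)\<bar> \<le> 1/4" using n4 y .
      show "\<bar>F \<kappa> v y - F \<kappa> v (x i)\<bar> \<le> 1"
      proof -
        obtain t where t: "t \<in> {min (x i) y..max (x i) y}" "F \<kappa> v y - F \<kappa> v (x i) = F' \<kappa> v t * (y - x i)"
          using mvt[OF xJ[OF i] yJ[OF y]] by blast
        have "t \<in> {\<alpha>..\<beta>}" using t(1) xJ[OF i] yJ[OF y] by auto
        hence "\<bar>F' \<kappa> v t\<bar> \<le> 3 * A * Q" using F'_bound(1)[OF _ \<kappa> v Q] by blast
        hence "\<bar>F' \<kappa> v t * (y - x i)\<bar> \<le> 3 * A * Q * \<eta>" unfolding abs_mult using yx[OF y] A Q by (intro mult_mono) auto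
        thus ?thesis using t(2) \<eta> by simp
      qed
      show "(\<bar>F' \<kappa> v (x i)\<bar> - 1/4) * \<bar>y - z\<bar> \<le> \<bar>F \<kappa> v y - F \<kappa> v z\<bar>" if z: "z \<in> P i"
      proof -
        obtain t where t: "t \<in> {min z y..max z y}" "F \<kappa> v y - F \<kappa> v z = F' \<kappa> v t * (y - z)"
          using mvt[OF yJ[OF z] yJ[OF y]] by blast
        have "t \<in> P i" using t(1) y z by (auto simp: P_def)
        from n4[OF this] show ?thesis unfolding t(2) abs_mult by (intro mult_right_mono) linarith+
      qed
    qed
    have finR: "finite (R i)" for i
    proof (rule finite_subset[OF _ finite_heights[of Q \<kappa> \<delta> "3 * A * Q"]])
      show "R i \<subseteq> {v. height v \<le> Q \<and> E \<kappa> v \<delta> (3 * A * Q) \<noteq> {}}"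
      proof
        fix v assume v: "v \<in> R i"
        then obtain y where y: "y \<in> P i" "\<bar>F \<kappa> v y\<bar> \<le> \<delta>" and h: "height v \<le> Q" by (auto simp: R_def U_def)
        have yJ: "y \<in> {\<alpha>..\<beta>}" using y by (simp add: P_def)
        have "y \<in> E \<kappa> v \<delta> (3 * A * Q)" using y yJ F'_bound(1)[OF yJ \<kappa> h Q] by (simp add: E_def)
        thus "v \<in> {v. height v \<le> Q \<and> E \<kappa> v \<delta> (3 * A * Q) \<noteq> {}}" using h by blast
      qed
    qed
    have diamU: "hcontent s (U i v) \<le> ennreal (4 * \<delta> powr s * (3 * A * Q powr (1 - s)) * (1 / \<bar>F' \<kappa> v (x i)\<bar>))"
      if i: "i < n" and v: "v \<in> R i" for i v
    proof -
      define D where "D = \<bar>F' \<kappa> v (x i)\<bar>"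
      have h: "height v \<le> Q" and D: "3/4 \<le> D" using v by (auto simp: R_def D_def)
      have bU: "bounded (U i v)" by (rule bounded_subset[OF bounded_closed_interval[of \<alpha> \<beta>]]) (auto simp: U_def P_def)
      have "(D / 2) * diameter (U i v) \<le> 2 * \<delta>"
      proof (rule diameter_mult_le[OF bU])
        fix y z assume yz: "y \<in> U i v" "z \<in> U i v"
        have "(D / 2) * \<bar>y - z\<bar> \<le> (D - 1/4) * \<bar>y - z\<bar>" using D by (intro mult_right_mono) auto
        also have "\<dots> \<le> \<bar>F \<kappa> v y - F \<kappa> v z\<bar>" unfolding D_def using yz by (intro expand h i) (auto simp: U_def)
        also have "\<dots> \<le> 2 * \<delta>" using yz by (auto simp: U_def)
        finally show "(D / 2) * \<bar>y - z\<bar> \<le> 2 * \<delta>" .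
      qed (use D \<delta> in auto)
      hence "diameter (U i v) \<le> 4 * \<delta> * (1 / D)" using D by (simp add: field_simps)
      hence "diameter (U i v) powr s \<le> (4 * \<delta> * (1 / D)) powr s"
        using s diameter_ge_0[OF bU] by (intro powr_mono2) auto
      also have "\<dots> = 4 powr s * \<delta> powr s * (1 / D) powr s" by (simp only: powr_mult)
      also have "\<dots> \<le> 4 * \<delta> powr s * (3 * A * Q powr (1 - s) * (1 / D))"
      proof (intro mult_mono)
        show "4 powr s \<le> 4" using s powr_mono[of s 1 4] by simp
        have "D powr (1 - s) \<le> (3 * A * Q) powr (1 - s)"
          unfolding D_def using F'_bound(1)[OF xJ[OF i] \<kappa> h Q] s by (intro powr_mono2) auto
        also have "\<dots> = (3 * A) powr (1 - s) * Q powr (1 - s)" by (rule powr_mult)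
        also have "\<dots> \<le> 3 * A * Q powr (1 - s)"
          using A s powr_mono[of "1 - s" 1 "3 * A"] by (intro mult_right_mono) auto
        finally have "D powr (1 - s) * (1 / D) \<le> 3 * A * Q powr (1 - s) * (1 / D)" using D by (intro mult_right_mono) auto
        moreover have "D powr (1 - s) * (1 / D) = (1 / D) powr s" using D by (simp add: powr_diff powr_divide)
        ultimately show "(1 / D) powr s \<le> 3 * A * Q powr (1 - s) * (1 / D)" by simp
      qed auto
      finally have "diameter (U i v) powr s \<le> 4 * \<delta> powr s * (3 * A * Q powr (1 - s)) * (1 / \<bar>F' \<kappa> v (x i)\<bar>)"
        by (simp only: D_def mult.assoc)
      thus ?thesis using hcontent_le_diameter[OF bU, of s] by (meson ennreal_leI order_trans)
    qed
    have sumR: "(\<Sum>v\<in>R i. 1 / \<bar>F' \<kappa> v (x i)\<bar>) \<le> 5 * (3 * Q * (C3 * (1 + ln Q)))" if i: "i < n" for i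
    proof -
      define G where "G a b = of_int a * f1' (x i) + (of_int b * f2' (x i) + \<kappa> * l' (x i))" for a b :: int
      have F'G: "F' \<kappa> (a, b, p) (x i) = G a b" for a b p by (simp add: F'_def G_def)
      define Z where "Z = {a::int. \<bar>of_int a - 0\<bar> \<le> Q}"
      have Z: "finite Z" "real (card Z) \<le> 3 * Q" using ints_near[of Q 0] Q by (auto simp: Z_def)
      define AB where "AB = {(a, b). a \<in> Z \<and> b \<in> Z \<and> 3/4 \<le> \<bar>G a b\<bar>}"
      have AB: "finite AB" by (rule finite_subset[OF _ finite_cartesian_product[OF Z(1) Z(1)]]) (auto simp: AB_def)
      define \<pi> :: "ivec \<Rightarrow> int \<times> int" where "\<pi> = (\<lambda>(a, b, p). (a, b))"
      have \<pi>: "\<pi> ` R i \<subseteq> AB"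
        by (auto simp: \<pi>_def R_def AB_def F'G Z_def height_def)
      \<comment> \<open>For fixed a and b, the form is within \<delta> <= 1 of 0 somewhere on the
        piece and varies by at most 1 there, so p lies within 2 of a fixed real number.\<close>
      have fib: "real (card {v\<in>R i. \<pi> v = z}) \<le> 5" for z
      proof -
        obtain a b where z: "z = (a, b)" by (cases z)
        define r where "r = - (of_int a * f1 (x i) + of_int b * f2 (x i) + \<kappa> * l (x i))"
        have "{v\<in>R i. \<pi> v = z} \<subseteq> (\<lambda>p. (a, b, p)) ` {p::int. \<bar>of_int p - r\<bar> \<le> 2}"
        proof
          fix v assume v: "v \<in> {v\<in>R i. \<pi> v = z}"
          obtain p where vp: "v = (a, b, p)" using v by (cases v) (auto simp: \<pi>_def z)
          obtain y where y: "y \<in> P i" "\<bar>F \<kappa> v y\<bar> \<le> \<delta>" and h: "height v \<le> Q" using v by (auto simp: R_def U_def)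
          have "\<bar>F \<kappa> v (x i)\<bar> \<le> 2" using near(2)[OF h i y(1)] y(2) \<delta> by linarith
          hence "\<bar>of_int p - r\<bar> \<le> 2" by (simp add: F_def vp r_def algebra_simps)
          thus "v \<in> (\<lambda>p. (a, b, p)) ` {p::int. \<bar>of_int p - r\<bar> \<le> 2}" using vp by blast
        qed
        hence "card {v\<in>R i. \<pi> v = z} \<le> card ((\<lambda>p. (a, b, p)) ` {p::int. \<bar>of_int p - r\<bar> \<le> 2})"
          using ints_near(1)[of 2 r] by (intro card_mono) auto
        also have "\<dots> \<le> card {p::int. \<bar>of_int p - r\<bar> \<le> 2}" using ints_near(1)[of 2 r] by (intro card_image_le) auto
        finally show ?thesis using ints_near(2)[of 2 r] by linarith
      qed
      have "(\<Sum>v\<in>R i. 1 / \<bar>F' \<kappa> v (x i)\<bar>) = (\<Sum>z\<in>AB. \<Sum>v\<in>{v\<in>R i. \<pi> v = z}. 1 / \<bar>F' \<kappa> v (x i)\<bar>)"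
        using finR AB \<pi> by (rule sum.group[symmetric])
      also have "\<dots> = (\<Sum>z\<in>AB. real (card {v\<in>R i. \<pi> v = z}) * (1 / \<bar>G (fst z) (snd z)\<bar>))"
      proof (rule sum.cong[OF refl])
        fix z assume "z \<in> AB"
        have "(\<Sum>v\<in>{v\<in>R i. \<pi> v = z}. 1 / \<bar>F' \<kappa> v (x i)\<bar>) = (\<Sum>v\<in>{v\<in>R i. \<pi> v = z}. 1 / \<bar>G (fst z) (snd z)\<bar>)"
          by (intro sum.cong) (auto simp: \<pi>_def F'G)
        thus "(\<Sum>v\<in>{v\<in>R i. \<pi> v = z}. 1 / \<bar>F' \<kappa> v (x i)\<bar>) = real (card {v\<in>R i. \<pi> v = z}) * (1 / \<bar>G (fst z) (snd z)\<bar>)"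
          by simp
      qed
      also have "\<dots> \<le> (\<Sum>z\<in>AB. 5 * (1 / \<bar>G (fst z) (snd z)\<bar>))"
        by (intro sum_mono mult_right_mono fib) auto
      also have "\<dots> = 5 * (\<Sum>z\<in>AB. 1 / \<bar>G (fst z) (snd z)\<bar>)" by (simp add: sum_distrib_left)
      also have "(\<Sum>z\<in>AB. 1 / \<bar>G (fst z) (snd z)\<bar>) = (\<Sum>b\<in>Z. \<Sum>z\<in>{z\<in>AB. snd z = b}. 1 / \<bar>G (fst z) (snd z)\<bar>)"
        using AB Z by (intro sum.group[symmetric]) (auto simp: AB_def)
      also have "\<dots> \<le> (\<Sum>b\<in>Z. C3 * (1 + ln Q))"
      proof (rule sum_mono)
        fix b assume b: "b \<in> Z"
        define S where "S = {a\<in>Z. 3/4 \<le> \<bar>G a b\<bar>}"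
        have "(\<Sum>z\<in>{z\<in>AB. snd z = b}. 1 / \<bar>G (fst z) (snd z)\<bar>) = (\<Sum>a\<in>S. 1 / \<bar>G a b\<bar>)"
          by (rule sum.reindex_bij_witness[of _ "\<lambda>a. (a, b)" fst]) (auto simp: AB_def S_def b)
        also have "\<dots> \<le> 4 / c * (1 + ln (2 * (3 * A * Q) / c))"
          unfolding G_def
        proof (rule sum_inverse_affine_le[OF c f1'_ge[OF xJ[OF i]]])
          show "1 \<le> 3 * A * Q" using AQ by simp
          show "finite S" using Z by (simp add: S_def)
          fix a assume "a \<in> S"
          hence "height (a, b, 0) \<le> Q" "3/4 \<le> \<bar>G a b\<bar>" using b by (auto simp: S_def Z_def height_def)
          thus "3/4 \<le> \<bar>of_int a * f1' (x i) + (of_int b * f2' (x i) + \<kappa> * l' (x i))\<bar> \<and>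
            \<bar>of_int a * f1' (x i) + (of_int b * f2' (x i) + \<kappa> * l' (x i))\<bar> \<le> 3 * A * Q"
            using F'_bound(1)[OF xJ[OF i] \<kappa> _ Q, of "(a, b, 0)"] by (simp add: F'G G_def)
        qed
        also have "\<dots> = 4 / c * (1 + (ln (6 * A / c) + ln Q))"
        proof -
          have "2 * (3 * A * Q) / c = (6 * A / c) * Q" by simp
          moreover have "ln ((6 * A / c) * Q) = ln (6 * A / c) + ln Q" using Ac Q by (intro ln_mult_pos) linarith+
          ultimately show ?thesis by (simp only:)
        qed
        also have "\<dots> \<le> 4 / c * ((1 + ln (6 * A / c)) * (1 + ln Q))"
        proof (intro mult_left_mono)
          have "0 \<le> ln (6 * A / c) * ln Q" using lnQ Ac by (intro mult_nonneg_nonneg) auto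
          thus "1 + (ln (6 * A / c) + ln Q) \<le> (1 + ln (6 * A / c)) * (1 + ln Q)" by (simp add: algebra_simps)
        qed (use c in auto)
        finally show "(\<Sum>z\<in>{z\<in>AB. snd z = b}. 1 / \<bar>G (fst z) (snd z)\<bar>) \<le> C3 * (1 + ln Q)" by (simp add: C3_def mult_ac)
      qed
      also have "\<dots> = real (card Z) * (C3 * (1 + ln Q))" by simp
      also have "\<dots> \<le> 3 * Q * (C3 * (1 + ln Q))" using Z(2) C3 lnQ by (intro mult_right_mono) auto
      finally show ?thesis by simp
    qed
    define W where "W = 4 * \<delta> powr s * (3 * A * Q powr (1 - s))"
    have W: "0 \<le> W" using A by (simp add: W_def)
    have "{x\<in>{\<alpha>..\<beta>}. \<exists>v. height v \<le> Q \<and> \<bar>F \<kappa> v x\<bar> \<le> \<delta> \<and> 1 \<le> \<bar>F' \<kappa> v x\<bar>} \<subseteq> (\<Union>i\<in>{..<n}. \<Union>v\<in>R i. U i v)"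
    proof
      fix y assume "y \<in> {x\<in>{\<alpha>..\<beta>}. \<exists>v. height v \<le> Q \<and> \<bar>F \<kappa> v x\<bar> \<le> \<delta> \<and> 1 \<le> \<bar>F' \<kappa> v x\<bar>}"
      then obtain v where y: "y \<in> {\<alpha>..\<beta>}" and v: "height v \<le> Q" "\<bar>F \<kappa> v y\<bar> \<le> \<delta>" "1 \<le> \<bar>F' \<kappa> v y\<bar>" by blast
      have "\<exists>i<n. y \<in> P i"
      proof (cases "y = \<beta>")
        case True
        have "real (n - 1) * \<eta> + \<eta> = \<beta> - \<alpha>"
        proof -
          have "real (n - 1) * \<eta> + \<eta> = (real (n - 1) + 1) * \<eta>" by (simp add: algebra_simps)
          also have "real (n - 1) + 1 = real n" using n0 by simp
          finally show ?thesis using n0 by (simp add: \<eta>_def)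
        qed
        hence "y \<in> P (n - 1)" using True \<eta> ab by (simp add: P_def x_def)
        thus ?thesis using n0 by (intro exI[of _ "n - 1"]) auto
      next
        case False
        define i where "i = nat \<lfloor>(y - \<alpha>) / \<eta>\<rfloor>"
        have 0: "0 \<le> (y - \<alpha>) / \<eta>" using y \<eta> by auto
        have "y - \<alpha> < \<beta> - \<alpha>" using y False by auto
        also have "\<dots> = real n * \<eta>" using n0 by (simp add: \<eta>_def)
        finally have 1: "(y - \<alpha>) / \<eta> < real n" using \<eta> by (simp add: pos_divide_less_eq)
        have i: "real i \<le> (y - \<alpha>) / \<eta>" "(y - \<alpha>) / \<eta> < real i + 1" using 0 unfolding i_def by linarith+
        hence "i < n" using 1 by linarith
        moreover have "real i * \<eta> \<le> y - \<alpha>" "y - \<alpha> \<le> (real i + 1) * \<eta>"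
          using i \<eta> by (auto simp: pos_le_divide_eq pos_divide_less_eq)
        hence "y \<in> P i" using y by (simp add: P_def x_def algebra_simps)
        ultimately show ?thesis by blast
      qed
      then obtain i where i: "i < n" "y \<in> P i" by blast
      have "3/4 \<le> \<bar>F' \<kappa> v (x i)\<bar>" using near(1)[OF v(1) i] v(3) by linarith
      moreover have yU: "y \<in> U i v" using i v by (simp add: U_def)
      ultimately have "v \<in> R i" using v(1) by (auto simp: R_def)
      thus "y \<in> (\<Union>i\<in>{..<n}. \<Union>v\<in>R i. U i v)" using yU i(1) by blast
    qed
    hence "hcontent s {x\<in>{\<alpha>..\<beta>}. \<exists>v. height v \<le> Q \<and> \<bar>F \<kappa> v x\<bar> \<le> \<delta> \<and> 1 \<le> \<bar>F' \<kappa> v x\<bar>}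
       \<le> hcontent s (\<Union>i\<in>{..<n}. \<Union>v\<in>R i. U i v)" by (rule hcontent_mono)
    also have "\<dots> \<le> (\<Sum>i\<in>{..<n}. hcontent s (\<Union>v\<in>R i. U i v))" by (rule hcontent_UN_finite) simp
    also have "\<dots> \<le> (\<Sum>i\<in>{..<n}. ennreal (W * (5 * (3 * Q * (C3 * (1 + ln Q))))))"
    proof (rule sum_mono)
      fix i assume "i \<in> {..<n}"
      hence i: "i < n" by simp
      have "hcontent s (\<Union>v\<in>R i. U i v) \<le> (\<Sum>v\<in>R i. hcontent s (U i v))" by (rule hcontent_UN_finite[OF finR])
      also have "\<dots> \<le> (\<Sum>v\<in>R i. ennreal (W * (1 / \<bar>F' \<kappa> v (x i)\<bar>)))" unfolding W_def by (intro sum_mono diamU i)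
      also have "\<dots> = ennreal (W * (\<Sum>v\<in>R i. 1 / \<bar>F' \<kappa> v (x i)\<bar>))"
        using W by (subst sum_ennreal) (auto simp: sum_distrib_left)
      also have "\<dots> \<le> ennreal (W * (5 * (3 * Q * (C3 * (1 + ln Q)))))"
        using sumR[OF i] W by (intro ennreal_leI mult_left_mono)
      finally show "hcontent s (\<Union>v\<in>R i. U i v) \<le> ennreal (W * (5 * (3 * Q * (C3 * (1 + ln Q)))))" .
    qed
    also have "\<dots> = ennreal (real n * (W * (5 * (3 * Q * (C3 * (1 + ln Q))))))"
      using W C3 Q lnQ by (simp add: ennreal_mult ennreal_of_nat_eq_real_of_nat)
    also have "\<dots> \<le> ennreal (13 * A * Q * (W * (5 * (3 * Q * (C3 * (1 + ln Q))))))"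
      using n W C3 Q lnQ by (intro ennreal_leI mult_right_mono) auto
    also have "13 * A * Q * (W * (5 * (3 * Q * (C3 * (1 + ln Q))))) =
        13 * A * (12 * A * (5 * (3 * C3))) * \<delta> powr s * (Q * Q * Q powr (1 - s)) * (1 + ln Q)"
      by (simp add: W_def)
    also have "Q * Q * Q powr (1 - s) = Q powr (3 - s)"
    proof -
      have "Q powr (3 - s) = Q powr (2 + (1 - s))" by simp
      also have "\<dots> = Q powr 2 * Q powr (1 - s)" by (rule powr_add)
      also have "Q powr 2 = Q * Q" using Q by (simp add: powr_numeral power2_eq_square)
      finally show ?thesis by simp
    qed
    finally show "hcontent s {x\<in>{\<alpha>..\<beta>}. \<exists>v. height v \<le> Q \<and> \<bar>F \<kappa> v x\<bar> \<le> \<delta> \<and> 1 \<le> \<bar>F' \<kappa> v x\<bar>}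
      \<le> ennreal (C * \<delta> powr s * Q powr (3 - s) * (1 + ln Q))" by (simp add: C_def)
  qed
qed

end

section \<open>The upper bound along an arc\<close>

lemma infdist_Ints_less_iff: "infdist y \<int> < r \<longleftrightarrow> (\<exists>p::int. \<bar>y + of_int p\<bar> < r)" for y r :: real
proof
  assume "infdist y \<int> < r"
  hence "(INF a\<in>\<int>. dist y a) < r" by (auto simp: infdist_def Ints_def split: if_splits)
  then obtain a where a: "a \<in> \<int>" "dist y a < r"
    by (subst (asm) cINF_less_iff) (auto intro!: bdd_belowI[of _ 0] simp: Ints_def)
  then obtain k :: int where "a = of_int k" by (auto elim: Ints_cases)
  thus "\<exists>p::int. \<bar>y + of_int p\<bar> < r" using a by (intro exI[of _ "- k"]) (simp add: dist_real_def)
next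
  assume "\<exists>p::int. \<bar>y + of_int p\<bar> < r"
  then obtain p :: int where p: "\<bar>y + of_int p\<bar> < r" by blast
  have "infdist y \<int> \<le> dist y (of_int (- p))" by (rule infdist_le) simp
  thus "infdist y \<int> < r" using p by (simp add: dist_real_def)
qed

lemma summable_linear_geometric:
  fixes x C :: real
  assumes "0 \<le> x" "x < 1"
  shows "summable (\<lambda>n. C * (real n + 3) * x ^ n)"
proof -
  have "summable (\<lambda>n. of_nat (Suc n) * x ^ n)" using geometric_deriv_sums[of x] assms by (simp add: sums_iff)
  moreover have "summable (\<lambda>n. 2 * x ^ n)" using assms by (intro summable_mult summable_geometric) auto
  ultimately have "summable (\<lambda>n. of_nat (Suc n) * x ^ n + 2 * x ^ n)" by (rule summable_add)
  hence "summable (\<lambda>n. C * (of_nat (Suc n) * x ^ n + 2 * x ^ n))" by (rule summable_mult)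
  thus ?thesis by (simp add: algebra_simps)
qed

context arc
begin

text \<open>With \<delta> = q powr -\<tau> the three terms have the exponents 2 - s * \<tau>, (3 - s
  * (\<tau> + 1)) / 2 and 3 - s * (\<tau> + 1). All are at most -\<eta>, the first because s <= 1;
  the tangential term equals q powr -\<eta> and determines the choice of \<eta>.\<close>

lemma level_content_summable:
  assumes s: "0 < s" "s \<le> 1" and \<tau>: "2 < \<tau>" and s\<tau>: "3 < s * (\<tau> + 1)"
  obtains C \<rho> t1 where "0 \<le> C" "0 \<le> \<rho>" "\<rho> < 1"
    "\<And>t. t1 \<le> t \<Longrightarrow> hcontent s {x\<in>{\<alpha>..\<beta>}. \<exists>v. 2 ^ t \<le> height v \<and> height v < 2 * 2 ^ t \<and> \<bar>F 1 v x\<bar> \<le> (2 ^ t) powr - \<tau>}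
      \<le> ennreal (C * (real t + 3) * \<rho> ^ t)"
proof -
  obtain C1 t0 where C1: "0 \<le> C1" "\<And>s t \<delta>. 0 < s \<Longrightarrow> s \<le> 1 \<Longrightarrow> t0 \<le> t \<Longrightarrow> 0 < \<delta> \<Longrightarrow> \<delta> \<le> 1 / (2 * 4 ^ t) \<Longrightarrow>
    hcontent s {x\<in>{\<alpha>..\<beta>}. \<exists>v. 2 ^ t \<le> height v \<and> height v < 2 * 2 ^ t \<and> \<bar>F 1 v x\<bar> \<le> \<delta> \<and> \<bar>F' 1 v x\<bar> \<le> 1}
      \<le> ennreal (C1 * (real t + 3) * (\<delta> powr s * 4 ^ t + (\<delta> / 2 ^ t) powr (s / 2) * (2 ^ t) powr (3 / 2)))"
    using small_derivative_content by blast
  obtain C2 where C2: "0 \<le> C2" "\<And>\<kappa> s Q \<delta>. \<bar>\<kappa>\<bar> \<le> 1 \<Longrightarrow> 0 < s \<Longrightarrow> s \<le> 1 \<Longrightarrow> 1 \<le> Q \<Longrightarrow> 0 < \<delta> \<Longrightarrow> \<delta> \<le> 1 \<Longrightarrow>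
    hcontent s {x\<in>{\<alpha>..\<beta>}. \<exists>v. height v \<le> Q \<and> \<bar>F \<kappa> v x\<bar> \<le> \<delta> \<and> 1 \<le> \<bar>F' \<kappa> v x\<bar>}
      \<le> ennreal (C2 * \<delta> powr s * Q powr (3 - s) * (1 + ln Q))"
    using large_derivative_content by blast
  define \<eta> where "\<eta> = (s * (\<tau> + 1) - 3) / 2"
  have \<eta>: "0 < \<eta>" using s\<tau> by (simp add: \<eta>_def)
  have s\<tau>': "s * \<tau> = 3 + 2 * \<eta> - s" by (simp add: \<eta>_def field_simps)
  define \<rho> where "\<rho> = (2::real) powr - \<eta>"
  have \<rho>: "0 \<le> \<rho>" "\<rho> < 1" using \<eta> powr_less_mono[of "-\<eta>" 0 2] by (auto simp: \<rho>_def)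
  \<comment> \<open>Since \<tau> > 2, from this level on q powr -\<tau> is at most 1 / (2 * q^2), as
    the small-derivative estimate demands.\<close>
  define t1 where "t1 = max t0 (nat \<lceil>1 / (\<tau> - 2)\<rceil>)"
  show ?thesis
  proof (rule that[of "2 * C1 + 8 * C2" \<rho> t1])
    fix t assume t: "t1 \<le> t"
    define q where "q = (2::real) ^ t"
    have q1: "1 \<le> q" by (simp add: q_def)
    have qp: "q = 2 powr real t" by (simp add: q_def powr_realpow)
    have \<rho>t: "q powr - \<eta> = \<rho> ^ t" by (simp add: qp \<rho>_def powr_powr powr_realpow[symmetric] mult.commute)
    define \<delta> where "\<delta> = q powr - \<tau>"
    have \<delta>: "0 < \<delta>" "\<delta> \<le> 1" using q1 \<tau> powr_mono[of "-\<tau>" 0 q] by (auto simp: \<delta>_def)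
    have \<delta>2: "\<delta> \<le> 1 / (2 * 4 ^ t)"
    proof -
      have "1 / (\<tau> - 2) \<le> real (nat \<lceil>1 / (\<tau> - 2)\<rceil>)" by linarith
      also have "\<dots> \<le> real t" using t by (simp add: t1_def)
      finally have "1 \<le> real t * (\<tau> - 2)" using \<tau> by (simp add: field_simps)
      hence "2 powr (real t * - \<tau>) \<le> 2 powr (- 1 - 2 * real t)" by (intro powr_mono) (auto simp: algebra_simps)
      also have "\<dots> = 2 powr - 1 / 2 powr (2 * real t)" by (rule powr_diff)
      also have "2 powr (2 * real t) = (4::real) ^ t"
      proof -
        have "2 powr (2 * real t) = (2 powr 2) powr real t" by (simp only: powr_powr)
        also have "\<dots> = (4::real) powr real t" by simp
        finally show ?thesis by (simp add: powr_realpow)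
      qed
      finally show ?thesis by (simp add: \<delta>_def qp powr_powr powr_minus_divide)
    qed
    have q2: "4 ^ t = q powr 2" using q1 by (simp add: q_def powr_numeral power_mult_distrib[symmetric] power2_eq_square)
    have e1: "\<delta> powr s * 4 ^ t \<le> \<rho> ^ t"
    proof -
      have "\<delta> powr s * 4 ^ t = q powr (- \<tau> * s + 2)" by (simp only: q2 \<delta>_def powr_powr powr_add)
      also have "\<dots> \<le> q powr - \<eta>" using s\<tau>' s \<eta> by (intro powr_mono q1) (simp add: mult.commute)
      finally show ?thesis by (simp add: \<rho>t)
    qed
    have e2: "(\<delta> / q) powr (s / 2) * q powr (3 / 2) \<le> \<rho> ^ t"
    proof -
      have "\<delta> / q = q powr (- \<tau> - 1)" using q1 by (simp add: \<delta>_def powr_diff)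
      hence "(\<delta> / q) powr (s / 2) * q powr (3 / 2) = q powr ((- \<tau> - 1) * (s / 2) + 3 / 2)"
        by (simp only: powr_powr powr_add)
      also have "(- \<tau> - 1) * (s / 2) + 3 / 2 = - \<eta>" by (simp add: \<eta>_def field_simps)
      finally show ?thesis by (simp add: \<rho>t)
    qed
    have e3: "\<delta> powr s * (2 * q) powr (3 - s) * (1 + ln (2 * q)) \<le> 8 * (real t + 3) * \<rho> ^ t"
    proof -
      have "\<delta> powr s * (2 * q) powr (3 - s) = 2 powr (3 - s) * q powr (- \<tau> * s + (3 - s))"
        by (simp only: \<delta>_def powr_powr powr_mult powr_add mult_ac)
      also have "\<dots> \<le> 8 * q powr - \<eta>"
      proof (intro mult_mono powr_mono q1)
        show "2 powr (3 - s) \<le> 8" using s powr_mono[of "3 - s" 3 2] by (simp add: powr_numeral)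
        show "- \<tau> * s + (3 - s) \<le> - \<eta>" using s\<tau>' \<eta> by (simp add: mult.commute)
      qed auto
      finally have 1: "\<delta> powr s * (2 * q) powr (3 - s) \<le> 8 * \<rho> ^ t" by (simp add: \<rho>t)
      have "ln (2 * q) = (real t + 1) * ln 2" using q1 by (simp add: ln_mult_pos q_def ln_realpow algebra_simps)
      also have "\<dots> \<le> (real t + 1) * 1" using ln2_le_25_over_36 by (intro mult_left_mono) auto
      finally have "1 + ln (2 * q) \<le> real t + 3" by simp
      hence "\<delta> powr s * (2 * q) powr (3 - s) * (1 + ln (2 * q)) \<le> (8 * \<rho> ^ t) * (real t + 3)"
        by (rule mult_mono[OF 1]) (use q1 \<rho> in auto)
      thus ?thesis by (simp add: mult_ac)
    qed
    define WS where "WS = {x\<in>{\<alpha>..\<beta>}. \<exists>v. 2 ^ t \<le> height v \<and> height v < 2 * 2 ^ t \<and> \<bar>F 1 v x\<bar> \<le> \<delta> \<and> \<bar>F' 1 v x\<bar> \<le> 1}"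
    define WL where "WL = {x\<in>{\<alpha>..\<beta>}. \<exists>v. height v \<le> 2 * q \<and> \<bar>F 1 v x\<bar> \<le> \<delta> \<and> 1 \<le> \<bar>F' 1 v x\<bar>}"
    have "{x\<in>{\<alpha>..\<beta>}. \<exists>v. 2 ^ t \<le> height v \<and> height v < 2 * 2 ^ t \<and> \<bar>F 1 v x\<bar> \<le> \<delta>} \<subseteq> WS \<union> WL"
    proof
      fix x assume "x \<in> {x\<in>{\<alpha>..\<beta>}. \<exists>v. 2 ^ t \<le> height v \<and> height v < 2 * 2 ^ t \<and> \<bar>F 1 v x\<bar> \<le> \<delta>}"
      then obtain v where x: "x \<in> {\<alpha>..\<beta>}" and v: "2 ^ t \<le> height v" "height v < 2 * 2 ^ t" "\<bar>F 1 v x\<bar> \<le> \<delta>" by blast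
      show "x \<in> WS \<union> WL"
      proof (cases "\<bar>F' 1 v x\<bar> \<le> 1")
        case True
        hence "x \<in> WS" using x v unfolding WS_def by blast
        thus ?thesis ..
      next
        case False
        hence "height v \<le> 2 * q" "1 \<le> \<bar>F' 1 v x\<bar>" using v by (auto simp: q_def)
        hence "x \<in> WL" using x v unfolding WL_def by blast
        thus ?thesis ..
      qed
    qed
    hence "hcontent s {x\<in>{\<alpha>..\<beta>}. \<exists>v. 2 ^ t \<le> height v \<and> height v < 2 * 2 ^ t \<and> \<bar>F 1 v x\<bar> \<le> \<delta>} \<le> hcontent s WS + hcontent s WL"
      by (rule order_trans[OF hcontent_mono hcontent_Un])
    also have "\<dots> \<le> ennreal (C1 * (real t + 3) * (\<delta> powr s * 4 ^ t + (\<delta> / 2 ^ t) powr (s / 2) * (2 ^ t) powr (3 / 2)))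
        + ennreal (C2 * \<delta> powr s * (2 * q) powr (3 - s) * (1 + ln (2 * q)))"
    proof (intro add_mono)
      show "hcontent s WS \<le> ennreal (C1 * (real t + 3) * (\<delta> powr s * 4 ^ t + (\<delta> / 2 ^ t) powr (s / 2) * (2 ^ t) powr (3 / 2)))"
        unfolding WS_def by (rule C1(2)[OF s _ \<delta>(1) \<delta>2]) (use t in \<open>simp add: t1_def\<close>)
      show "hcontent s WL \<le> ennreal (C2 * \<delta> powr s * (2 * q) powr (3 - s) * (1 + ln (2 * q)))"
        unfolding WL_def by (rule C2(2)[OF _ s _ \<delta>]) (use q1 in auto)
    qed
    also have "\<dots> \<le> ennreal (C1 * (real t + 3) * (2 * \<rho> ^ t)) + ennreal (C2 * (8 * (real t + 3) * \<rho> ^ t))"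
    proof (intro add_mono ennreal_leI)
      show "C1 * (real t + 3) * (\<delta> powr s * 4 ^ t + (\<delta> / 2 ^ t) powr (s / 2) * (2 ^ t) powr (3 / 2)) \<le> C1 * (real t + 3) * (2 * \<rho> ^ t)"
        using e1 e2 C1(1) unfolding q_def by (intro mult_left_mono) auto
      show "C2 * \<delta> powr s * (2 * q) powr (3 - s) * (1 + ln (2 * q)) \<le> C2 * (8 * (real t + 3) * \<rho> ^ t)"
        using mult_left_mono[OF e3 C2(1)] by (simp only: mult.assoc)
    qed
    also have "\<dots> = ennreal (C1 * (real t + 3) * (2 * \<rho> ^ t) + C2 * (8 * (real t + 3) * \<rho> ^ t))"
      using C1(1) C2(1) \<rho> by (intro ennreal_plus[symmetric]) auto
    also have "C1 * (real t + 3) * (2 * \<rho> ^ t) + C2 * (8 * (real t + 3) * \<rho> ^ t) = (2 * C1 + 8 * C2) * (real t + 3) * \<rho> ^ t"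
      by (simp add: algebra_simps)
    finally show "hcontent s {x\<in>{\<alpha>..\<beta>}. \<exists>v. 2 ^ t \<le> height v \<and> height v < 2 * 2 ^ t \<and> \<bar>F 1 v x\<bar> \<le> (2 ^ t) powr - \<tau>}
      \<le> ennreal ((2 * C1 + 8 * C2) * (real t + 3) * \<rho> ^ t)" by (simp only: \<delta>_def q_def)
  qed (use C1 C2 \<rho> in auto)
qed

lemma hcontent_A2_null:
  assumes s: "0 < s" "s \<le> 1" and \<tau>: "2 < \<tau>" and s\<tau>: "3 < s * (\<tau> + 1)"
    and \<psi>: "eventually (\<lambda>q. \<psi> q \<le> q powr - \<tau>) at_top"
  shows "hcontent s (A2 {\<alpha>..\<beta>} f1 f2 \<psi> l) = 0"
proof -
  define W where "W t = {x\<in>{\<alpha>..\<beta>}. \<exists>v. 2 ^ t \<le> height v \<and> height v < 2 * 2 ^ t \<and> \<bar>F 1 v x\<bar> \<le> (2 ^ t) powr - \<tau>}" for t :: nat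
  obtain C \<rho> t1 where C: "0 \<le> C" "0 \<le> \<rho>" "\<rho> < 1" "\<And>t. t1 \<le> t \<Longrightarrow> hcontent s (W t) \<le> ennreal (C * (real t + 3) * \<rho> ^ t)"
    using level_content_summable[OF s \<tau> s\<tau>] unfolding W_def by blast
  have null: "hcontent s {x. infinite {n. x \<in> W (n + t1)}} = 0"
  proof (rule hcontent_limsup_null)
    show "hcontent s (W (n + t1)) \<le> ennreal (C * (real (n + t1) + 3) * \<rho> ^ (n + t1))" for n by (rule C(4)) simp
    have "summable (\<lambda>n. C * (real n + 3) * \<rho> ^ n)" by (rule summable_linear_geometric[OF C(2,3)])
    thus "summable (\<lambda>n. C * (real (n + t1) + 3) * \<rho> ^ (n + t1))" by (rule summable_ignore_initial_segment)
  qed (use C in auto)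
  obtain q0 where q0: "\<And>q. q0 \<le> q \<Longrightarrow> \<psi> q \<le> q powr - \<tau>" using \<psi> by (auto simp: eventually_at_top_linorder)
  have "A2 {\<alpha>..\<beta>} f1 f2 \<psi> l \<subseteq> {x. infinite {n. x \<in> W (n + t1)}}"
  proof
    fix x assume xA: "x \<in> A2 {\<alpha>..\<beta>} f1 f2 \<psi> l"
    define S where "S = {a :: int \<times> int. a \<noteq> (0, 0) \<and>
       infdist (of_int (fst a) * f1 x + of_int (snd a) * f2 x + l x) \<int> < \<psi> (of_int (max \<bar>fst a\<bar> \<bar>snd a\<bar>))}"
    have x: "x \<in> {\<alpha>..\<beta>}" and S: "infinite S" using xA by (auto simp: A2_def S_def)
    have "\<exists>n\<ge>m. x \<in> W (n + t1)" for m
    proof -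
      \<comment> \<open>A box contains only finitely many pairs, so some solution lies outside it;
        its height exceeds both q0 and the required dyadic level.\<close>
      define B where "B = \<lceil>max q0 (2 ^ (m + t1))\<rceil>"
      have "finite ({-B..B} \<times> {-B..B})" by simp
      hence "\<not> S \<subseteq> {-B..B} \<times> {-B..B}" using S finite_subset by blast
      then obtain z where "z \<in> S" "z \<notin> {-B..B} \<times> {-B..B}" by blast
      then obtain a b where ab: "(a, b) \<in> S" "(a, b) \<notin> {-B..B} \<times> {-B..B}" by (cases z) simp
      hence "B < max \<bar>a\<bar> \<bar>b\<bar>" by auto
      define h where "h = real_of_int (max \<bar>a\<bar> \<bar>b\<bar>)"
      have h: "q0 \<le> h" "2 ^ (m + t1) \<le> h" using \<open>B < max \<bar>a\<bar> \<bar>b\<bar>\<close> unfolding B_def h_def by linarith+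
      have h1: "1 \<le> h" using h(2) one_le_power[of "2::real" "m + t1"] by linarith
      have "infdist (of_int a * f1 x + of_int b * f2 x + l x) \<int> < \<psi> h" using ab(1) by (simp add: S_def h_def)
      then obtain p :: int where p: "\<bar>of_int a * f1 x + of_int b * f2 x + l x + of_int p\<bar> < \<psi> h"
        by (auto simp: infdist_Ints_less_iff)
      define v where "v = (a, b, p)"
      have hv: "height v = h" by (simp add: v_def height_def h_def)
      obtain t where t: "2 ^ t \<le> h" "h < 2 * 2 ^ t" using dyadic_level[OF h1] .
      have "\<bar>F 1 v x\<bar> \<le> \<psi> h" using p by (simp add: F_def v_def algebra_simps)
      also have "\<dots> \<le> h powr - \<tau>" by (rule q0[OF h(1)])
      also have "\<dots> \<le> (2 ^ t) powr - \<tau>" using t \<tau> by (intro powr_mono2') auto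
      finally have "x \<in> W t" using x t unfolding W_def hv[symmetric] by blast
      moreover have "(2::real) ^ (m + t1) < 2 ^ Suc t" using h t by simp
      hence "m + t1 < Suc t" by (rule power_less_imp_less_exp[rotated]) simp
      ultimately show ?thesis by (intro exI[of _ "t - t1"]) auto
    qed
    thus "x \<in> {x. infinite {n. x \<in> W (n + t1)}}" by (simp add: infinite_nat_iff_unbounded_le)
  qed
  from hcontent_mono[OF this, of s] show ?thesis unfolding null by simp
qed

end

section \<open>Inhomogeneous solutions at points without small homogeneous values\<close>

text \<open>One coordinate is controlled by the other two, so a grid in only two coordinates
  suffices; the mesh \<kappa> / 2 leaves room for the sum that bounds the third difference.\<close>

lemma grid_pigeonhole:
  fixes g1 g2 g3 :: "'v \<Rightarrow> real"
  assumes "finite S" and card: "(2 * K + 1)\<^sup>2 < card S" and \<kappa>: "0 < \<kappa>" "2 * r / \<kappa> \<le> real K"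
    and bounds: "\<And>v. v \<in> S \<Longrightarrow> \<bar>g1 v\<bar> \<le> r" "\<And>v. v \<in> S \<Longrightarrow> \<bar>g2 v\<bar> \<le> r"
    and dep: "\<And>v w. v \<in> S \<Longrightarrow> w \<in> S \<Longrightarrow> \<bar>g3 v - g3 w\<bar> \<le> \<bar>g1 v - g1 w\<bar> + \<bar>g2 v - g2 w\<bar>"
  obtains v w where "v \<in> S" "w \<in> S" "v \<noteq> w"
    "\<bar>g1 v - g1 w\<bar> \<le> \<kappa>" "\<bar>g2 v - g2 w\<bar> \<le> \<kappa>" "\<bar>g3 v - g3 w\<bar> \<le> \<kappa>"
proof -
  define cell where "cell y = \<lfloor>2 * y / \<kappa>\<rfloor>" for y :: real
  have cell_in: "cell y \<in> {- int K..int K}" if "\<bar>y\<bar> \<le> r" for y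
  proof -
    have "\<bar>2 * y / \<kappa>\<bar> \<le> real K"
    proof -
      have "\<bar>2 * y / \<kappa>\<bar> = 2 * \<bar>y\<bar> / \<kappa>" using \<kappa> by (simp add: abs_mult)
      also have "\<dots> \<le> 2 * r / \<kappa>" using that \<kappa> by (intro divide_right_mono) auto
      finally show ?thesis using \<kappa> by simp
    qed
    hence "- real K \<le> 2 * y / \<kappa>" "2 * y / \<kappa> \<le> real K" by linarith+
    thus ?thesis unfolding cell_def atLeastAtMost_iff by linarith
  qed
  have cell_eq: "\<bar>y - z\<bar> \<le> \<kappa> / 2" if "cell y = cell z" for y z
  proof -
    have "\<bar>2 * y / \<kappa> - 2 * z / \<kappa>\<bar> \<le> 1" using that unfolding cell_def by linarith
    hence "\<bar>2 * (y - z) / \<kappa>\<bar> \<le> 1" by (simp add: diff_divide_distrib right_diff_distrib)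
    hence "2 * \<bar>y - z\<bar> / \<kappa> \<le> 1" using \<kappa> by (simp only: abs_divide abs_mult abs_numeral abs_of_pos)
    thus ?thesis using \<kappa> by (simp add: pos_divide_le_eq)
  qed
  define \<phi> where "\<phi> v = (cell (g1 v), cell (g2 v))" for v
  have "\<not> inj_on \<phi> S"
  proof
    assume "inj_on \<phi> S"
    moreover have "\<phi> ` S \<subseteq> {- int K..int K} \<times> {- int K..int K}"
      using cell_in bounds by (auto simp: \<phi>_def simp del: atLeastAtMost_iff)
    ultimately have "card S \<le> card ({- int K..int K} \<times> {- int K..int K})"
      by (intro card_inj_on_le) auto
    also have "\<dots> = (2 * K + 1)\<^sup>2"
    proof -
      have "nat (int K - - int K + 1) = 2 * K + 1" by linarith
      thus ?thesis by (simp only: card_cartesian_product power2_eq_square card_atLeastAtMost_int)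
    qed
    finally show False using card by simp
  qed
  then obtain v w where vw: "v \<in> S" "w \<in> S" "v \<noteq> w" "\<phi> v = \<phi> w" by (auto simp: inj_on_def)
  have "\<bar>g1 v - g1 w\<bar> \<le> \<kappa> / 2" "\<bar>g2 v - g2 w\<bar> \<le> \<kappa> / 2" 
    using vw(4) cell_eq[of "g1 v" "g1 w"] cell_eq[of "g2 v" "g2 w"] unfolding \<phi>_def by blast+
  moreover from this have "\<bar>g3 v - g3 w\<bar> \<le> \<kappa>" using dep[OF vw(1,2)] by linarith
  ultimately show ?thesis using vw \<kappa> by (intro that[of v w]) auto
qed

lemma exists_large_fibre:
  assumes "finite S" "\<phi> ` S \<subseteq> T" "finite T" "n * card T < card S"
  obtains y where "n < card {x\<in>S. \<phi> x = y}"
proof (rule ccontr)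
  assume "\<not> thesis"
  hence "card S \<le> n * card (\<phi> ` S)" using that by (intro card_le_fibres assms) (meson not_le)
  also have "\<dots> \<le> n * card T" using assms by (intro mult_le_mono2 card_mono)
  finally show False using assms by simp
qed

text \<open>The equation of the plane is solved for the coordinate whose coefficient is
  largest.\<close>

lemma abs_coordinate_le:
  fixes N1 N2 N3 y1 y2 y3 :: real
  assumes "N1 * y1 + N2 * y2 + N3 * y3 = 0" "\<bar>N1\<bar> \<le> \<bar>N3\<bar>" "\<bar>N2\<bar> \<le> \<bar>N3\<bar>" "N3 \<noteq> 0"
  shows "\<bar>y3\<bar> \<le> \<bar>y1\<bar> + \<bar>y2\<bar>"
proof -
  have "\<bar>N3\<bar> * \<bar>y3\<bar> = \<bar>N1 * y1 + N2 * y2\<bar>" using assms(1) by (simp add: abs_mult[symmetric])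
  also have "\<dots> \<le> \<bar>N1\<bar> * \<bar>y1\<bar> + \<bar>N2\<bar> * \<bar>y2\<bar>" by (metis abs_mult abs_triangle_ineq)
  also have "\<dots> \<le> \<bar>N3\<bar> * \<bar>y1\<bar> + \<bar>N3\<bar> * \<bar>y2\<bar>" using assms by (intro add_mono mult_right_mono) auto
  also have "\<dots> = \<bar>N3\<bar> * (\<bar>y1\<bar> + \<bar>y2\<bar>)" by (simp add: distrib_left)
  finally show ?thesis using assms(4) by (simp add: mult_le_cancel_left)
qed

context arc
begin

text \<open>A linear map of determinant 1 that takes the box height <= q, |F| <= 1 / q^2 to the unit
  cube; its values on integer vectors form a unimodular lattice.\<close>

definition scaled :: "real \<Rightarrow> real \<Rightarrow> ivec \<Rightarrow> real \<times> real \<times> real" where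
  "scaled q x v = (case v of (a, b, p) \<Rightarrow> (of_int a / q, of_int b / q, q\<^sup>2 * F 0 v x))"

lemma scaled_diff: "scaled q x (v - w) = scaled q x v - scaled q x w"
  by (cases v; cases w) (simp add: scaled_def F_def diff_divide_distrib algebra_simps)

lemma scaled_smul: "scaled q x (smul k v) = of_int k *\<^sub>R scaled q x v"
  by (cases v) (simp add: scaled_def smul_def F_def algebra_simps)

lemma scaled_sum: "finite B \<Longrightarrow> scaled q x (\<Sum>b\<in>B. smul (k b) (v b)) = (\<Sum>b\<in>B. of_int (k b) *\<^sub>R scaled q x (v b))"
proof (induction rule: finite_induct)
  case empty
  show ?case by (simp add: scaled_def F_def zero_prod_def)
next
  case (insert b B)
  have add: "scaled q x (v + w) = scaled q x v + scaled q x w" for v w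
    by (cases v; cases w) (simp add: scaled_def F_def add_divide_distrib algebra_simps)
  show ?case using insert by (simp add: add scaled_smul)
qed

text \<open>Dirichlet's box argument with multiplicity: more than (r * q)^2 pairs are distributed
  over at most 2 * q^2 / r classes of fractional parts, so some class has more than n members.
  Subtracting one member from all of them gives the vectors.\<close>

lemma many_short_vectors:
  assumes q: "1 \<le> q" and r: "1 \<le> r" "r \<le> q\<^sup>2" and n: "2 * real n < r ^ 3"
  obtains S where "finite S" "n < card S"
    "\<And>v. v \<in> S \<Longrightarrow> height v \<le> r * q \<and> \<bar>q\<^sup>2 * F 0 v x\<bar> \<le> r"
proof -
  define m where "m = nat \<lfloor>r * q\<rfloor>"
  have rq: "1 \<le> r * q" using mult_mono[of 1 r 1 q] q r by simp
  have m: "real m \<le> r * q" "r * q < real m + 1" unfolding m_def using rq by linarith+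
  define k where "k = nat \<lceil>q\<^sup>2 / r\<rceil>"
  have qr: "1 \<le> q\<^sup>2 / r" using r by simp
  have k: "q\<^sup>2 / r \<le> real k" "real k \<le> 2 * (q\<^sup>2 / r)" unfolding k_def using qr by linarith+
  have k0: "0 < real k" using k qr by linarith
  define G where "G = {0..int m} \<times> {0..int m}"
  define f where "f a = of_int (fst a) * f1 x + of_int (snd a) * f2 x" for a :: "int \<times> int"
  define \<phi> where "\<phi> a = nat \<lfloor>real k * frac (f a)\<rfloor>" for a
  have \<phi>: "\<phi> ` G \<subseteq> {..<k}"
  proof (rule image_subsetI)
    fix a
    have "0 \<le> real k * frac (f a)" by simp
    moreover have "real k * frac (f a) < real k * 1" using k0 frac_lt_1 by (intro mult_strict_left_mono)
    ultimately show "\<phi> a \<in> {..<k}" unfolding \<phi>_def lessThan_iff by linarith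
  qed
  have cardG: "card G = (m + 1)\<^sup>2" by (simp add: G_def card_cartesian_product power2_eq_square nat_add_distrib)
  have "n * k < (m + 1)\<^sup>2"
  proof -
    have "real n * real k \<le> real n * (2 * (q\<^sup>2 / r))" using k by (intro mult_left_mono) auto
    also have "\<dots> = (2 * real n) * (q\<^sup>2 / r)" by simp
    also have "\<dots> < r ^ 3 * (q\<^sup>2 / r)" using n qr by (intro mult_strict_right_mono) auto
    also have "\<dots> = (r * q)\<^sup>2" using r by (simp add: power2_eq_square power3_eq_cube)
    also have "\<dots> \<le> (real m + 1)\<^sup>2" using m rq by (intro power_mono) auto
    finally have "real (n * k) < real ((m + 1)\<^sup>2)" by (simp add: add.commute)
    thus ?thesis by (simp only: of_nat_less_iff)
  qed
  then obtain y where y: "n < card {a\<in>G. \<phi> a = y}"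
    using exists_large_fibre[of G \<phi> "{..<k}" n] \<phi> cardG by (auto simp: G_def)
  define T where "T = {a\<in>G. \<phi> a = y}"
  have T: "finite T" "n < card T" using y by (auto simp: T_def G_def)
  hence "T \<noteq> {}" by auto
  then obtain a0 where a0: "a0 \<in> T" by blast
  define V where "V a = (fst a - fst a0, snd a - snd a0, - (\<lfloor>f a\<rfloor> - \<lfloor>f a0\<rfloor>))" for a
  show ?thesis
  proof (rule that[of "V ` T"])
    show "finite (V ` T)" using T by simp
    have "inj_on V T" by (rule inj_onI) (auto simp: V_def prod_eq_iff)
    thus "n < card (V ` T)" using T by (simp add: card_image)
    fix v assume "v \<in> V ` T"
    then obtain a where a: "a \<in> T" "v = V a" by blast
    have G: "a \<in> G" "a0 \<in> G" "\<phi> a = \<phi> a0" using a a0 by (auto simp: T_def)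
    have "height v \<le> real m"
      using G by (auto simp: a(2) V_def height_def G_def abs_le_iff)
    moreover have "F 0 v x = frac (f a) - frac (f a0)"
      by (simp add: a(2) V_def F_def frac_def f_def algebra_simps)
    moreover have "\<bar>frac (f a) - frac (f a0)\<bar> \<le> 1 / real k"
    proof -
      have "\<lfloor>real k * frac (f a)\<rfloor> = \<lfloor>real k * frac (f a0)\<rfloor>"
      proof -
        have "0 \<le> \<lfloor>real k * frac (f a)\<rfloor>" "0 \<le> \<lfloor>real k * frac (f a0)\<rfloor>" by auto
        thus ?thesis using G(3) unfolding \<phi>_def by linarith
      qed
      hence "\<bar>real k * frac (f a) - real k * frac (f a0)\<bar> \<le> 1" by linarith
      hence "\<bar>real k * (frac (f a) - frac (f a0))\<bar> \<le> 1" by (simp add: right_diff_distrib)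
      hence "real k * \<bar>frac (f a) - frac (f a0)\<bar> \<le> 1" by (simp add: abs_mult)
      thus ?thesis using k0 by (simp add: field_simps)
    qed
    moreover have "q\<^sup>2 * (1 / real k) \<le> r" using k(1) k0 r by (simp add: field_simps)
    ultimately have "q\<^sup>2 * \<bar>F 0 v x\<bar> \<le> r"
      using mult_left_mono[of "\<bar>F 0 v x\<bar>" "1 / real k" "q\<^sup>2"] by simp
    thus "height v \<le> r * q \<and> \<bar>q\<^sup>2 * F 0 v x\<bar> \<le> r"
      using \<open>height v \<le> real m\<close> m by (simp add: abs_mult)
  qed
qed

text \<open>If the scaled short vectors spanned at most a plane, there would be too many of them for the
  separation guaranteed by the absence of very short vectors.\<close>

lemma short_vectors_span:
  assumes q: "1 \<le> q" and \<kappa>: "0 < \<kappa>" "\<kappa> \<le> 1" and r: "1 \<le> r"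
    and good: "\<And>v. v \<noteq> 0 \<Longrightarrow> height v \<le> q \<Longrightarrow> \<kappa> < q\<^sup>2 * \<bar>F 0 v x\<bar>"
    and S: "finite S" "\<And>v. v \<in> S \<Longrightarrow> height v \<le> r * q \<and> \<bar>q\<^sup>2 * F 0 v x\<bar> \<le> r"
    and card: "(2 * K + 1)\<^sup>2 < card S" "2 * r / \<kappa> \<le> real K"
  shows "span (scaled q x ` S) = UNIV"
proof (rule ccontr)
  assume "span (scaled q x ` S) \<noteq> UNIV"
  then obtain N where N: "N \<noteq> 0" "\<And>y. y \<in> span (scaled q x ` S) \<Longrightarrow> N \<bullet> y = 0"
    using span_not_UNIV_orthogonal by blast
  obtain N1 N2 N3 where NN: "N = (N1, N2, N3)" by (cases N)
  define g1 where "g1 v = fst (scaled q x v)" for v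
  define g2 where "g2 v = fst (snd (scaled q x v))" for v
  define g3 where "g3 v = snd (snd (scaled q x v))" for v
  have sc: "scaled q x v = (g1 v, g2 v, g3 v)" for v by (simp add: g1_def g2_def g3_def)
  have bd: "\<bar>g1 v\<bar> \<le> r" "\<bar>g2 v\<bar> \<le> r" "\<bar>g3 v\<bar> \<le> r" if "v \<in> S" for v
  proof -
    obtain a b p where v: "v = (a, b, p)" by (cases v)
    have "\<bar>real_of_int a\<bar> \<le> r * q" "\<bar>real_of_int b\<bar> \<le> r * q" "\<bar>q\<^sup>2 * F 0 v x\<bar> \<le> r"
      using S(2)[OF that] by (auto simp: v height_def)
    thus "\<bar>g1 v\<bar> \<le> r" "\<bar>g2 v\<bar> \<le> r" "\<bar>g3 v\<bar> \<le> r"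
      using q by (auto simp: g1_def g2_def g3_def scaled_def v pos_divide_le_eq)
  qed
  have diff: "g1 (v - w) = g1 v - g1 w" "g2 (v - w) = g2 v - g2 w" "g3 (v - w) = g3 v - g3 w" for v w
    by (simp_all add: g1_def g2_def g3_def scaled_diff)
  have rel: "N1 * (g1 v - g1 w) + N2 * (g2 v - g2 w) + N3 * (g3 v - g3 w) = 0" if "v \<in> S" "w \<in> S" for v w
  proof -
    have "N \<bullet> (scaled q x v - scaled q x w) = 0"
      using that by (intro N(2) span_diff span_base) auto
    thus ?thesis by (simp add: NN sc add.assoc)
  qed
  \<comment> \<open>Since \<kappa> <= 1, closeness in the first two coordinates makes the difference
    a vector of height at most q, to which \<open>good\<close> applies; closeness in the third
    contradicts it.\<close>
  have contra: False if vw: "v \<in> S" "w \<in> S" "v \<noteq> w" "\<bar>g1 v - g1 w\<bar> \<le> \<kappa>" "\<bar>g2 v - g2 w\<bar> \<le> \<kappa>" "\<bar>g3 v - g3 w\<bar> \<le> \<kappa>" for v w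
  proof -
    obtain a b p where u: "v - w = (a, b, p)" by (cases "v - w")
    have g: "\<bar>g1 (v - w)\<bar> \<le> \<kappa>" "\<bar>g2 (v - w)\<bar> \<le> \<kappa>" "\<bar>g3 (v - w)\<bar> \<le> \<kappa>" using vw by (simp_all add: diff)
    have "\<bar>real_of_int a\<bar> / q \<le> 1" "\<bar>real_of_int b\<bar> / q \<le> 1"
      using g(1,2) \<kappa> q by (auto simp: g1_def g2_def scaled_def u simp del: divide_le_eq_1_pos)
    hence "height (v - w) \<le> q" using q by (simp add: height_def u)
    hence "\<kappa> < q\<^sup>2 * \<bar>F 0 (v - w) x\<bar>" using vw(3) by (intro good) auto
    moreover have "q\<^sup>2 * \<bar>F 0 (v - w) x\<bar> \<le> \<kappa>" using g(3) by (simp add: g3_def scaled_def u abs_mult)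
    ultimately show False by simp
  qed
  consider "\<bar>N1\<bar> \<le> \<bar>N3\<bar>" "\<bar>N2\<bar> \<le> \<bar>N3\<bar>" "N3 \<noteq> 0" | "\<bar>N1\<bar> \<le> \<bar>N2\<bar>" "\<bar>N3\<bar> \<le> \<bar>N2\<bar>" "N2 \<noteq> 0"
    | "\<bar>N2\<bar> \<le> \<bar>N1\<bar>" "\<bar>N3\<bar> \<le> \<bar>N1\<bar>" "N1 \<noteq> 0"
    using N(1) unfolding NN zero_prod_def prod.inject by linarith
  thus False
  proof cases
    case 1
    have "\<bar>g3 v - g3 w\<bar> \<le> \<bar>g1 v - g1 w\<bar> + \<bar>g2 v - g2 w\<bar>" if "v \<in> S" "w \<in> S" for v w
      by (rule abs_coordinate_le[OF rel[OF that] 1])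
    from grid_pigeonhole[of S K \<kappa> r g1 g2 g3, OF S(1) card(1) \<kappa>(1) card(2) bd(1,2) this]
    obtain v w where "v \<in> S" "w \<in> S" "v \<noteq> w" "\<bar>g1 v - g1 w\<bar> \<le> \<kappa>" "\<bar>g2 v - g2 w\<bar> \<le> \<kappa>" "\<bar>g3 v - g3 w\<bar> \<le> \<kappa>" .
    thus False using contra by blast
  next
    case 2
    have "\<bar>g2 v - g2 w\<bar> \<le> \<bar>g1 v - g1 w\<bar> + \<bar>g3 v - g3 w\<bar>" if "v \<in> S" "w \<in> S" for v w
      by (rule abs_coordinate_le[OF _ 2]) (use rel[OF that] in simp)
    from grid_pigeonhole[of S K \<kappa> r g1 g3 g2, OF S(1) card(1) \<kappa>(1) card(2) bd(1,3) this]
    obtain v w where "v \<in> S" "w \<in> S" "v \<noteq> w" "\<bar>g1 v - g1 w\<bar> \<le> \<kappa>" "\<bar>g3 v - g3 w\<bar> \<le> \<kappa>" "\<bar>g2 v - g2 w\<bar> \<le> \<kappa>" .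
    thus False using contra by blast
  next
    case 3
    have "\<bar>g1 v - g1 w\<bar> \<le> \<bar>g2 v - g2 w\<bar> + \<bar>g3 v - g3 w\<bar>" if "v \<in> S" "w \<in> S" for v w
      by (rule abs_coordinate_le[OF _ 3]) (use rel[OF that] in simp)
    from grid_pigeonhole[of S K \<kappa> r g2 g3 g1, OF S(1) card(1) \<kappa>(1) card(2) bd(2,3) this]
    obtain v w where "v \<in> S" "w \<in> S" "v \<noteq> w" "\<bar>g2 v - g2 w\<bar> \<le> \<kappa>" "\<bar>g3 v - g3 w\<bar> \<le> \<kappa>" "\<bar>g1 v - g1 w\<bar> \<le> \<kappa>" .
    thus False using contra by blast
  qed
qed

text \<open>Independent short vectors allow any target in space to be approximated by a lattice
  point with error O(r). The target is chosen so that the third coordinate cancels l x and the first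
  forces a large derivative.\<close>

lemma inhomogeneous_solution:
  obtains M where "3 \<le> M" "\<And>q \<kappa> r K x. x \<in> {\<alpha>..\<beta>} \<Longrightarrow> 1 \<le> q \<Longrightarrow> 0 < \<kappa> \<Longrightarrow> \<kappa> \<le> 1 \<Longrightarrow> 1 \<le> r \<Longrightarrow> r \<le> q\<^sup>2 \<Longrightarrow>
      (\<And>v. v \<noteq> 0 \<Longrightarrow> height v \<le> q \<Longrightarrow> \<kappa> < q\<^sup>2 * \<bar>F 0 v x\<bar>) \<Longrightarrow>
      2 * r / \<kappa> \<le> real K \<Longrightarrow> 2 * (2 * real K + 1)\<^sup>2 < r ^ 3 \<Longrightarrow>
      \<exists>v. height v \<le> M * r * q \<and> r * q \<le> height v \<and> q\<^sup>2 * \<bar>F 1 v x\<bar> \<le> 2 * r \<and> r * q \<le> \<bar>F' 1 v x\<bar>"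
proof (rule that[of "4 + (3 * A + 1) / c"])
  \<comment> \<open>The first target coordinate gives a >= (m - 2) * r * q, so a * f1' has size at
    least (3 * A + 1) * r * q; the terms with f2' and l' take away at most 3 * A * r * q. The bound
    in the conclusion is m + 2.\<close>
  define m where "m = 2 + (3 * A + 1) / c"
  have m: "2 \<le> m" "c * (m - 2) = 3 * A + 1" using A c by (auto simp: m_def)
  show "3 \<le> 4 + (3 * A + 1) / c" using A c by simp
  fix q \<kappa> r x :: real and K :: nat
  assume x: "x \<in> {\<alpha>..\<beta>}" and q: "1 \<le> q" and \<kappa>: "0 < \<kappa>" "\<kappa> \<le> 1" and r: "1 \<le> r" "r \<le> q\<^sup>2"
    and good: "\<And>v. v \<noteq> 0 \<Longrightarrow> height v \<le> q \<Longrightarrow> \<kappa> < q\<^sup>2 * \<bar>F 0 v x\<bar>"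
    and K: "2 * r / \<kappa> \<le> real K" "2 * (2 * real K + 1)\<^sup>2 < r ^ 3"
  have "2 * real ((2 * K + 1)\<^sup>2) < r ^ 3" using K(2) by (simp add: add.commute)
  then obtain S where S: "finite S" "(2 * K + 1)\<^sup>2 < card S"
    "\<And>v. v \<in> S \<Longrightarrow> height v \<le> r * q \<and> \<bar>q\<^sup>2 * F 0 v x\<bar> \<le> r"
    using many_short_vectors[OF q r, of "(2 * K + 1)\<^sup>2" x] by metis
  have span: "span (scaled q x ` S) = UNIV"
    by (rule short_vectors_span[OF q \<kappa> r(1) good S(1,3,2) K(1)])
  obtain B where B: "B \<subseteq> scaled q x ` S" "independent B" "scaled q x ` S \<subseteq> span B" "card B = dim (scaled q x ` S)"
    using basis_exists by blast
  have finB: "finite B" using B(2) by (rule independent_imp_finite)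
  have "card B \<le> DIM(real \<times> real \<times> real)" unfolding B(4) by (rule dim_subset_UNIV)
  hence cardB: "card B \<le> 3" by simp
  have "span B = UNIV" using span_mono[OF B(3)] span by (auto simp: span_span)
  define target :: "real \<times> real \<times> real" where "target = (m * r, 0, - q\<^sup>2 * l x)"
  have "target \<in> span B" using \<open>span B = UNIV\<close> by simp
  then obtain t where t: "target = (\<Sum>b\<in>B. t b *\<^sub>R b)" using span_finite[OF finB] by auto
  have "\<exists>v\<in>S. scaled q x v = b" if "b \<in> B" for b using B(1) that by force
  then obtain V where V: "\<And>b. b \<in> B \<Longrightarrow> V b \<in> S \<and> scaled q x (V b) = b" by metis
  define v where "v = (\<Sum>b\<in>B. smul (round (t b)) (V b))"
  have sv: "scaled q x v = (\<Sum>b\<in>B. of_int (round (t b)) *\<^sub>R b)"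
    unfolding v_def scaled_sum[OF finB] using V by (intro sum.cong) auto
  have dv: "scaled q x v - target = (\<Sum>b\<in>B. (of_int (round (t b)) - t b) *\<^sub>R b)"
    unfolding sv t by (simp add: sum_subtractf scaleR_diff_left)
  \<comment> \<open>Rounding moves each of at most three coefficients by at most 1/2, and the basis
    vectors have coordinates of size at most r.\<close>
  have coord: "\<bar>g (scaled q x v - target)\<bar> \<le> 3/2 * r"
    if g: "linear g" "\<And>v. v \<in> S \<Longrightarrow> \<bar>g (scaled q x v)\<bar> \<le> r" for g :: "real \<times> real \<times> real \<Rightarrow> real"
  proof -
    have "\<bar>g (scaled q x v - target)\<bar> = \<bar>\<Sum>b\<in>B. (of_int (round (t b)) - t b) * g b\<bar>"
      unfolding dv using g(1) by (simp add: linear_sum linear_scale)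
    also have "\<dots> \<le> (\<Sum>b\<in>B. \<bar>(of_int (round (t b)) - t b) * g b\<bar>)" by (rule sum_abs)
    also have "\<dots> \<le> (\<Sum>b\<in>B. 1/2 * r)"
    proof (rule sum_mono)
      fix b assume b: "b \<in> B"
      show "\<bar>(of_int (round (t b)) - t b) * g b\<bar> \<le> 1/2 * r"
        unfolding abs_mult using of_int_round_abs_le[of "t b"] g(2)[of "V b"] V[OF b] by (intro mult_mono) auto
    qed
    also have "\<dots> = real (card B) * (1/2 * r)" by simp
    also have "\<dots> \<le> 3 * (1/2 * r)" using cardB r by (intro mult_right_mono) auto
    finally show ?thesis by simp
  qed
  obtain a b p where v3: "v = (a, b, p)" by (cases v)
  have Sc: "\<bar>fst (scaled q x w)\<bar> \<le> r" "\<bar>fst (snd (scaled q x w))\<bar> \<le> r" "\<bar>snd (snd (scaled q x w))\<bar> \<le> r" if "w \<in> S" for w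
  proof -
    obtain a b p where w: "w = (a, b, p)" by (cases w)
    have "\<bar>real_of_int a\<bar> \<le> r * q" "\<bar>real_of_int b\<bar> \<le> r * q" "\<bar>q\<^sup>2 * F 0 w x\<bar> \<le> r"
      using S(3)[OF that] by (auto simp: w height_def)
    thus "\<bar>fst (scaled q x w)\<bar> \<le> r" "\<bar>fst (snd (scaled q x w))\<bar> \<le> r" "\<bar>snd (snd (scaled q x w))\<bar> \<le> r"
      using q by (auto simp: scaled_def w pos_divide_le_eq)
  qed
  have c1: "\<bar>of_int a / q - m * r\<bar> \<le> 2 * r"
  proof -
    from coord[OF linear_fst Sc(1)] have "\<bar>of_int a / q - m * r\<bar> \<le> 3/2 * r" by (simp add: scaled_def v3 target_def)
    thus ?thesis using r by linarith
  qed
  have c2: "\<bar>of_int b / q\<bar> \<le> 2 * r"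
  proof -
    have "linear (\<lambda>y::real \<times> real \<times> real. fst (snd y))"
      using linear_compose[OF linear_snd linear_fst] by (simp add: o_def)
    from coord[OF this Sc(2)] have "\<bar>of_int b / q\<bar> \<le> 3/2 * r" by (simp add: scaled_def v3 target_def)
    thus ?thesis using r by linarith
  qed
  have c3: "\<bar>q\<^sup>2 * F 0 v x + q\<^sup>2 * l x\<bar> \<le> 2 * r"
  proof -
    have "linear (\<lambda>y::real \<times> real \<times> real. snd (snd y))"
      using linear_compose[OF linear_snd linear_snd] by (simp add: o_def)
    from coord[OF this Sc(3)] have "\<bar>q\<^sup>2 * F 0 v x + q\<^sup>2 * l x\<bar> \<le> 3/2 * r" by (simp add: scaled_def v3 target_def)
    thus ?thesis using r by linarith
  qed
  have rq: "1 \<le> r * q" using mult_mono[of 1 r 1 q] q r by simp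
  have a: "(m - 2) * (r * q) \<le> of_int a" "of_int a \<le> (m + 2) * (r * q)"
  proof -
    have "(m - 2) * r \<le> of_int a / q" "of_int a / q \<le> (m + 2) * r" using c1 by (auto simp: abs_le_iff algebra_simps)
    hence "(m - 2) * r * q \<le> of_int a" "of_int a \<le> (m + 2) * r * q" using q by (auto simp: field_simps)
    thus "(m - 2) * (r * q) \<le> of_int a" "of_int a \<le> (m + 2) * (r * q)" by (simp_all add: mult.assoc)
  qed
  have b: "\<bar>of_int b\<bar> \<le> 2 * (r * q)" using c2 q by (simp add: field_simps)
  have a0: "0 \<le> real_of_int a" using a(1) m rq by (smt (verit) mult_nonneg_nonneg)
  have m3: "1 \<le> m - 2"
  proof -
    have "c * 1 \<le> c * (m - 2)" unfolding m(2) using c A by simp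
    thus ?thesis using c by (simp add: mult_le_cancel_left)
  qed
  have h1: "height v \<le> (m + 2) * (r * q)"
  proof -
    have "2 * (r * q) \<le> (m + 2) * (r * q)" using m rq by (intro mult_right_mono) auto
    thus ?thesis using a a0 b by (auto simp: height_def v3)
  qed
  have h2: "r * q \<le> height v"
  proof -
    have "1 * (r * q) \<le> (m - 2) * (r * q)" using m3 rq by (intro mult_right_mono) auto
    thus ?thesis using a a0 by (auto simp: height_def v3)
  qed
  have Fb: "q\<^sup>2 * \<bar>F 1 v x\<bar> \<le> 2 * r"
  proof -
    have "F 1 v x = F 0 v x + l x" by (simp add: F_def v3)
    hence "\<bar>q\<^sup>2 * F 1 v x\<bar> \<le> 2 * r" using c3 by (simp add: distrib_left)
    thus ?thesis by (simp add: abs_mult)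
  qed
  have F'b: "r * q \<le> \<bar>F' 1 v x\<bar>"
  proof -
    have "(3 * A + 1) * (r * q) = c * ((m - 2) * (r * q))" using m(2) by (simp add: mult.assoc[symmetric])
    also have "\<dots> \<le> \<bar>f1' x\<bar> * \<bar>of_int a\<bar>" using f1'_ge[OF x] a a0 c m rq by (intro mult_mono) auto
    finally have 1: "(3 * A + 1) * (r * q) \<le> \<bar>of_int a * f1' x\<bar>" by (simp add: abs_mult mult.commute)
    have 2: "\<bar>of_int b * f2' x\<bar> \<le> 2 * (r * q) * A" unfolding abs_mult
      using b bounds_f2(2)[OF x] rq by (intro mult_mono) auto
    have "A * 1 \<le> A * (r * q)" using rq A by (intro mult_left_mono) auto
    hence 3: "\<bar>l' x\<bar> \<le> A * (r * q)" using bounds_l(2)[OF x] by linarith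
    have "F' 1 v x = of_int a * f1' x + of_int b * f2' x + l' x" by (simp add: F'_def v3)
    moreover have "(3 * A + 1) * (r * q) - 2 * (r * q) * A - A * (r * q) = r * q" by (simp add: algebra_simps)
    ultimately show ?thesis using 1 2 3 by linarith
  qed
  show "\<exists>v. height v \<le> (4 + (3 * A + 1) / c) * r * q \<and> r * q \<le> height v \<and> q\<^sup>2 * \<bar>F 1 v x\<bar> \<le> 2 * r \<and> r * q \<le> \<bar>F' 1 v x\<bar>"
    using h1 h2 Fb F'b by (intro exI[of _ v]) (simp add: m_def mult.assoc)
qed

end

section \<open>The lower bound along an arc\<close>

lemma maximal_separated:
  fixes Z :: "real set"
  assumes "Z \<subseteq> {u..v}" "0 < \<rho>"
  shows "\<exists>X. finite X \<and> X \<subseteq> Z \<and> (\<forall>x\<in>X. \<forall>y\<in>X. x \<noteq> y \<longrightarrow> \<rho> \<le> \<bar>x - y\<bar>) \<and>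
    (\<forall>z\<in>Z. \<exists>x\<in>X. \<bar>z - x\<bar> < \<rho>)"
proof -
  define P where "P X \<longleftrightarrow> finite X \<and> X \<subseteq> Z \<and> (\<forall>x\<in>X. \<forall>y\<in>X. x \<noteq> y \<longrightarrow> \<rho> \<le> \<bar>x - y\<bar>)" for X
  have bound: "card X \<le> nat \<lfloor>\<bar>v - u\<bar> / \<rho> + 1\<rfloor>" if "P X" for X
  proof (cases "X = {}")
    case False
    hence uv: "u \<le> v" using that assms(1) by (fastforce simp: P_def)
    have "real (card X) \<le> (v - u) / \<rho> + 1"
      by (rule card_separated_le) (use that assms uv in \<open>auto simp: P_def\<close>)
    also have "\<dots> = \<bar>v - u\<bar> / \<rho> + 1" using uv by simp
    finally show ?thesis by linarith
  qed auto
  have "P {}" by (simp add: P_def)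
  moreover have "\<forall>Y. P Y \<longrightarrow> card Y < Suc (nat \<lfloor>\<bar>v - u\<bar> / \<rho> + 1\<rfloor>)"
    using bound unfolding less_Suc_eq_le by blast
  ultimately obtain X where X: "P X" "\<And>Y. P Y \<Longrightarrow> card Y \<le> card X"
    using ex_has_greatest_nat[of P "{}" card] by blast
  show ?thesis
  proof (intro exI[of _ X] conjI ballI[of Z])
    fix z assume z: "z \<in> Z"
    show "\<exists>x\<in>X. \<bar>z - x\<bar> < \<rho>"
    proof (rule ccontr)
      assume "\<not> ?thesis"
      hence far: "\<And>x. x \<in> X \<Longrightarrow> \<rho> \<le> \<bar>z - x\<bar>" by force
      hence "z \<notin> X" using assms(2) by force
      moreover have "P (insert z X)" using X(1) z far by (auto simp: P_def abs_minus_commute)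
      hence "card (insert z X) \<le> card X" by (rule X(2))
      ultimately show False using X(1) by (simp add: P_def)
    qed
  qed (use X in \<open>auto simp: P_def\<close>)
qed

lemma eventually_le_powr:
  fixes p \<Lambda> :: real
  assumes "0 < p"
  obtains T where "\<And>t::nat. T \<le> t \<Longrightarrow> \<Lambda> \<le> (2 ^ t) powr p"
proof -
  have "1 < 2 powr p" using assms powr_less_mono[of 0 p 2] by simp
  then obtain T where T: "\<Lambda> < (2 powr p) ^ T" using real_arch_pow by blast
  show ?thesis
  proof (rule that[of T])
    fix t assume "T \<le> t"
    hence "(2 powr p) ^ T \<le> (2 powr p) ^ t" using \<open>1 < 2 powr p\<close> by (intro power_increasing) auto
    also have "(2 powr p) ^ t = (2 ^ t) powr p"
      by (simp add: powr_realpow[symmetric] powr_powr mult.commute)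
    finally show "\<Lambda> \<le> (2 ^ t) powr p" using T by simp
  qed
qed

context arc
begin

text \<open>The room q powr -\<epsilon> below the scale 1 / q^2 beats the logarithm in both regimes:
  bounded derivative is handled by the homogeneous mean estimate, large derivative by the content
  estimate with exponent 1, which dominates Lebesgue measure.\<close>

lemma good_points:
  assumes \<epsilon>: "0 < \<epsilon>" and \<mu>: "0 < \<mu>"
  obtains t0 where "\<And>t. t0 \<le> t \<Longrightarrow> \<exists>Bd. Bd \<in> fmeasurable lborel \<and> measure lborel Bd \<le> \<mu> \<and>
    (\<forall>x\<in>{\<alpha>..\<beta>} - Bd. \<forall>v. v \<noteq> 0 \<longrightarrow> height v \<le> 2 ^ t \<longrightarrow> (2 ^ t) powr - \<epsilon> < (2 ^ t)\<^sup>2 * \<bar>F 0 v x\<bar>)"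
proof -
  obtain C1 where C1: "0 \<le> C1" "\<And>t e' V. finite V \<Longrightarrow> 0 < e' \<Longrightarrow> e' < 1 \<Longrightarrow> e' \<le> 2 / 4 ^ t \<Longrightarrow>
      (\<And>v. v \<in> V \<Longrightarrow> v \<noteq> 0 \<and> height v \<le> 4 * 2 ^ t) \<Longrightarrow>
      (\<Sum>v\<in>V. measure lborel (E 0 v e' 4)) \<le> C1 * (2 ^ t * sqrt e') * (real t + 3)"
    using homogeneous_sum_bounded by blast
  obtain C2 where C2: "0 \<le> C2" "\<And>\<kappa> s Q \<delta>. \<bar>\<kappa>\<bar> \<le> 1 \<Longrightarrow> 0 < s \<Longrightarrow> s \<le> 1 \<Longrightarrow> 1 \<le> Q \<Longrightarrow> 0 < \<delta> \<Longrightarrow> \<delta> \<le> 1 \<Longrightarrow>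
    hcontent s {x\<in>{\<alpha>..\<beta>}. \<exists>v. height v \<le> Q \<and> \<bar>F \<kappa> v x\<bar> \<le> \<delta> \<and> 1 \<le> \<bar>F' \<kappa> v x\<bar>}
      \<le> ennreal (C2 * \<delta> powr s * Q powr (3 - s) * (1 + ln Q))"
    using large_derivative_content by blast
  define \<rho> where "\<rho> = (2::real) powr - (\<epsilon> / 2)"
  have \<rho>: "0 \<le> \<rho>" "\<rho> < 1" using \<epsilon> powr_less_mono[of "- (\<epsilon> / 2)" 0 2] by (auto simp: \<rho>_def)
  have "(\<lambda>t. (C1 + C2) * (real t + 3) * \<rho> ^ t) \<longlonglongrightarrow> 0"
    by (rule summable_LIMSEQ_zero[OF summable_linear_geometric[OF \<rho>]])
  hence "eventually (\<lambda>t. (C1 + C2) * (real t + 3) * \<rho> ^ t < \<mu>) sequentially" using \<mu> by (intro order_tendstoD)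
  then obtain t0 where t0: "\<And>t. t0 \<le> t \<Longrightarrow> (C1 + C2) * (real t + 3) * \<rho> ^ t < \<mu>" by (auto simp: eventually_sequentially)
  show ?thesis
  proof (rule that[of "max 1 t0"])
    fix t :: nat assume t: "max 1 t0 \<le> t"
    define q where "q = (2::real) ^ t"
    have "(2::real) ^ 1 \<le> q" unfolding q_def using t by (intro power_increasing) auto
    hence q2: "2 \<le> q" by simp
    have q1: "1 \<le> q" using q2 by simp
    have \<rho>t: "q powr - (\<epsilon> / 2) = \<rho> ^ t" by (simp add: q_def \<rho>_def powr_powr powr_realpow[symmetric] mult.commute)
    \<comment> \<open>With this threshold q * sqrt e' is q powr -(\<epsilon> / 2), which decays
      faster than t grows.\<close>
    define e' where "e' = q powr (- \<epsilon> - 2)"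
    have e'e: "e' = q powr - \<epsilon> / q\<^sup>2"
    proof -
      have "e' = q powr - \<epsilon> / q powr 2" unfolding e'_def by (rule powr_diff)
      thus ?thesis using q1 by (simp add: powr_numeral)
    qed
    have e'0: "0 < e'" using q1 by (simp add: e'_def)
    have e'4: "e' \<le> 1 / 4 ^ t"
    proof -
      have "q powr - \<epsilon> \<le> 1" using q1 \<epsilon> powr_mono[of "-\<epsilon>" 0 q] by simp
      hence "e' \<le> 1 / q\<^sup>2" unfolding e'e by (intro divide_right_mono) auto
      also have "q\<^sup>2 = 4 ^ t" by (simp add: q_def power2_eq_square power_mult_distrib[symmetric])
      finally show ?thesis .
    qed
    have e'1: "e' < 1"
    proof -
      have "(4::real) ^ 1 \<le> 4 ^ t" using t by (intro power_increasing) auto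
      hence "1 / (4::real) ^ t \<le> 1 / 4" by (intro divide_left_mono) auto
      with e'4 show ?thesis by linarith
    qed
    define V where "V = {v. height v \<le> q \<and> E 0 v e' (3 * A * q) \<noteq> {}} - {0}"
    have V: "finite V" unfolding V_def by (intro finite_Diff finite_heights)
    define Lv where "Lv v = {x\<in>{\<alpha>..\<beta>}. \<bar>F 0 v x\<bar> \<le> e' \<and> 1 \<le> \<bar>F' 0 v x\<bar>}" for v
    have cL: "compact (Lv v)" if "v \<in> V" for v
    proof -
      interpret C2_function \<alpha> \<beta> "F 0 v" "F' 0 v" "F'' 0 v" "3 * A * q"
        by (rule C2_F) (use that q1 in \<open>auto simp: V_def\<close>)
      have "compact {x\<in>{\<alpha>..\<beta>}. max (\<bar>F 0 v x\<bar> - e') (1 - \<bar>F' 0 v x\<bar>) \<le> 0}"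
        by (intro compact_sublevel continuous_intros cont cont')
      thus ?thesis by (simp add: Lv_def conj_commute)
    qed
    define B1 where "B1 = (\<Union>v\<in>V. E 0 v e' 4)"
    define B2 where "B2 = (\<Union>v\<in>V. Lv v)"
    have "compact B1" unfolding B1_def by (intro compact_UN V E_measurable(3))
    hence B1: "B1 \<in> fmeasurable lborel" by (rule fmeasurable_compact)
    have "compact B2" unfolding B2_def by (intro compact_UN V cL)
    hence B2: "B2 \<in> fmeasurable lborel" by (rule fmeasurable_compact)
    have m1: "measure lborel B1 \<le> C1 * (real t + 3) * \<rho> ^ t"
    proof -
      have "measure lborel B1 \<le> (\<Sum>v\<in>V. measure lborel (E 0 v e' 4))"
        unfolding B1_def by (rule measure_UNION_le[OF V]) (use E_measurable in auto)
      also have "\<dots> \<le> C1 * (2 ^ t * sqrt e') * (real t + 3)"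
      proof (rule C1(2)[OF V e'0 e'1])
        show "e' \<le> 2 / 4 ^ t" using e'4 by (rule order_trans) (simp add: divide_right_mono)
        fix v assume "v \<in> V"
        hence "v \<noteq> 0" "height v \<le> q" by (simp_all add: V_def)
        moreover have "q \<le> 4 * 2 ^ t" by (simp add: q_def)
        ultimately show "v \<noteq> 0 \<and> height v \<le> 4 * 2 ^ t" by linarith
      qed
      also have "2 ^ t * sqrt e' = \<rho> ^ t"
      proof -
        have "sqrt e' = q powr ((- \<epsilon> - 2) * (1/2))"
        proof -
          have "sqrt e' = e' powr (1/2)" using e'0 by (intro powr_half_sqrt[symmetric]) simp
          thus ?thesis unfolding e'_def powr_powr .
        qed
        also have "(- \<epsilon> - 2) * (1/2) = - 1 - \<epsilon> / 2" by simp
        finally have "sqrt e' = q powr (- 1 - \<epsilon> / 2)" .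
        hence "q * sqrt e' = q powr 1 * q powr (- 1 - \<epsilon> / 2)" using q1 by simp
        also have "\<dots> = q powr (1 + (- 1 - \<epsilon> / 2))" by (rule powr_add[symmetric])
        also have "1 + (- 1 - \<epsilon> / 2) = - (\<epsilon> / 2)" by simp
        finally have "q * sqrt e' = q powr - (\<epsilon> / 2)" .
        thus ?thesis unfolding \<rho>t by (simp only: q_def)
      qed
      finally show ?thesis by (simp add: mult_ac)
    qed
    have m2: "measure lborel B2 \<le> C2 * (real t + 3) * \<rho> ^ t"
    proof -
      have "ennreal (measure lborel B2) = emeasure lborel B2" using B2 by (simp add: emeasure_eq_measure2)
      also have "\<dots> \<le> hcontent 1 B2" using B2 by (intro emeasure_le_hcontent) auto
      also have "\<dots> \<le> hcontent 1 {x\<in>{\<alpha>..\<beta>}. \<exists>v. height v \<le> q \<and> \<bar>F 0 v x\<bar> \<le> e' \<and> 1 \<le> \<bar>F' 0 v x\<bar>}"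
      proof (rule hcontent_mono, rule subsetI)
        fix x assume "x \<in> B2"
        then obtain v where "v \<in> V" "x \<in> Lv v" unfolding B2_def by blast
        thus "x \<in> {x\<in>{\<alpha>..\<beta>}. \<exists>v. height v \<le> q \<and> \<bar>F 0 v x\<bar> \<le> e' \<and> 1 \<le> \<bar>F' 0 v x\<bar>}"
          unfolding V_def Lv_def by blast
      qed
      also have "\<dots> \<le> ennreal (C2 * e' powr 1 * q powr (3 - 1) * (1 + ln q))"
        by (rule C2(2)) (use q1 e'0 e'1 in auto)
      also have "\<dots> \<le> ennreal (C2 * (real t + 3) * \<rho> ^ t)"
      proof (rule ennreal_leI)
        have "e' powr 1 * q powr (3 - 1) = q powr - \<epsilon>" using e'0 q1 by (simp add: e'e powr_numeral)
        also have "\<dots> \<le> \<rho> ^ t" unfolding \<rho>t[symmetric] using q1 \<epsilon> by (intro powr_mono) auto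
        finally have 1: "e' powr 1 * q powr (3 - 1) \<le> \<rho> ^ t" .
        have "ln q = real t * ln 2" by (simp add: q_def ln_realpow)
        also have "\<dots> \<le> real t * 1" using ln2_le_25_over_36 by (intro mult_left_mono) auto
        finally have "1 + ln q \<le> real t + 3" by simp
        hence "(e' powr 1 * q powr (3 - 1)) * (1 + ln q) \<le> \<rho> ^ t * (real t + 3)"
          by (rule mult_mono[OF 1]) (use q1 \<rho> in auto)
        from mult_left_mono[OF this C2(1)]
        show "C2 * e' powr 1 * q powr (3 - 1) * (1 + ln q) \<le> C2 * (real t + 3) * \<rho> ^ t" by (simp only: mult_ac)
      qed
      finally show ?thesis using C2(1) \<rho> by (simp add: ennreal_le_iff)
    qed
    show "\<exists>Bd. Bd \<in> fmeasurable lborel \<and> measure lborel Bd \<le> \<mu> \<and>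
      (\<forall>x\<in>{\<alpha>..\<beta>} - Bd. \<forall>v. v \<noteq> 0 \<longrightarrow> height v \<le> 2 ^ t \<longrightarrow> (2 ^ t) powr - \<epsilon> < (2 ^ t)\<^sup>2 * \<bar>F 0 v x\<bar>)"
    proof (intro exI[of _ "B1 \<union> B2"] conjI ballI allI impI)
      show "B1 \<union> B2 \<in> fmeasurable lborel" using B1 B2 by (rule fmeasurable.Un)
      have "measure lborel (B1 \<union> B2) \<le> measure lborel B1 + measure lborel B2"
        using B1 B2 by (intro measure_Un_le) auto
      also have "\<dots> \<le> (C1 + C2) * (real t + 3) * \<rho> ^ t" using m1 m2 by (simp add: distrib_right)
      also have "\<dots> \<le> \<mu>" using t0[of t] t by simp
      finally show "measure lborel (B1 \<union> B2) \<le> \<mu>" .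
      fix x v assume x: "x \<in> {\<alpha>..\<beta>} - (B1 \<union> B2)" and v: "v \<noteq> 0" "height v \<le> 2 ^ t"
      have xJ: "x \<in> {\<alpha>..\<beta>}" using x by blast
      have hv: "height v \<le> q" using v by (simp add: q_def)
      show "(2 ^ t) powr - \<epsilon> < (2 ^ t)\<^sup>2 * \<bar>F 0 v x\<bar>"
      proof (rule ccontr)
        assume "\<not> ?thesis"
        hence "q\<^sup>2 * \<bar>F 0 v x\<bar> \<le> q powr - \<epsilon>" by (simp add: q_def)
        hence small: "\<bar>F 0 v x\<bar> \<le> e'" unfolding e'e using q1 by (simp add: pos_le_divide_eq mult.commute)
        have "\<bar>F' 0 v x\<bar> \<le> 3 * A * q" by (rule F'_bound(1)[OF xJ _ hv q1]) simp
        hence "x \<in> E 0 v e' (3 * A * q)" using small xJ by (simp add: E_def)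
        hence vV: "v \<in> V" using v hv unfolding V_def by blast
        show False
        proof (cases "\<bar>F' 0 v x\<bar> \<le> 4")
          case True
          hence "x \<in> E 0 v e' 4" using small xJ by (simp add: E_def)
          thus False using vV x unfolding B1_def by blast
        next
          case False
          hence "x \<in> Lv v" using small xJ by (simp add: Lv_def)
          thus False using vV x unfolding B2_def by blast
        qed
      qed
    qed
  qed
qed

text \<open>The derivative keeps its sign and at least half of the size D within distance d of x, so
  F changes by at least D / 2 * d to either side and the intermediate value theorem applies.\<close>

lemma root_nearby:
  assumes "\<alpha> \<le> x - d" "x + d \<le> \<beta>" "0 < d" and h: "height v \<le> H" "1 \<le> H"
    and D: "3 * A * H * d \<le> D / 2" "D \<le> \<bar>F' 1 v x\<bar>" "\<bar>F 1 v x\<bar> \<le> D / 2 * d"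
  obtains z where "\<bar>z - x\<bar> \<le> d" "F 1 v z = 0"
proof -
  interpret C2_function \<alpha> \<beta> "F 1 v" "F' 1 v" "F'' 1 v" "3 * A * H"
    by (rule C2_F) (use h in auto)
  have xJ: "x \<in> {\<alpha>..\<beta>}" using assms by auto
  have near: "\<bar>F' 1 v y - F' 1 v x\<bar> \<le> D / 2" "y \<in> {\<alpha>..\<beta>}" if "\<bar>y - x\<bar> \<le> d" for y
  proof -
    show yJ: "y \<in> {\<alpha>..\<beta>}" using that assms by auto
    have "\<bar>F' 1 v y - F' 1 v x\<bar> \<le> 3 * A * H * \<bar>y - x\<bar>" by (rule deriv_lipschitz[OF xJ yJ])
    also have "\<dots> \<le> 3 * A * H * d" using that A h by (intro mult_left_mono) auto
    finally show "\<bar>F' 1 v y - F' 1 v x\<bar> \<le> D / 2" using D by simp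
  qed
  obtain t1 where t1: "t1 \<in> {min x (x + d)..max x (x + d)}" "F 1 v (x + d) - F 1 v x = F' 1 v t1 * (x + d - x)"
    using mvt[OF xJ near(2)[of "x + d"]] assms by auto
  obtain t2 where t2: "t2 \<in> {min x (x - d)..max x (x - d)}" "F 1 v (x - d) - F 1 v x = F' 1 v t2 * (x - d - x)"
    using mvt[OF xJ near(2)[of "x - d"]] assms by auto
  have n1: "\<bar>F' 1 v t1 - F' 1 v x\<bar> \<le> D / 2" using t1 assms by (intro near) auto
  have n2: "\<bar>F' 1 v t2 - F' 1 v x\<bar> \<le> D / 2" using t2 assms by (intro near) auto
  have sub: "{x - d..x + d} \<subseteq> {\<alpha>..\<beta>}" using assms by auto
  have cont1: "continuous_on {x - d..x + d} (F 1 v)" using cont sub by (rule continuous_on_subset)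
  have "\<exists>z. x - d \<le> z \<and> z \<le> x + d \<and> F 1 v z = 0"
  proof (cases "0 \<le> F' 1 v x")
    case True
    have "D / 2 * d \<le> F' 1 v t1 * d" "D / 2 * d \<le> F' 1 v t2 * d"
      by (rule mult_right_mono; use True D n1 n2 assms(3) in linarith)+
    hence "F 1 v (x - d) \<le> 0" "0 \<le> F 1 v (x + d)" using t1(2) t2(2) D(3) by auto
    thus ?thesis using IVT'[of "F 1 v" "x - d" 0 "x + d"] cont1 assms(3) by auto
  next
    case False
    have "F' 1 v t1 * d \<le> - (D / 2) * d" "F' 1 v t2 * d \<le> - (D / 2) * d"
      by (rule mult_right_mono; use False D n1 n2 assms(3) in linarith)+
    hence "F 1 v (x + d) \<le> 0" "0 \<le> F 1 v (x - d)" using t1(2) t2(2) D(3) by auto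
    thus ?thesis using IVT2'[of "F 1 v" "x + d" 0 "x - d"] cont1 assms(3) by auto
  qed
  then obtain z where "x - d \<le> z" "z \<le> x + d" "F 1 v z = 0" by blast
  thus ?thesis by (intro that[of z]) auto
qed

text \<open>The weaker separation q powr -\<epsilon> forces short vectors of size r of order q powr
  (2 * \<epsilon>). This enlarges the height, but r cancels in |F| / |F'|, so the distance to the
  root remains of order 1 / q^3.\<close>

lemma root_near_good_point:
  obtains B where "1 \<le> B" "\<And>\<epsilon>. 0 < \<epsilon> \<Longrightarrow> \<epsilon> \<le> 1/4 \<Longrightarrow> \<exists>t0. \<forall>t\<ge>t0. \<forall>x. \<alpha> \<le> x - 4 / (2 ^ t) ^ 3 \<longrightarrow> x + 4 / (2 ^ t) ^ 3 \<le> \<beta> \<longrightarrow>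
      (\<forall>v. v \<noteq> 0 \<longrightarrow> height v \<le> 2 ^ t \<longrightarrow> (2 ^ t) powr - \<epsilon> < (2 ^ t)\<^sup>2 * \<bar>F 0 v x\<bar>) \<longrightarrow>
      (\<exists>z v. \<bar>z - x\<bar> \<le> 4 / (2 ^ t) ^ 3 \<and> F 1 v z = 0 \<and> 2 ^ t \<le> height v \<and> height v \<le> B * (2 ^ t) powr (1 + 2 * \<epsilon>))"
proof -
  obtain M where M: "3 \<le> M" "\<And>q \<kappa> r K x. x \<in> {\<alpha>..\<beta>} \<Longrightarrow> 1 \<le> q \<Longrightarrow> 0 < \<kappa> \<Longrightarrow> \<kappa> \<le> 1 \<Longrightarrow> 1 \<le> r \<Longrightarrow> r \<le> q\<^sup>2 \<Longrightarrow>
      (\<And>v. v \<noteq> 0 \<Longrightarrow> height v \<le> q \<Longrightarrow> \<kappa> < q\<^sup>2 * \<bar>F 0 v x\<bar>) \<Longrightarrow>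
      2 * r / \<kappa> \<le> real K \<Longrightarrow> 2 * (2 * real K + 1)\<^sup>2 < r ^ 3 \<Longrightarrow>
      \<exists>v. height v \<le> M * r * q \<and> r * q \<le> height v \<and> q\<^sup>2 * \<bar>F 1 v x\<bar> \<le> 2 * r \<and> r * q \<le> \<bar>F' 1 v x\<bar>"
    by (rule inhomogeneous_solution) blast
  show ?thesis
  proof (rule that[of "M * 99"])
    show "1 \<le> M * 99" using M by simp
    fix \<epsilon> :: real assume \<epsilon>: "0 < \<epsilon>" "\<epsilon> \<le> 1/4"
    obtain T where T: "\<And>t::nat. T \<le> t \<Longrightarrow> max 99 (24 * A * M) \<le> (2 ^ t) powr 1"
      by (rule eventually_le_powr[of 1 "max 99 (24 * A * M)"]) (simp, blast)
    show "\<exists>t0. \<forall>t\<ge>t0. \<forall>x. \<alpha> \<le> x - 4 / (2 ^ t) ^ 3 \<longrightarrow> x + 4 / (2 ^ t) ^ 3 \<le> \<beta> \<longrightarrow>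
      (\<forall>v. v \<noteq> 0 \<longrightarrow> height v \<le> 2 ^ t \<longrightarrow> (2 ^ t) powr - \<epsilon> < (2 ^ t)\<^sup>2 * \<bar>F 0 v x\<bar>) \<longrightarrow>
      (\<exists>z v. \<bar>z - x\<bar> \<le> 4 / (2 ^ t) ^ 3 \<and> F 1 v z = 0 \<and> 2 ^ t \<le> height v \<and> height v \<le> M * 99 * (2 ^ t) powr (1 + 2 * \<epsilon>))"
    proof (intro exI[of _ T] allI impI)
      fix t x assume t: "T \<le> t" and x: "\<alpha> \<le> x - 4 / (2 ^ t) ^ 3" "x + 4 / (2 ^ t) ^ 3 \<le> \<beta>"
        and good: "\<forall>v. v \<noteq> 0 \<longrightarrow> height v \<le> 2 ^ t \<longrightarrow> (2 ^ t) powr - \<epsilon> < (2 ^ t)\<^sup>2 * \<bar>F 0 v x\<bar>"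
      define q where "q = (2::real) ^ t"
      have q: "99 \<le> q" "24 * A * M \<le> q" using T[OF t] by (auto simp: q_def)
      define \<kappa> where "\<kappa> = q powr - \<epsilon>"
      define u where "u = q powr \<epsilon>"
      have u1: "1 \<le> u" unfolding u_def using q \<epsilon> by (intro ge_one_powr_ge_zero) auto
      have \<kappa>u: "\<kappa> = 1 / u" using q by (simp add: \<kappa>_def u_def powr_minus_divide)
      have uu: "u * u = q powr (2 * \<epsilon>)" by (simp add: u_def powr_add[symmetric])
      \<comment> \<open>The packing needs 2 * (2 * K + 1)^2 < r^3 with K of size up to 3 * r * u.
        The left side is then at most 98 * u^2 * r^2, so 99 * u^2 is large enough.\<close>
      define r where "r = 99 * (u * u)"
      have uu1: "1 \<le> u * u" using mult_mono[OF u1 u1] u1 by simp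
      have r1: "1 \<le> r" using uu1 by (simp add: r_def)
      have "u * u \<le> q powr 1" unfolding uu using q \<epsilon> by (intro powr_mono) auto
      hence "99 * (u * u) \<le> q * q" using q by (intro mult_mono) auto
      hence rq: "r \<le> q\<^sup>2" by (simp add: r_def power2_eq_square)
      define K where "K = nat \<lceil>2 * r / \<kappa>\<rceil>"
      have ru: "1 \<le> r * u" using mult_mono[OF r1 u1] u1 r1 by simp
      have K: "2 * r / \<kappa> \<le> real K" "real K \<le> 3 * (r * u)"
        unfolding K_def \<kappa>u using ru u1 by (simp_all, linarith+)
      have K3: "2 * (2 * real K + 1)\<^sup>2 < r ^ 3"
      proof -
        have "(2 * real K + 1)\<^sup>2 \<le> (7 * (r * u))\<^sup>2" using K(2) ru by (intro power_mono) auto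
        hence "2 * (2 * real K + 1)\<^sup>2 \<le> 98 * (u * u) * r\<^sup>2" by (simp add: power2_eq_square mult_ac)
        also have "\<dots> < r * r\<^sup>2" using r1 uu1 by (intro mult_strict_right_mono) (auto simp: r_def)
        finally show ?thesis by (simp add: power2_eq_square power3_eq_cube)
      qed
      \<comment> \<open>Twice the quotient of the bounds 2 * r / q^2 for |F| and r * q for |F'|,
        because only half of the derivative is guaranteed nearby.\<close>
      define d where "d = 4 / q ^ 3"
      have d: "0 < d" using q by (simp add: d_def)
      have "\<alpha> \<le> x - d" "x + d \<le> \<beta>" using x by (simp_all only: d_def q_def)
      hence xJ: "x \<in> {\<alpha>..\<beta>}" using d by simp
      have "\<exists>v. height v \<le> M * r * q \<and> r * q \<le> height v \<and> q\<^sup>2 * \<bar>F 1 v x\<bar> \<le> 2 * r \<and> r * q \<le> \<bar>F' 1 v x\<bar>"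
      proof (rule M(2)[OF xJ _ _ _ r1 rq _ K(1) K3])
        show "1 \<le> q" using q by simp
        show "0 < \<kappa>" "\<kappa> \<le> 1" using u1 by (auto simp: \<kappa>u)
        show "\<kappa> < q\<^sup>2 * \<bar>F 0 v x\<bar>" if "v \<noteq> 0" "height v \<le> q" for v
          using good that unfolding \<kappa>_def q_def by blast
      qed
      then obtain v where v: "height v \<le> M * r * q" "r * q \<le> height v" "q\<^sup>2 * \<bar>F 1 v x\<bar> \<le> 2 * r" "r * q \<le> \<bar>F' 1 v x\<bar>" by blast
      have rq1: "1 \<le> r * q" using mult_mono[OF r1, of 1 q] q r1 by simp
      obtain z where z: "\<bar>z - x\<bar> \<le> d" "F 1 v z = 0"
      proof (rule root_nearby[of x d v "M * r * q" "r * q"])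
        show "\<alpha> \<le> x - d" "x + d \<le> \<beta>" using x by (simp_all add: d_def q_def)
        have "1 * 1 \<le> M * (r * q)" using M(1) rq1 by (intro mult_mono) auto
        thus "1 \<le> M * r * q" by (simp add: mult.assoc)
        have "24 * A * M * 1 \<le> q * q\<^sup>2" using q A M(1) by (intro mult_mono) (auto simp: one_le_power)
        hence "24 * A * M / q ^ 3 \<le> 1" using q by (simp add: power2_eq_square power3_eq_cube)
        hence "(r * q / 2) * (24 * A * M / q ^ 3) \<le> (r * q / 2) * 1" using rq1 by (intro mult_left_mono) auto
        thus "3 * A * (M * r * q) * d \<le> r * q / 2" by (simp add: d_def mult_ac)
        have "\<bar>F 1 v x\<bar> \<le> 2 * r / q\<^sup>2" using v(3) q by (simp add: pos_le_divide_eq mult.commute)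
        also have "2 * r / q\<^sup>2 = r * q / 2 * d" using q by (simp add: d_def power2_eq_square power3_eq_cube)
        finally show "\<bar>F 1 v x\<bar> \<le> r * q / 2 * d" .
      qed (use d v in auto)
      have "1 * q \<le> r * q" using r1 q by (intro mult_right_mono) auto
      hence "q \<le> height v" using v(2) by simp
      moreover have "M * r * q = M * 99 * q powr (1 + 2 * \<epsilon>)"
        using q by (simp add: r_def uu powr_add)
      hence "height v \<le> M * 99 * q powr (1 + 2 * \<epsilon>)" using v(1) by (simp only:)
      ultimately show "\<exists>z v. \<bar>z - x\<bar> \<le> 4 / (2 ^ t) ^ 3 \<and> F 1 v z = 0 \<and> 2 ^ t \<le> height v \<and> height v \<le> M * 99 * (2 ^ t) powr (1 + 2 * \<epsilon>)"
        using z unfolding d_def q_def by blast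
    qed
  qed
qed

text \<open>Balls of radius about q0^(-\<tau>-1) around roots at separation about q^(-3) satisfy
  \<open>L * \<rho> \<le> r powr s\<close> once q^(-3) is small against q0^(-\<sigma>), where
  \<sigma> = s * (\<tau> + 1). Since \<sigma> < 3, this survives the loss from q0 being as large as
  q^(1 + 2 * \<epsilon>), for every constant L.\<close>

lemma hcontent_A2_pos:
  assumes s: "0 < s" "s \<le> 1" and \<tau>: "2 \<le> \<tau>" and s\<tau>: "s * (\<tau> + 1) < 3"
    and anti: "antimono_on {0<..} \<psi>" and freq: "\<And>N. \<exists>q\<ge>N. q powr - \<tau> \<le> \<psi> q"
  shows "hcontent s (A2 {\<alpha>..\<beta>} f1 f2 \<psi> l) \<noteq> 0"
proof -
  define \<sigma> where "\<sigma> = s * (\<tau> + 1)"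
  have \<sigma>: "0 < \<sigma>" "\<sigma> < 3" using s \<tau> s\<tau> by (auto simp: \<sigma>_def)
  \<comment> \<open>The second term gives (1 + 2 * \<epsilon>) * \<sigma> < 3; the bound 1/4 is
    required by \<open>root_near_good_point\<close>.\<close>
  define \<epsilon> where "\<epsilon> = min (1/4) ((3 - \<sigma>) / (4 * \<sigma>))"
  have \<epsilon>: "0 < \<epsilon>" "\<epsilon> \<le> 1/4" using \<sigma> by (auto simp: \<epsilon>_def)
  define \<sigma>' where "\<sigma>' = (1 + 2 * \<epsilon>) * \<sigma>"
  have \<sigma>': "\<sigma>' < 3" "0 < \<sigma>'"
  proof -
    have "2 * \<epsilon> * \<sigma> \<le> 2 * ((3 - \<sigma>) / (4 * \<sigma>)) * \<sigma>" using \<sigma> by (intro mult_right_mono mult_left_mono) (auto simp: \<epsilon>_def)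
    also have "\<dots> = (3 - \<sigma>) / 2" using \<sigma> by (simp add: field_simps)
    finally show "\<sigma>' < 3" using \<sigma> by (simp add: \<sigma>'_def distrib_right)
    show "0 < \<sigma>'" using \<sigma> \<epsilon> by (simp add: \<sigma>'_def)
  qed
  obtain B where B: "1 \<le> B" "\<And>\<epsilon>. 0 < \<epsilon> \<Longrightarrow> \<epsilon> \<le> 1/4 \<Longrightarrow> \<exists>t0. \<forall>t\<ge>t0. \<forall>x. \<alpha> \<le> x - 4 / (2 ^ t) ^ 3 \<longrightarrow> x + 4 / (2 ^ t) ^ 3 \<le> \<beta> \<longrightarrow>
      (\<forall>v. v \<noteq> 0 \<longrightarrow> height v \<le> 2 ^ t \<longrightarrow> (2 ^ t) powr - \<epsilon> < (2 ^ t)\<^sup>2 * \<bar>F 0 v x\<bar>) \<longrightarrow>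
      (\<exists>z v. \<bar>z - x\<bar> \<le> 4 / (2 ^ t) ^ 3 \<and> F 1 v z = 0 \<and> 2 ^ t \<le> height v \<and> height v \<le> B * (2 ^ t) powr (1 + 2 * \<epsilon>))"
    by (rule root_near_good_point) blast
  obtain T1 where T1: "\<forall>t\<ge>T1. \<forall>x. \<alpha> \<le> x - 4 / (2 ^ t) ^ 3 \<longrightarrow> x + 4 / (2 ^ t) ^ 3 \<le> \<beta> \<longrightarrow>
      (\<forall>v. v \<noteq> 0 \<longrightarrow> height v \<le> 2 ^ t \<longrightarrow> (2 ^ t) powr - \<epsilon> < (2 ^ t)\<^sup>2 * \<bar>F 0 v x\<bar>) \<longrightarrow>
      (\<exists>z v. \<bar>z - x\<bar> \<le> 4 / (2 ^ t) ^ 3 \<and> F 1 v z = 0 \<and> 2 ^ t \<le> height v \<and> height v \<le> B * (2 ^ t) powr (1 + 2 * \<epsilon>))"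
    using B(2)[OF \<epsilon>] by blast
  \<comment> \<open>The index is a lower bound for the height, so belonging to infinitely many W n
    means having solutions of unbounded height.\<close>
  define W where "W n = {x\<in>{\<alpha>..\<beta>}. \<exists>v. real n \<le> height v \<and> \<bar>F 1 v x\<bar> < \<psi> (height v)}" for n :: nat
  have "hcontent s {x\<in>{\<alpha>..\<beta>}. infinite {n. x \<in> W n}} \<noteq> 0"
  proof (rule limsup_hcontent_pos[of \<alpha> \<beta> s "1/8"])
    fix a b L \<eta> :: real and N :: nat
    assume ab': "\<alpha> \<le> a" "a < b" "b \<le> \<beta>" and \<eta>: "0 < \<eta>" and L: "0 < L"
    \<comment> \<open>Two margins of (b - a) / 8 keep the roots inside {a..b}. The bad set removes
      at most (b - a) / 4 of the rest, so intervals of length 4 * \<rho> around the chosen roots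
      cover at least (b - a) / 2, which gives the constant 1/8.\<close>
    define w where "w = (b - a) / 8"
    have w: "0 < w" using ab' by (simp add: w_def)
    have "0 < (b - a) / 4" using ab' by simp
    then obtain T2 where T2: "\<And>t. T2 \<le> t \<Longrightarrow> \<exists>Bd. Bd \<in> fmeasurable lborel \<and> measure lborel Bd \<le> (b - a) / 4 \<and>
      (\<forall>x\<in>{\<alpha>..\<beta>} - Bd. \<forall>v. v \<noteq> 0 \<longrightarrow> height v \<le> 2 ^ t \<longrightarrow> (2 ^ t) powr - \<epsilon> < (2 ^ t)\<^sup>2 * \<bar>F 0 v x\<bar>)"
      using good_points[OF \<epsilon>(1)] by blast
    obtain T3 where T3: "\<And>t::nat. T3 \<le> t \<Longrightarrow> 4 * L * (6 * A * (B ^ 3 * 8)) \<le> (2 ^ t) powr (3 - \<sigma>')"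
      using eventually_le_powr[of "3 - \<sigma>'"] \<sigma>' by auto
    obtain T4 where T4: "\<And>t::nat. T4 \<le> t \<Longrightarrow> max (real N) (max (4 / \<eta>) (8 / w)) \<le> (2 ^ t) powr 1"
      by (rule eventually_le_powr[of 1 "max (real N) (max (4 / \<eta>) (8 / w))"]) (simp, blast)
    define T where "T = max (max T1 T2) (max T3 T4)"
    obtain q0 where q0: "B * (2 ^ T) powr (1 + 2 * \<epsilon>) \<le> q0" "q0 powr - \<tau> \<le> \<psi> q0" using freq by blast
    \<comment> \<open>Solves \<open>B * y powr (1 + 2 * \<epsilon>) = q0\<close>. The lower bound
      for \<psi> is known only at arguments q0 that may be sparse, so the dyadic level is fitted to
      q0 and not conversely.\<close>
    define y where "y = (q0 / B) powr (1 / (1 + 2 * \<epsilon>))"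
    have "(2 ^ T) powr (1 + 2 * \<epsilon>) \<le> q0 / B" using q0(1) B by (simp add: pos_le_divide_eq mult.commute)
    hence "((2 ^ T) powr (1 + 2 * \<epsilon>)) powr (1 / (1 + 2 * \<epsilon>)) \<le> y"
      unfolding y_def using \<epsilon> by (intro powr_mono2) auto
    hence yT: "2 ^ T \<le> y" using \<epsilon> by (simp add: powr_powr)
    have y1: "1 \<le> y" using yT one_le_power[of "2::real" T] by linarith
    obtain t where t: "2 ^ t \<le> y" "y < 2 * 2 ^ t" using dyadic_level[OF y1] .
    have tT: "T \<le> t"
    proof -
      have "(2::real) ^ T < 2 ^ Suc t" using yT t by simp
      hence "T < Suc t" by (rule power_less_imp_less_exp[rotated]) simp
      thus ?thesis by simp
    qed
    define q where "q = (2::real) ^ t"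
    have q1: "1 \<le> q" by (simp add: q_def)
    have q0pos: "0 < q0" using q0(1) B by (smt (verit) mult_pos_pos powr_gt_zero zero_less_power)
    have yy: "y powr (1 + 2 * \<epsilon>) = q0 / B" unfolding y_def using \<epsilon> q0pos B by (simp add: powr_powr)
    have H: "B * q powr (1 + 2 * \<epsilon>) \<le> q0"
    proof -
      have "q powr (1 + 2 * \<epsilon>) \<le> y powr (1 + 2 * \<epsilon>)" using t \<epsilon> q1 by (intro powr_mono2) (auto simp: q_def)
      thus ?thesis unfolding yy using B by (simp add: pos_le_divide_eq mult.commute)
    qed
    have H': "q0 \<le> B * (2 * q) powr (1 + 2 * \<epsilon>)"
    proof -
      have "y powr (1 + 2 * \<epsilon>) \<le> (2 * q) powr (1 + 2 * \<epsilon>)" using t \<epsilon> y1 by (intro powr_mono2) (auto simp: q_def)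
      thus ?thesis unfolding yy using B by (simp add: pos_divide_le_eq mult.commute)
    qed
    have qq0: "q \<le> q0"
    proof -
      have "1 * q powr 1 \<le> B * q powr (1 + 2 * \<epsilon>)" using B q1 \<epsilon> by (intro mult_mono powr_mono) auto
      thus ?thesis using H q1 by simp
    qed
    have qN: "real N \<le> q" "4 / \<eta> \<le> q" "8 / w \<le> q" using T4[of t] tT by (auto simp: T_def q_def)
    define \<rho> where "\<rho> = 4 / q ^ 3"
    have \<rho>: "0 < \<rho>" "\<rho> \<le> 4 / q"
    proof -
      show "0 < \<rho>" using q1 by (simp add: \<rho>_def)
      have "q ^ 1 \<le> q ^ 3" using q1 by (intro power_increasing) auto
      thus "\<rho> \<le> 4 / q" unfolding \<rho>_def using q1 by (intro divide_left_mono) auto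
    qed
    have \<rho>\<eta>: "\<rho> \<le> \<eta>"
    proof -
      have "4 / q \<le> \<eta>" using qN(2) \<eta> q1 by (simp add: field_simps)
      thus ?thesis using \<rho> by simp
    qed
    have \<rho>w: "2 * \<rho> \<le> w"
    proof -
      have "2 * (4 / q) \<le> w" using qN(3) w q1 by (simp add: field_simps)
      thus ?thesis using \<rho> by simp
    qed
    \<comment> \<open>The derivative is at most 3 * A * q0, so within r of a root the form stays
      below half of q0 powr -\<tau>.\<close>
    define r where "r = q0 powr (- \<tau> - 1) / (6 * A)"
    have r0: "0 < r" using q0pos A by (simp add: r_def)
    have r\<rho>: "r \<le> \<rho>"
    proof -
      have "r \<le> q0 powr (- \<tau> - 1) / 1" unfolding r_def using A by (intro divide_left_mono) auto
      also have "\<dots> \<le> q0 powr - 3" using q1 qq0 \<tau> by (simp add: powr_mono)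
      also have "\<dots> \<le> q powr - 3" using q1 qq0 by (intro powr_mono2') auto
      also have "\<dots> = 1 / q ^ 3" using q1 by (simp add: powr_minus_divide powr_numeral)
      also have "\<dots> \<le> \<rho>" unfolding \<rho>_def using q1 by (intro divide_right_mono) auto
      finally show ?thesis .
    qed
    have Lr: "L * \<rho> \<le> r powr s"
    proof -
      have "q0 powr - \<sigma> \<ge> (B * (2 * q) powr (1 + 2 * \<epsilon>)) powr - \<sigma>"
        using H' q0pos \<sigma> by (intro powr_mono2') auto
      moreover have "(B * (2 * q) powr (1 + 2 * \<epsilon>)) powr - \<sigma> = B powr - \<sigma> * (2 powr - \<sigma>' * q powr - \<sigma>')"
        by (simp add: powr_mult powr_powr \<sigma>'_def)
      moreover have "1 / B ^ 3 * (1 / 8 * q powr - \<sigma>') \<le> B powr - \<sigma> * (2 powr - \<sigma>' * q powr - \<sigma>')"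
      proof (intro mult_mono)
        have "B powr - 3 \<le> B powr - \<sigma>" using B \<sigma> by (intro powr_mono) auto
        thus "1 / B ^ 3 \<le> B powr - \<sigma>" using B by (simp add: powr_minus_divide powr_numeral)
        have "2 powr - 3 \<le> (2::real) powr - \<sigma>'" using \<sigma>' by (intro powr_mono) auto
        thus "1 / 8 \<le> (2::real) powr - \<sigma>'" by (simp add: powr_minus_divide)
      qed (use B in auto)
      ultimately have q0s: "q0 powr - \<sigma> \<ge> 1 / (B ^ 3 * 8) * q powr - \<sigma>'" by (simp add: field_simps)
      have "r powr s = (q0 powr (- \<tau> - 1)) powr s / (6 * A) powr s" unfolding r_def using A by (simp add: powr_divide)
      also have "(q0 powr (- \<tau> - 1)) powr s = q0 powr - \<sigma>" 
      proof -
        have "(- \<tau> - 1) * s = - \<sigma>" by (simp add: \<sigma>_def algebra_simps)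
        thus ?thesis by (simp only: powr_powr)
      qed
      finally have rs: "r powr s = q0 powr - \<sigma> / (6 * A) powr s" .
      have "(6 * A) powr s \<le> (6 * A) powr 1" using A s by (intro powr_mono) auto
      hence "q0 powr - \<sigma> / (6 * A) \<le> r powr s" unfolding rs using A by (intro divide_left_mono) auto
      moreover have "1 / (B ^ 3 * 8) * q powr - \<sigma>' / (6 * A) \<le> q0 powr - \<sigma> / (6 * A)"
        using q0s A by (intro divide_right_mono) auto
      moreover have "L * \<rho> \<le> 1 / (B ^ 3 * 8) * q powr - \<sigma>' / (6 * A)"
      proof -
        have "4 * L * (6 * A * (B ^ 3 * 8)) \<le> q powr (3 - \<sigma>')" using T3[of t] tT by (simp add: T_def q_def)
        also have "\<dots> = q powr 3 * q powr - \<sigma>'" by (simp add: powr_add[symmetric])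
        also have "q powr 3 = q ^ 3" using q1 by (simp add: powr_numeral)
        finally have *: "4 * L * (6 * A * (B ^ 3 * 8)) \<le> q ^ 3 * q powr - \<sigma>'" .
        have pos: "0 < 6 * A * (B ^ 3 * 8)" using A B by simp
        have "4 * L / q ^ 3 \<le> q powr - \<sigma>' / (6 * A * (B ^ 3 * 8))"
          using * pos q1 by (simp add: pos_divide_le_eq pos_le_divide_eq mult_ac)
        thus ?thesis by (simp add: \<rho>_def mult_ac)
      qed
      ultimately show ?thesis by linarith
    qed
    obtain Bd where Bd: "Bd \<in> fmeasurable lborel" "measure lborel Bd \<le> (b - a) / 4"
      "\<And>x v. x \<in> {\<alpha>..\<beta>} - Bd \<Longrightarrow> v \<noteq> 0 \<Longrightarrow> height v \<le> 2 ^ t \<Longrightarrow> (2 ^ t) powr - \<epsilon> < (2 ^ t)\<^sup>2 * \<bar>F 0 v x\<bar>"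
      using T2[of t] tT by (auto simp: T_def)
    define Z where "Z = {z\<in>{a + r..b - r}. \<exists>v. q \<le> height v \<and> height v \<le> q0 \<and> F 1 v z = 0}"
    have Zsub: "Z \<subseteq> {a + r..b - r}" by (auto simp: Z_def)
    obtain X where X: "finite X" "X \<subseteq> Z" "\<forall>x\<in>X. \<forall>y\<in>X. x \<noteq> y \<longrightarrow> \<rho> \<le> \<bar>x - y\<bar>"
      "\<And>z. z \<in> Z \<Longrightarrow> \<exists>x\<in>X. \<bar>z - x\<bar> < \<rho>"
      using maximal_separated[OF Zsub \<rho>(1)] by meson
    have cover: "{a + w..b - w} \<subseteq> Bd \<union> (\<Union>x\<in>X. {x - 2 * \<rho>..x + 2 * \<rho>})"
    proof
      fix x assume x: "x \<in> {a + w..b - w}"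
      show "x \<in> Bd \<union> (\<Union>x\<in>X. {x - 2 * \<rho>..x + 2 * \<rho>})"
      proof (cases "x \<in> Bd")
        case False
        have xJ: "x \<in> {\<alpha>..\<beta>} - Bd" using x w ab' False by auto
        have "\<alpha> \<le> x - \<rho>" "x + \<rho> \<le> \<beta>" using x \<rho>w \<rho> ab' by auto
        hence lo: "\<alpha> \<le> x - 4 / (2 ^ t) ^ 3" and hi: "x + 4 / (2 ^ t) ^ 3 \<le> \<beta>"
          by (simp_all only: \<rho>_def q_def)
        have "T1 \<le> t" using tT by (simp add: T_def)
        from T1[rule_format, OF this lo hi Bd(3)[OF xJ]] obtain z v where z: "\<bar>z - x\<bar> \<le> 4 / (2 ^ t) ^ 3" "F 1 v z = 0" "2 ^ t \<le> height v"
          "height v \<le> B * (2 ^ t) powr (1 + 2 * \<epsilon>)"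
          by blast
        have zx: "\<bar>z - x\<bar> \<le> \<rho>" using z(1) by (simp add: \<rho>_def q_def)
        have "z \<in> {a + r..b - r}" using zx x \<rho>w r\<rho> by auto
        hence "z \<in> Z" using z H unfolding Z_def q_def by (blast intro: order_trans)
        then obtain x' where "x' \<in> X" "\<bar>z - x'\<bar> < \<rho>" using X(4) by blast
        hence "x \<in> {x' - 2 * \<rho>..x' + 2 * \<rho>}" using zx by auto
        thus ?thesis using \<open>x' \<in> X\<close> by blast
      qed blast
    qed
    have cardX: "1/8 * (b - a) \<le> real (card X) * \<rho>"
    proof -
      have fm: "(\<Union>x\<in>X. {x - 2 * \<rho>..x + 2 * \<rho>}) \<in> fmeasurable lborel"
        using X(1) by (intro fmeasurable_compact compact_UN) auto
      have "measure lborel {a + w..b - w} \<le> measure lborel (Bd \<union> (\<Union>x\<in>X. {x - 2 * \<rho>..x + 2 * \<rho>}))"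
        by (rule measure_mono_fmeasurable[OF cover]) (use Bd fm in auto)
      also have "\<dots> \<le> measure lborel Bd + measure lborel (\<Union>x\<in>X. {x - 2 * \<rho>..x + 2 * \<rho>})"
        using Bd fm by (intro measure_Un_le) auto
      also have "measure lborel (\<Union>x\<in>X. {x - 2 * \<rho>..x + 2 * \<rho>}) \<le> (\<Sum>x\<in>X. measure lborel {x - 2 * \<rho>..x + 2 * \<rho>})"
        using X(1) by (intro measure_UNION_le) auto
      also have "\<dots> = real (card X) * (4 * \<rho>)" using \<rho> by simp
      finally have "measure lborel {a + w..b - w} \<le> measure lborel Bd + real (card X) * (4 * \<rho>)" by simp
      moreover have ww: "b - a = 8 * w" by (simp add: w_def)
      hence "a + w \<le> b - w" using w by linarith
      hence "measure lborel {a + w..b - w} = b - w - (a + w)" by simp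
      ultimately have "b - w - (a + w) \<le> (b - a) / 4 + real (card X) * (4 * \<rho>)" using Bd(2) by linarith
      thus ?thesis using ww by simp
    qed
    have balls: "{x - r..x + r} \<subseteq> {a..b} \<inter> W N" if xX: "x \<in> X" for x
    proof
      fix u assume u: "u \<in> {x - r..x + r}"
      obtain v where v: "q \<le> height v" "height v \<le> q0" "F 1 v x = 0" and x: "x \<in> {a + r..b - r}"
        using xX X(2) unfolding Z_def by blast
      have uab: "u \<in> {a..b}" using u x by auto
      have uJ: "u \<in> {\<alpha>..\<beta>}" and xJ: "x \<in> {\<alpha>..\<beta>}" using uab x r0 ab' by auto
      interpret C2_function \<alpha> \<beta> "F 1 v" "F' 1 v" "F'' 1 v" "3 * A * q0"
        by (rule C2_F) (use v q1 in auto)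
      obtain y where y: "y \<in> {min x u..max x u}" "F 1 v u - F 1 v x = F' 1 v y * (u - x)"
        using mvt[OF xJ uJ] by blast
      have yJ: "y \<in> {\<alpha>..\<beta>}" using y(1) uJ xJ by auto
      have "\<bar>F' 1 v y\<bar> \<le> 3 * A * q0" by (rule F'_bound(1)[OF yJ]) (use v q1 in auto)
      moreover have "\<bar>u - x\<bar> \<le> r" using u by auto
      ultimately have "\<bar>F' 1 v y * (u - x)\<bar> \<le> 3 * A * q0 * r"
        unfolding abs_mult using A q0pos by (intro mult_mono) auto
      also have "3 * A * q0 * r = q0 powr (- \<tau>) / 2"
      proof -
        have "q0 * q0 powr (- \<tau> - 1) = q0 powr 1 * q0 powr (- \<tau> - 1)" using q0pos by simp
        also have "\<dots> = q0 powr (1 + (- \<tau> - 1))" by (rule powr_add[symmetric])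
        also have "1 + (- \<tau> - 1) = - \<tau>" by simp
        finally show ?thesis using A by (simp add: r_def)
      qed
      also have "\<dots> < q0 powr - \<tau>" using q0pos by simp
      also have "\<dots> \<le> \<psi> q0" by (rule q0(2))
      \<comment> \<open>The height found may be smaller than q0; monotonicity carries the lower
        bound at q0 over to it.\<close>
      also have "\<dots> \<le> \<psi> (height v)"
        using anti v q1 q0pos by (auto simp: monotone_on_def)
      finally have "\<bar>F 1 v u\<bar> < \<psi> (height v)" using y(2) v(3) by simp
      moreover have "real N \<le> height v" using v(1) qN(1) by simp
      ultimately have "u \<in> W N" using uJ unfolding W_def by blast
      thus "u \<in> {a..b} \<inter> W N" using uab by blast
    qed
    show "\<exists>n\<ge>N. \<exists>\<rho> r X. 0 < r \<and> r \<le> \<rho> \<and> r \<le> \<eta> \<and> finite X \<and>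
        (\<forall>x\<in>X. {x - r..x + r} \<subseteq> {a..b} \<inter> W n) \<and>
        (\<forall>x\<in>X. \<forall>y\<in>X. x \<noteq> y \<longrightarrow> \<rho> \<le> \<bar>x - y\<bar>) \<and>
        1/8 * (b - a) \<le> real (card X) * \<rho> \<and> L * \<rho> \<le> r powr s"
    proof -
      have "r \<le> \<eta>" using r\<rho> \<rho>\<eta> by simp
      moreover have "\<forall>x\<in>X. {x - r..x + r} \<subseteq> {a..b} \<inter> W N" using balls by blast
      ultimately have "0 < r \<and> r \<le> \<rho> \<and> r \<le> \<eta> \<and> finite X \<and>
        (\<forall>x\<in>X. {x - r..x + r} \<subseteq> {a..b} \<inter> W N) \<and>
        (\<forall>x\<in>X. \<forall>y\<in>X. x \<noteq> y \<longrightarrow> \<rho> \<le> \<bar>x - y\<bar>) \<and>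
        1/8 * (b - a) \<le> real (card X) * \<rho> \<and> L * \<rho> \<le> r powr s"
        using r0 r\<rho> X(1,3) cardX Lr by (intro conjI)
      thus ?thesis by (meson order_refl)
    qed
  qed (use ab s in auto)
  moreover have "{x\<in>{\<alpha>..\<beta>}. infinite {n. x \<in> W n}} \<subseteq> A2 {\<alpha>..\<beta>} f1 f2 \<psi> l"
  proof
    fix x assume x: "x \<in> {x\<in>{\<alpha>..\<beta>}. infinite {n. x \<in> W n}}"
    define S where "S = {a :: int \<times> int. a \<noteq> (0, 0) \<and>
       infdist (of_int (fst a) * f1 x + of_int (snd a) * f2 x + l x) \<int> < \<psi> (of_int (max \<bar>fst a\<bar> \<bar>snd a\<bar>))}"
    have "infinite S"
    proof
      assume fin: "finite S"
      define g where "g a = nat (max \<bar>fst a\<bar> \<bar>snd a\<bar>)" for a :: "int \<times> int"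
      obtain N where N: "\<And>a. a \<in> S \<Longrightarrow> g a \<le> N" using fin finite_nat_set_iff_bounded_le[of "g ` S"] by auto
      have "\<exists>n\<ge>Suc N. x \<in> W n" using x by (auto simp: infinite_nat_iff_unbounded_le)
      then obtain n v where n: "Suc N \<le> n" and v: "real n \<le> height v" "\<bar>F 1 v x\<bar> < \<psi> (height v)" unfolding W_def by blast
      obtain a b p where vv: "v = (a, b, p)" by (cases v)
      have h: "height v = of_int (max \<bar>a\<bar> \<bar>b\<bar>)" by (simp add: vv height_def)
      have big: "int (Suc N) \<le> max \<bar>a\<bar> \<bar>b\<bar>" using v(1) n unfolding h by linarith
      have "\<bar>(of_int a * f1 x + of_int b * f2 x + l x) + of_int p\<bar> < \<psi> (of_int (max \<bar>a\<bar> \<bar>b\<bar>))"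
        using v(2) unfolding h by (simp add: F_def vv algebra_simps)
      hence "(a, b) \<in> S" using big by (auto simp: S_def infdist_Ints_less_iff)
      from N[OF this] show False using big by (simp add: g_def)
    qed
    thus "x \<in> A2 {\<alpha>..\<beta>} f1 f2 \<psi> l" using x by (simp add: A2_def S_def)
  qed
  hence "hcontent s {x\<in>{\<alpha>..\<beta>}. infinite {n. x \<in> W n}} \<le> hcontent s (A2 {\<alpha>..\<beta>} f1 f2 \<psi> l)" by (rule hcontent_mono)
  ultimately show ?thesis by auto
qed

end

section \<open>Localisation\<close>

lemma C2_on_deriv:
  assumes "C2_on I f" "x \<in> interior I"
  shows "(f has_real_derivative deriv_in I f x) (at x)"
    "(deriv_in I f has_real_derivative deriv_in I (deriv_in I f) x) (at x)"
    "isCont (deriv_in I (deriv_in I f)) x"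
proof -
  have x: "x \<in> I" "at x within I = at x" using assms(2) interior_subset at_within_interior by auto
  have "g differentiable_on I \<Longrightarrow> (g has_real_derivative deriv_in I g x) (at x)" for g
    using x unfolding differentiable_on_def deriv_in_def has_real_derivative_iff_has_vector_derivative
    by (metis vector_derivative_works)
  thus "(f has_real_derivative deriv_in I f x) (at x)"
    "(deriv_in I f has_real_derivative deriv_in I (deriv_in I f) x) (at x)"
    using assms(1) unfolding C2_on_def by blast+
  show "isCont (deriv_in I (deriv_in I f)) x"
    using assms continuous_on_interior unfolding C2_on_def by blast
qed

text \<open>By Cramer's rule the two forms u * f1' + v * f2' and u * f1'' + v * f2'' at x0 determine
  (u, v) with denominator the Wronskian, so one of them is at least 2 * c * max |u| |v|. On an
  interval where all functions vary by less than c / 2 that form keeps half of its size, uniformly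
  in (u, v).\<close>

lemma exists_arc:
  assumes smooth: "C2_on I f1" "C2_on I f2" "C2_on I \<Lambda>" and x0: "x0 \<in> interior I"
    and nd: "nondegenerate_at I f1 f2 x0" and d0: "deriv_in I f1 x0 \<noteq> 0"
  obtains \<alpha> \<beta> c A where "\<alpha> < x0" "x0 < \<beta>" "{\<alpha>..\<beta>} \<subseteq> interior I"
    "arc \<alpha> \<beta> f1 (deriv_in I f1) (deriv_in I (deriv_in I f1)) f2 (deriv_in I f2) (deriv_in I (deriv_in I f2))
      \<Lambda> (deriv_in I \<Lambda>) (deriv_in I (deriv_in I \<Lambda>)) c A"
proof -
  define D1 where "D1 = deriv_in I f1"
  define E1 where "E1 = deriv_in I D1"
  define D2 where "D2 = deriv_in I f2"
  define E2 where "E2 = deriv_in I D2"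
  define D3 where "D3 = deriv_in I \<Lambda>"
  define E3 where "E3 = deriv_in I D3"
  note der1 = C2_on_deriv[OF smooth(1), folded D1_def E1_def]
  note der2 = C2_on_deriv[OF smooth(2), folded D2_def E2_def]
  note der3 = C2_on_deriv[OF smooth(3), folded D3_def E3_def]
  define w where "w = D1 x0 * E2 x0 - D2 x0 * E1 x0"
  have w: "w \<noteq> 0" using nd by (simp add: nondegenerate_at_def w_def D1_def E1_def D2_def E2_def)
  define B where "B = \<bar>D1 x0\<bar> + \<bar>D2 x0\<bar> + \<bar>E1 x0\<bar> + \<bar>E2 x0\<bar>"
  have B: "0 < B" using d0 by (simp add: B_def D1_def add_pos_nonneg)
  define c where "c = min (min 1 (\<bar>D1 x0\<bar> / 2)) (\<bar>w\<bar> / (4 * B))"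
  have c: "0 < c" "c \<le> 1" "2 * c \<le> \<bar>D1 x0\<bar>" "c \<le> \<bar>w\<bar> / (4 * B)"
    using w B d0 by (auto simp: c_def D1_def)
  have big: "2 * c * max \<bar>u\<bar> \<bar>v\<bar> \<le> max \<bar>u * D1 x0 + v * D2 x0\<bar> \<bar>u * E1 x0 + v * E2 x0\<bar>" for u v
  proof -
    define X where "X = u * D1 x0 + v * D2 x0"
    define Y where "Y = u * E1 x0 + v * E2 x0"
    define m where "m = max \<bar>X\<bar> \<bar>Y\<bar>"
    have m: "\<bar>X\<bar> \<le> m" "\<bar>Y\<bar> \<le> m" "0 \<le> m" by (auto simp: m_def)
    have prod: "\<bar>a * X - b * Y\<bar> \<le> 2 * B * m" if "\<bar>a\<bar> \<le> B" "\<bar>b\<bar> \<le> B" for a b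
    proof -
      have "\<bar>a * X\<bar> \<le> B * m" "\<bar>b * Y\<bar> \<le> B * m" unfolding abs_mult using that m B by (auto intro!: mult_mono)
      thus ?thesis by linarith
    qed
    have "\<bar>u * w\<bar> \<le> 2 * B * m"
    proof -
      have "u * w = E2 x0 * X - D2 x0 * Y" by (simp add: w_def X_def Y_def algebra_simps)
      thus ?thesis using prod[of "E2 x0" "D2 x0"] by (simp add: B_def)
    qed
    moreover have "\<bar>v * w\<bar> \<le> 2 * B * m"
    proof -
      have "v * w = - (E1 x0 * X - D1 x0 * Y)" by (simp add: w_def X_def Y_def algebra_simps)
      hence "\<bar>v * w\<bar> = \<bar>E1 x0 * X - D1 x0 * Y\<bar>" by (simp only: abs_minus_cancel)
      thus ?thesis using prod[of "E1 x0" "D1 x0"] by (simp add: B_def)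
    qed
    ultimately have "max \<bar>u\<bar> \<bar>v\<bar> * \<bar>w\<bar> \<le> 2 * B * m" by (auto simp: max_def abs_mult)
    hence "max \<bar>u\<bar> \<bar>v\<bar> * (\<bar>w\<bar> / (2 * B)) \<le> m" using B by (simp add: field_simps)
    moreover have "max \<bar>u\<bar> \<bar>v\<bar> * (2 * c) \<le> max \<bar>u\<bar> \<bar>v\<bar> * (\<bar>w\<bar> / (2 * B))"
      using c(4) B by (intro mult_left_mono) (auto simp: field_simps)
    ultimately show ?thesis unfolding m_def X_def Y_def by (simp add: mult.commute)
  qed
  have ev: "eventually (\<lambda>x. \<bar>g x - g x0\<bar> < c / 2) (nhds x0)" if "isCont g x0" for g :: "real \<Rightarrow> real"
  proof -
    have "(g \<longlongrightarrow> g x0) (nhds x0)" using that by (simp add: isCont_def tendsto_at_iff_tendsto_nhds)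
    from tendstoD[OF this, of "c / 2"] show ?thesis using c by (simp add: dist_real_def)
  qed
  note isc = DERIV_isCont[OF der1(1)[OF x0]] DERIV_isCont[OF der1(2)[OF x0]] der1(3)[OF x0]
    DERIV_isCont[OF der2(1)[OF x0]] DERIV_isCont[OF der2(2)[OF x0]] der2(3)[OF x0]
    DERIV_isCont[OF der3(1)[OF x0]] DERIV_isCont[OF der3(2)[OF x0]] der3(3)[OF x0]
  define P where "P x \<longleftrightarrow> x \<in> interior I \<and>
     \<bar>f1 x - f1 x0\<bar> < c / 2 \<and> \<bar>D1 x - D1 x0\<bar> < c / 2 \<and> \<bar>E1 x - E1 x0\<bar> < c / 2 \<and>
     \<bar>f2 x - f2 x0\<bar> < c / 2 \<and> \<bar>D2 x - D2 x0\<bar> < c / 2 \<and> \<bar>E2 x - E2 x0\<bar> < c / 2 \<and>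
     \<bar>\<Lambda> x - \<Lambda> x0\<bar> < c / 2 \<and> \<bar>D3 x - D3 x0\<bar> < c / 2 \<and> \<bar>E3 x - E3 x0\<bar> < c / 2" for x
  have "eventually P (nhds x0)"
    unfolding P_def by (intro eventually_conj ev isc eventually_nhds_in_open x0 open_interior)
  then obtain d where d: "0 < d" "\<And>x. \<bar>x - x0\<bar> < d \<Longrightarrow> P x"
    by (auto simp: eventually_nhds_metric dist_real_def)
  define e where "e = min (d / 2) (1/2)"
  have e: "0 < e" "e < d" "e \<le> 1/2" using d by (auto simp: e_def)
  define \<alpha> where "\<alpha> = x0 - e"
  define \<beta> where "\<beta> = x0 + e"
  have J: "P x" if "x \<in> {\<alpha>..\<beta>}" for x using that e by (intro d) (auto simp: \<alpha>_def \<beta>_def)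
  have Jint: "x \<in> interior I" if "x \<in> {\<alpha>..\<beta>}" for x using J[OF that] by (simp add: P_def)
  define A where "A = 1 + (\<bar>f1 x0\<bar> + \<bar>D1 x0\<bar> + \<bar>E1 x0\<bar> + \<bar>f2 x0\<bar> + \<bar>D2 x0\<bar> + \<bar>E2 x0\<bar> + \<bar>\<Lambda> x0\<bar> + \<bar>D3 x0\<bar> + \<bar>E3 x0\<bar>)"
  have cont: "continuous_on {\<alpha>..\<beta>} g" if "\<And>x. x \<in> interior I \<Longrightarrow> isCont g x" for g :: "real \<Rightarrow> real"
    using that Jint by (intro continuous_at_imp_continuous_on) blast
  have lin: "\<bar>(u * g x + v * h x) - (u * g x0 + v * h x0)\<bar> \<le> c * m"
    if "\<bar>u\<bar> \<le> m" "\<bar>v\<bar> \<le> m" "\<bar>g x - g x0\<bar> < c / 2" "\<bar>h x - h x0\<bar> < c / 2"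
    for u v m x :: real and g h :: "real \<Rightarrow> real"
  proof -
    have "\<bar>u\<bar> * \<bar>g x - g x0\<bar> \<le> m * (c / 2)" "\<bar>v\<bar> * \<bar>h x - h x0\<bar> \<le> m * (c / 2)"
      by (rule mult_mono; use that in linarith)+
    hence "\<bar>u * (g x - g x0)\<bar> \<le> m * (c / 2)" "\<bar>v * (h x - h x0)\<bar> \<le> m * (c / 2)"
      unfolding abs_mult .
    moreover have "(u * g x + v * h x) - (u * g x0 + v * h x0) = u * (g x - g x0) + v * (h x - h x0)"
      by (simp add: algebra_simps)
    moreover have "m * (c / 2) + m * (c / 2) = c * m" by simp
    ultimately show ?thesis by linarith
  qed
  have "arc \<alpha> \<beta> f1 D1 E1 f2 D2 E2 \<Lambda> D3 E3 c A"
  proof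
    show "\<alpha> < \<beta>" "\<beta> - \<alpha> \<le> 1" using e by (auto simp: \<alpha>_def \<beta>_def)
    show "0 < c" "c \<le> 1" using c by auto
    show "1 \<le> A" by (simp add: A_def)
    show "continuous_on {\<alpha>..\<beta>} E1" "continuous_on {\<alpha>..\<beta>} E2" "continuous_on {\<alpha>..\<beta>} E3"
      using der1(3) der2(3) der3(3) by (blast intro: cont)+
    fix u v :: real
    show "(\<forall>x\<in>{\<alpha>..\<beta>}. c * max \<bar>u\<bar> \<bar>v\<bar> \<le> \<bar>u * D1 x + v * D2 x\<bar>) \<or>
      (\<forall>x\<in>{\<alpha>..\<beta>}. c * max \<bar>u\<bar> \<bar>v\<bar> \<le> \<bar>u * E1 x + v * E2 x\<bar>)"
    proof -
      define m where "m = max \<bar>u\<bar> \<bar>v\<bar>"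
      have m: "\<bar>u\<bar> \<le> m" "\<bar>v\<bar> \<le> m" by (simp_all add: m_def)
      have "2 * c * m \<le> \<bar>u * D1 x0 + v * D2 x0\<bar> \<or> 2 * c * m \<le> \<bar>u * E1 x0 + v * E2 x0\<bar>"
        using big[of u v, folded m_def] unfolding le_max_iff_disj .
      thus ?thesis unfolding m_def[symmetric]
      proof
        assume *: "2 * c * m \<le> \<bar>u * D1 x0 + v * D2 x0\<bar>"
        have "c * m \<le> \<bar>u * D1 x + v * D2 x\<bar>" if "x \<in> {\<alpha>..\<beta>}" for x
        proof -
          have "\<bar>D1 x - D1 x0\<bar> < c / 2" "\<bar>D2 x - D2 x0\<bar> < c / 2" using J[OF that] unfolding P_def by blast+
          from lin[OF m this] * show ?thesis by linarith
        qed
        thus "(\<forall>x\<in>{\<alpha>..\<beta>}. c * m \<le> \<bar>u * D1 x + v * D2 x\<bar>) \<or> (\<forall>x\<in>{\<alpha>..\<beta>}. c * m \<le> \<bar>u * E1 x + v * E2 x\<bar>)" by blast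
      next
        assume *: "2 * c * m \<le> \<bar>u * E1 x0 + v * E2 x0\<bar>"
        have "c * m \<le> \<bar>u * E1 x + v * E2 x\<bar>" if "x \<in> {\<alpha>..\<beta>}" for x
        proof -
          have "\<bar>E1 x - E1 x0\<bar> < c / 2" "\<bar>E2 x - E2 x0\<bar> < c / 2" using J[OF that] unfolding P_def by blast+
          from lin[OF m this] * show ?thesis by linarith
        qed
        thus "(\<forall>x\<in>{\<alpha>..\<beta>}. c * m \<le> \<bar>u * D1 x + v * D2 x\<bar>) \<or> (\<forall>x\<in>{\<alpha>..\<beta>}. c * m \<le> \<bar>u * E1 x + v * E2 x\<bar>)" by blast
      qed
    qed
  next
    fix x assume x: "x \<in> {\<alpha>..\<beta>}"
    note xi = Jint[OF x]
    show "(f1 has_real_derivative D1 x) (at x)" "(D1 has_real_derivative E1 x) (at x)"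
      "(f2 has_real_derivative D2 x) (at x)" "(D2 has_real_derivative E2 x) (at x)"
      "(\<Lambda> has_real_derivative D3 x) (at x)" "(D3 has_real_derivative E3 x) (at x)"
      by (intro der1(1,2)[OF xi] der2(1,2)[OF xi] der3(1,2)[OF xi])+
    have Px: "P x" using J[OF x] .
    have le_A: "\<bar>y\<bar> \<le> A" if "\<bar>y - y0\<bar> < c / 2" "\<bar>y0\<bar> \<le> A - 1" for y y0 using that c(2) by linarith
    have abs_sum: "p1 \<le> S \<and> p2 \<le> S \<and> p3 \<le> S \<and> p4 \<le> S \<and> p5 \<le> S \<and> p6 \<le> S \<and> p7 \<le> S \<and> p8 \<le> S \<and> p9 \<le> S"
      if "0 \<le> p1" "0 \<le> p2" "0 \<le> p3" "0 \<le> p4" "0 \<le> p5" "0 \<le> p6" "0 \<le> p7" "0 \<le> p8" "0 \<le> p9"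
        "S = p1 + p2 + p3 + p4 + p5 + p6 + p7 + p8 + p9" for p1 p2 p3 p4 p5 p6 p7 p8 p9 S :: real
      using that by auto
    have A1: "A - 1 = \<bar>f1 x0\<bar> + \<bar>D1 x0\<bar> + \<bar>E1 x0\<bar> + \<bar>f2 x0\<bar> + \<bar>D2 x0\<bar> + \<bar>E2 x0\<bar> + \<bar>\<Lambda> x0\<bar> + \<bar>D3 x0\<bar> + \<bar>E3 x0\<bar>"
      by (simp add: A_def)
    note A_ge = abs_sum[OF abs_ge_zero abs_ge_zero abs_ge_zero abs_ge_zero abs_ge_zero abs_ge_zero
        abs_ge_zero abs_ge_zero abs_ge_zero A1]
    show "\<bar>f1 x\<bar> \<le> A" "\<bar>D1 x\<bar> \<le> A" "\<bar>E1 x\<bar> \<le> A" "\<bar>f2 x\<bar> \<le> A" "\<bar>D2 x\<bar> \<le> A" "\<bar>E2 x\<bar> \<le> A"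
      "\<bar>\<Lambda> x\<bar> \<le> A" "\<bar>D3 x\<bar> \<le> A" "\<bar>E3 x\<bar> \<le> A"
      using Px A_ge unfolding P_def by (blast intro: le_A)+
    have "\<bar>D1 x - D1 x0\<bar> < c / 2" using Px unfolding P_def by blast
    thus "c \<le> \<bar>D1 x\<bar>" using c(1,3) by linarith
  qed
  thus ?thesis
    using e Jint by (intro that[of \<alpha> \<beta> c A]) (auto simp: \<alpha>_def \<beta>_def D1_def E1_def D2_def E2_def D3_def E3_def)
qed

text \<open>An arc requires f1' to be bounded away from 0. If f1' vanishes at the point,
  nondegeneracy gives f2' nonzero there, and the two coordinates exchange roles.\<close>

lemma A2_swap: "A2 I f1 f2 \<psi> \<Lambda> = A2 I f2 f1 \<psi> \<Lambda>"
proof -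
  define S where "S f g x = {a :: int \<times> int. a \<noteq> (0, 0) \<and>
     infdist (of_int (fst a) * f x + of_int (snd a) * g x + \<Lambda> x) \<int> < \<psi> (of_int (max \<bar>fst a\<bar> \<bar>snd a\<bar>))}"
    for f g :: "real \<Rightarrow> real" and x
  have img: "S g f x = prod.swap ` S f g x" for f g x
  proof -
    have "prod.swap a \<in> S g f x" if "a \<in> S f g x" for a f g
      using that by (cases a) (auto simp: S_def max.commute add.commute)
    note swap_mem = this
    show ?thesis
    proof
      show "prod.swap ` S f g x \<subseteq> S g f x" using swap_mem by (rule image_subsetI)
      show "S g f x \<subseteq> prod.swap ` S f g x"
      proof
        fix a assume "a \<in> S g f x"
        hence "prod.swap a \<in> S f g x" by (rule swap_mem)
        thus "a \<in> prod.swap ` S f g x" by (intro image_eqI[of _ _ "prod.swap a"]) simp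
      qed
    qed
  qed
  have "infinite (S f2 f1 x) \<longleftrightarrow> infinite (S f1 f2 x)" for x
    using img[of f1 f2 x] img[of f2 f1 x] finite_imageI by metis
  thus ?thesis unfolding A2_def S_def[symmetric] by simp
qed

lemma A2_mono: "I \<subseteq> I' \<Longrightarrow> A2 I f1 f2 \<psi> \<Lambda> \<subseteq> A2 I' f1 f2 \<psi> \<Lambda>"
  by (auto simp: A2_def)

lemma A2_Int: "A2 I f1 f2 \<psi> \<Lambda> \<inter> U \<subseteq> A2 U f1 f2 \<psi> \<Lambda>"
  by (auto simp: A2_def)

lemma local_content:
  assumes smooth: "C2_on I f1" "C2_on I f2" "C2_on I \<Lambda>" and x0: "x0 \<in> interior I"
    and nd: "nondegenerate_at I f1 f2 x0"
  obtains \<alpha> \<beta> where "\<alpha> < x0" "x0 < \<beta>" "{\<alpha>..\<beta>} \<subseteq> interior I"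
    "\<And>s \<tau>. 0 < s \<Longrightarrow> s \<le> 1 \<Longrightarrow> 2 < \<tau> \<Longrightarrow> 3 < s * (\<tau> + 1) \<Longrightarrow> eventually (\<lambda>q. \<psi> q \<le> q powr - \<tau>) at_top \<Longrightarrow>
      hcontent s (A2 {\<alpha>..\<beta>} f1 f2 \<psi> \<Lambda>) = 0"
    "\<And>s \<tau>. 0 < s \<Longrightarrow> s \<le> 1 \<Longrightarrow> 2 \<le> \<tau> \<Longrightarrow> s * (\<tau> + 1) < 3 \<Longrightarrow> antimono_on {0<..} \<psi> \<Longrightarrow>
      (\<And>N. \<exists>q\<ge>N. q powr - \<tau> \<le> \<psi> q) \<Longrightarrow> hcontent s (A2 {\<alpha>..\<beta>} f1 f2 \<psi> \<Lambda>) \<noteq> 0"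
proof (cases "deriv_in I f1 x0 = 0")
  case False
  obtain \<alpha> \<beta> c A where *: "\<alpha> < x0" "x0 < \<beta>" "{\<alpha>..\<beta>} \<subseteq> interior I"
    "arc \<alpha> \<beta> f1 (deriv_in I f1) (deriv_in I (deriv_in I f1)) f2 (deriv_in I f2) (deriv_in I (deriv_in I f2))
      \<Lambda> (deriv_in I \<Lambda>) (deriv_in I (deriv_in I \<Lambda>)) c A"
    by (rule exists_arc[OF smooth x0 nd False])
  show ?thesis
    by (rule that[OF *(1-3)]) (rule arc.hcontent_A2_null[OF *(4)] arc.hcontent_A2_pos[OF *(4)]; assumption)+
next
  case True
  hence d2: "deriv_in I f2 x0 \<noteq> 0" and nd2: "nondegenerate_at I f2 f1 x0"
    using nd by (auto simp: nondegenerate_at_def)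
  obtain \<alpha> \<beta> c A where *: "\<alpha> < x0" "x0 < \<beta>" "{\<alpha>..\<beta>} \<subseteq> interior I"
    "arc \<alpha> \<beta> f2 (deriv_in I f2) (deriv_in I (deriv_in I f2)) f1 (deriv_in I f1) (deriv_in I (deriv_in I f1))
      \<Lambda> (deriv_in I \<Lambda>) (deriv_in I (deriv_in I \<Lambda>)) c A"
    by (rule exists_arc[OF smooth(2,1,3) x0 nd2 d2])
  show ?thesis
    by (rule that[OF *(1-3)]; subst A2_swap)
       (rule arc.hcontent_A2_null[OF *(4)] arc.hcontent_A2_pos[OF *(4)]; assumption)+
qed

section \<open>From arcs to the whole interval\<close>

lemma countable_interval_boundary:
  fixes I :: "real set"
  assumes "is_interval I"
  shows "countable (I - interior I)"
proof -
  have "I - interior I \<subseteq> {Inf I, Sup I}"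
  proof
    fix x assume x: "x \<in> I - interior I"
    show "x \<in> {Inf I, Sup I}"
    proof (cases "(\<forall>y\<in>I. x \<le> y) \<or> (\<forall>y\<in>I. y \<le> x)")
      case True
      thus ?thesis using x cInf_eq_minimum[of x I] cSup_eq_maximum[of x I] by blast
    next
      case False
      then obtain a b where ab: "a \<in> I" "b \<in> I" "a < x" "x < b" by (meson not_le)
      have "{a<..<b} \<subseteq> I"
      proof
        fix y assume "y \<in> {a<..<b}"
        thus "y \<in> I" using assms ab(1,2) unfolding is_interval_1 by (meson greaterThanLessThan_iff less_imp_le)
      qed
      hence "x \<in> interior I" using ab by (intro interiorI[of "{a<..<b}"]) auto
      thus ?thesis using x by blast
    qed
  qed
  thus ?thesis by (rule countable_subset) simp
qed

lemma hcontent_countable_UN_null: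
  assumes "countable K" "\<And>k. k \<in> K \<Longrightarrow> hcontent s (E k) = 0"
  shows "hcontent s (\<Union>k\<in>K. E k) = 0"
proof (cases "K = {}")
  case False
  hence "(\<Union>k\<in>K. E k) = (\<Union>n::nat. E (from_nat_into K n))"
    using range_from_nat_into[OF False assms(1)] by (metis image_image)
  moreover have "hcontent s (\<Union>n::nat. E (from_nat_into K n)) = 0"
    by (intro hcontent_UN_null assms from_nat_into False)
  ultimately show ?thesis by simp
qed simp

text \<open>Every nondegenerate interior point has an arc around it, and by the Lindelof property
  countably many arcs suffice. What remains is the degenerate set and the endpoints of I, both
  null.\<close>

lemma hcontent_A2_null_global:
  assumes I: "is_interval I" and smooth: "C2_on I f1" "C2_on I f2" "C2_on I \<Lambda>"
    and deg: "hcontent s {x \<in> I. \<not> nondegenerate_at I f1 f2 x} = 0"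
    and s: "0 < s" "s \<le> 1" "2 < \<tau>" "3 < s * (\<tau> + 1)" "eventually (\<lambda>q. \<psi> q \<le> q powr - \<tau>) at_top"
  shows "hcontent s (A2 I f1 f2 \<psi> \<Lambda>) = 0"
proof -
  define \<U> where "\<U> = {U. \<exists>\<alpha> \<beta>. U = {\<alpha><..<\<beta>} \<and> hcontent s (A2 {\<alpha>..\<beta>} f1 f2 \<psi> \<Lambda>) = 0}"
  have "open U" if "U \<in> \<U>" for U using that by (auto simp: \<U>_def)
  then obtain \<U>' where U': "\<U>' \<subseteq> \<U>" "countable \<U>'" "\<Union>\<U>' = \<Union>\<U>" using Lindelof by metis
  have null: "hcontent s (\<Union>U\<in>\<U>'. A2 I f1 f2 \<psi> \<Lambda> \<inter> U) = 0"
  proof (rule hcontent_countable_UN_null[OF U'(2)])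
    fix U assume "U \<in> \<U>'"
    then obtain \<alpha> \<beta> where U: "U = {\<alpha><..<\<beta>}" "hcontent s (A2 {\<alpha>..\<beta>} f1 f2 \<psi> \<Lambda>) = 0" using U'(1) by (auto simp: \<U>_def)
    have "U \<subseteq> {\<alpha>..\<beta>}" using U(1) by auto
    from hcontent_mono[OF order_trans[OF A2_Int[of I f1 f2 \<psi> \<Lambda> U] A2_mono[OF this]], of s] show "hcontent s (A2 I f1 f2 \<psi> \<Lambda> \<inter> U) = 0" using U(2) by simp
  qed
  have "A2 I f1 f2 \<psi> \<Lambda> \<subseteq> ((I - interior I) \<union> {x \<in> I. \<not> nondegenerate_at I f1 f2 x}) \<union> (\<Union>U\<in>\<U>'. A2 I f1 f2 \<psi> \<Lambda> \<inter> U)"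
  proof
    fix x assume x: "x \<in> A2 I f1 f2 \<psi> \<Lambda>"
    show "x \<in> ((I - interior I) \<union> {x \<in> I. \<not> nondegenerate_at I f1 f2 x}) \<union> (\<Union>U\<in>\<U>'. A2 I f1 f2 \<psi> \<Lambda> \<inter> U)"
    proof (cases "x \<in> interior I \<and> nondegenerate_at I f1 f2 x")
      case True
      obtain \<alpha> \<beta> where ab: "\<alpha> < x" "x < \<beta>" "hcontent s (A2 {\<alpha>..\<beta>} f1 f2 \<psi> \<Lambda>) = 0"
        by (rule local_content[OF smooth, of x \<psi>]) (use True s in auto)
      hence "{\<alpha><..<\<beta>} \<in> \<U>" "x \<in> {\<alpha><..<\<beta>}" by (auto simp: \<U>_def)
      hence "x \<in> \<Union>\<U>'" unfolding U'(3) by blast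
      thus ?thesis using x by blast
    qed (use x in \<open>auto simp: A2_def\<close>)
  qed
  hence "hcontent s (A2 I f1 f2 \<psi> \<Lambda>) \<le> hcontent s ((I - interior I) \<union> {x \<in> I. \<not> nondegenerate_at I f1 f2 x})
      + hcontent s (\<Union>U\<in>\<U>'. A2 I f1 f2 \<psi> \<Lambda> \<inter> U)"
    by (rule order_trans[OF hcontent_mono hcontent_Un])
  also have "\<dots> \<le> (hcontent s (I - interior I) + hcontent s {x \<in> I. \<not> nondegenerate_at I f1 f2 x}) + 0"
    unfolding null by (intro add_mono hcontent_Un order_refl)
  also have "\<dots> = 0" using hcontent_countable_null[OF countable_interval_boundary[OF I] s(1)] deg by simp
  finally show ?thesis by simp
qed

section \<open>Consequences of the lower order and the final comparison\<close>

lemma lower_order_greater_imp: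
  assumes "\<And>q. 0 < q \<Longrightarrow> 0 < \<psi> q" "ereal \<tau> < lower_order \<psi>"
  shows "eventually (\<lambda>q. \<psi> q \<le> q powr - \<tau>) at_top"
proof -
  have "eventually (\<lambda>q. ereal \<tau> < ereal (- ln (\<psi> q) / ln q)) at_top"
    using assms(2) unfolding lower_order_def by (rule less_LiminfD)
  moreover have "eventually (\<lambda>q::real. 1 < q) at_top" by (rule eventually_gt_at_top)
  ultimately show ?thesis
  proof eventually_elim
    case (elim q)
    have "0 < ln q" using elim by simp
    moreover have "\<tau> < - ln (\<psi> q) / ln q" using elim(1) by (simp only: less_ereal.simps)
    ultimately have "\<tau> * ln q < - ln (\<psi> q)" by (simp only: pos_less_divide_eq)
    hence "ln (\<psi> q) < ln (q powr - \<tau>)" using elim by (simp add: ln_powr)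
    hence "\<psi> q < q powr - \<tau>" using assms(1)[of q] elim by (subst (asm) ln_less_cancel_iff) auto
    thus ?case by simp
  qed
qed

lemma lower_order_less_imp:
  assumes "\<And>q. 0 < q \<Longrightarrow> 0 < \<psi> q" "lower_order \<psi> < ereal \<tau>"
  shows "\<exists>q\<ge>N. q powr - \<tau> \<le> \<psi> q"
proof (rule ccontr)
  assume "\<not> ?thesis"
  hence less: "\<psi> q < q powr - \<tau>" if "N \<le> q" for q using that by force
  have "eventually (\<lambda>q::real. max 1 N < q) at_top" by (rule eventually_gt_at_top)
  hence "eventually (\<lambda>q. ereal \<tau> \<le> ereal (- ln (\<psi> q) / ln q)) at_top"
  proof eventually_elim
    case (elim q)
    have q: "1 < q" "0 < \<psi> q" using elim assms(1)[of q] by auto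
    have "\<psi> q < q powr - \<tau>" using less[of q] elim by simp
    hence "ln (\<psi> q) < ln (q powr - \<tau>)" using q by (subst ln_less_cancel_iff) auto
    hence "\<tau> * ln q \<le> - ln (\<psi> q)" using q by (simp add: ln_powr)
    hence "\<tau> \<le> - ln (\<psi> q) / ln q" by (subst pos_le_divide_eq) (use q in auto)
    thus ?case by (simp only: ereal_less_eq)
  qed
  hence "ereal \<tau> \<le> lower_order \<psi>" unfolding lower_order_def by (rule Liminf_bounded)
  thus False using assms(2) by simp
qed

text \<open>Supplies a nondegenerate interior point: a null set for exponent 1 contains no interval
  of positive length.\<close>

lemma not_subset_null:
  fixes U :: "real set"
  assumes "open U" "U \<noteq> {}" "hcontent 1 D = 0"
  shows "\<not> U \<subseteq> D"
proof
  assume UD: "U \<subseteq> D"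
  obtain x where "x \<in> U" using assms(2) by blast
  then obtain e where e: "0 < e" "cball x e \<subseteq> U" using assms(1) open_contains_cball by blast
  have "{x - e..x + e} \<subseteq> D"
    unfolding cball_eq_atLeastAtMost[symmetric] using e(2) UD by (rule order_trans)
  have "ennreal (2 * e) = emeasure lborel {x - e..x + e}" using e by simp
  also have "\<dots> \<le> hcontent 1 {x - e..x + e}" by (rule emeasure_le_hcontent) simp
  also have "\<dots> \<le> hcontent 1 D" by (rule hcontent_mono) fact
  finally show False using e assms(3) by simp
qed

theorem theorem2:
  fixes \<psi> f1 f2 \<Lambda> :: "real \<Rightarrow> real" and I :: "real set"
  assumes psi_pos: "\<And>q. 0 < q \<Longrightarrow> 0 < \<psi> q"
    and psi_decreasing: "antimono_on {0<..} \<psi>"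
    and tau: "2 \<le> lower_order \<psi>"
    and interval: "is_interval I" "interior I \<noteq> {}"
    and smooth: "C2_on I f1" "C2_on I f2" "C2_on I \<Lambda>"
    and nondegenerate: "{x \<in> I. \<not> nondegenerate_at I f1 f2 x} = {} \<or>
          hausdorff_dim {x \<in> I. \<not> nondegenerate_at I f1 f2 x} < 3 / (lower_order \<psi> + 1)"
  shows "hausdorff_dim (A2 I f1 f2 \<psi> \<Lambda>) = 3 / (lower_order \<psi> + 1)"
proof (rule antisym)
  define T where "T = lower_order \<psi>"
  define D where "D = {x \<in> I. \<not> nondegenerate_at I f1 f2 x}"
  have deg: "hcontent s D = 0" if "3 / (T + 1) \<le> ereal s" for s
    using nondegenerate hausdorff_dim_less_imp_null[of D s] that
    unfolding D_def[symmetric] T_def[symmetric] by auto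
  consider t where "T = ereal t" "2 \<le> t" | "T = \<infinity>" using tau unfolding T_def[symmetric] by (cases T) auto
  note T_cases = this
  have "hausdorff_dim (A2 I f1 f2 \<psi> \<Lambda>) \<le> 3 / (T + 1)"
  proof (rule ccontr)
    assume "\<not> ?thesis"
    hence "3 / (T + 1) < hausdorff_dim (A2 I f1 f2 \<psi> \<Lambda>)" by (simp only: not_le)
    then obtain s where s: "3 / (T + 1) < ereal s" "ereal s < hausdorff_dim (A2 I f1 f2 \<psi> \<Lambda>)"
      using ereal_dense2 by blast
    have s0: "0 < s"
    proof -
      have "0 \<le> 3 / (T + 1)" by (cases rule: T_cases) auto
      hence "0 < ereal s" using s(1) by (rule le_less_trans)
      thus ?thesis by simp
    qed
    have "hcontent s (A2 I f1 f2 \<psi> \<Lambda>) = 0"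
    proof (cases "1 < s")
      case False
      \<comment> \<open>For s <= 1 the inequality 3 / (T + 1) < s forces both T > 2 and T > 3 / s -
        1, so some real \<tau> below T meets the strict hypotheses of the upper bound, even when T
        is infinite.\<close>
      have "ereal (max 2 (3 / s - 1)) < T"
        using s0 s(1) False by (cases rule: T_cases) (auto simp: field_simps)
      then obtain \<tau> where "ereal (max 2 (3 / s - 1)) < ereal \<tau>" "ereal \<tau> < T" using ereal_dense2 by blast
      hence \<tau>: "max 2 (3 / s - 1) < \<tau>" "ereal \<tau> < T" by (simp_all only: less_ereal.simps)
      show ?thesis
      proof (rule hcontent_A2_null_global[OF interval(1) smooth])
        show "hcontent s {x \<in> I. \<not> nondegenerate_at I f1 f2 x} = 0" using deg[of s] s(1) by (simp add: D_def)
        show "3 < s * (\<tau> + 1)" using \<tau>(1) s0 by (simp add: field_simps)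
        show "eventually (\<lambda>q. \<psi> q \<le> q powr - \<tau>) at_top"
          by (rule lower_order_greater_imp[OF psi_pos \<tau>(2)[unfolded T_def]])
      qed (use s0 False \<tau> in auto)
    qed (rule hcontent_bounded_null)
    from hausdorff_dim_le[OF this s0] show False using s(2) by simp
  qed
  thus "hausdorff_dim (A2 I f1 f2 \<psi> \<Lambda>) \<le> 3 / (lower_order \<psi> + 1)" unfolding T_def .
  have "3 / (T + 1) \<le> hausdorff_dim (A2 I f1 f2 \<psi> \<Lambda>)"
  proof (cases rule: T_cases)
    case (1 t)
    have t3: "3 / (T + 1) = ereal (3 / (t + 1))" using 1 by simp
    \<comment> \<open>The lower order is at least 2, so the critical exponent is at most 1 and the
      degenerate set is null for exponent 1.\<close>
    have "hcontent 1 D = 0" using 1 by (intro deg) (simp add: t3)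
    hence "\<not> interior I \<subseteq> D" using interval(2) by (intro not_subset_null) auto
    then obtain x0 where x0: "x0 \<in> interior I" "nondegenerate_at I f1 f2 x0"
      using interior_subset unfolding D_def by blast
    obtain \<alpha> \<beta> where J: "{\<alpha>..\<beta>} \<subseteq> interior I"
      and pos: "\<And>s \<tau>. 0 < s \<Longrightarrow> s \<le> 1 \<Longrightarrow> 2 \<le> \<tau> \<Longrightarrow> s * (\<tau> + 1) < 3 \<Longrightarrow> antimono_on {0<..} \<psi> \<Longrightarrow>
        (\<And>N. \<exists>q\<ge>N. q powr - \<tau> \<le> \<psi> q) \<Longrightarrow> hcontent s (A2 {\<alpha>..\<beta>} f1 f2 \<psi> \<Lambda>) \<noteq> 0"
      by (rule local_content[OF smooth x0, of \<psi>]) blast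
    have sub: "A2 {\<alpha>..\<beta>} f1 f2 \<psi> \<Lambda> \<subseteq> A2 I f1 f2 \<psi> \<Lambda>"
      using J interior_subset by (intro A2_mono) blast
    show "3 / (T + 1) \<le> hausdorff_dim (A2 I f1 f2 \<psi> \<Lambda>)"
      unfolding t3
    proof (rule hausdorff_dim_ge)
      fix s assume s: "0 < s" "s < 3 / (t + 1)"
      have st: "t < 3 / s - 1" using s 1 by (simp add: field_simps)
      \<comment> \<open>A \<tau> strictly above the lower order is exceeded by the exponent only
        finitely far out, so \<open>q powr - \<tau> \<le> \<psi> q\<close> recurs; staying below 3 /
        s - 1 keeps s subcritical.\<close>
      then obtain \<tau> where \<tau>: "t < \<tau>" "\<tau> < 3 / s - 1" using dense by blast
      have "3 / (t + 1) \<le> 1" using 1 by simp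
      have "hcontent s (A2 {\<alpha>..\<beta>} f1 f2 \<psi> \<Lambda>) \<noteq> 0"
      proof (rule pos[OF s(1) _ _ _ psi_decreasing])
        show "s \<le> 1" using s(2) \<open>3 / (t + 1) \<le> 1\<close> by linarith
        show "2 \<le> \<tau>" using 1 \<tau> by simp
        show "s * (\<tau> + 1) < 3" using \<tau>(2) s(1) by (simp add: field_simps)
        show "\<exists>q\<ge>N. q powr - \<tau> \<le> \<psi> q" for N
          by (rule lower_order_less_imp[OF psi_pos]) (use 1 \<tau> in \<open>auto simp: T_def[symmetric]\<close>)
      qed
      thus "hcontent s (A2 I f1 f2 \<psi> \<Lambda>) \<noteq> 0" using hcontent_mono[OF sub, of s] by auto
    qed
  next
    case 2
    thus "3 / (T + 1) \<le> hausdorff_dim (A2 I f1 f2 \<psi> \<Lambda>)" using hausdorff_dim_nonneg by simp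
  qed
  thus "3 / (lower_order \<psi> + 1) \<le> hausdorff_dim (A2 I f1 f2 \<psi> \<Lambda>)" unfolding T_def .
qed

end
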